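(* Fix $\alpha,\beta\in(0,1)$, $c_0>0$ and $\gamma\ge 1$. Let $p_n\ge n$ with $p_n/n\to\gamma$, $r_n=n^{1-\beta}$, $\delta_n=n^{-\alpha}$, and write $p=p_n$, $r=r_n$, $\delta=\delta_n$. Let $\Sigma^*=\Sigma^*_n\in\mathbb{R}^{p\times p}$ be a covariance matrix. Given vectors $X_1,\dots,X_n\in\mathbb{R}^p$, consider testing $H_0^{(n)}:X_i\stackrel{iid}{\sim}N(0,\Sigma^* )$ versus the alternative $H_1^{(n)}:(X_i\mid Q)\stackrel{iid}{\sim}N\big(0,\Sigma^*+\tfrac{\delta}{1-\delta}QQ'\big)$, where $Q$ is uniformly distributed over the Stiefel manifold $\mathbb{S}(p,r)$. If $\alpha+\beta>1$ and $\lambda_{\min}(\Sigma^* )\ge c_0$, then as $n\to\infty$, the sum of Type I and Type II errors of any test tends to $1$ (i.e. the infimum over all tests of the sum of Type I and Type II errors tends to $1$).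
   Context: $\mathbb{S}(p,r)=\{Q\in\mathbb{R}^{p\times r}:Q'Q=I_r\}$ is the Stiefel manifold; "uniform" means the law invariant under left multiplication by orthogonal $p\times p$ matrices. $r_n=n^{1-\beta}$ is understood as rounded to an integer. $\lambda_{\min}(A)$ is the smallest eigenvalue of the symmetric matrix $A$. Under $H_1^{(n)}$ the law of the data is the mixture over $Q$ (one $Q$ is drawn, common to all $i$). The Type I error of a test is its rejection probability under $H_0^{(n)}$; the Type II error is its acceptance probability under $H_1^{(n)}$. *)

theory Defs
  imports
    "HOL-Probability.Probability"
    "Jordan_Normal_Form.Gauss_Jordan_Elimination"
    "Jordan_Normal_Form.Char_Poly"
begin

text \<open>The dimension p grows with n, so matrices are those of \<^theory>\<open>Jordan_Normal_Form.Matrix\<close>,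
  with explicit carriers, and a random vector in R^p is an element of the product measurable
  space over the index set {..<p}, turned into a vector by \<^const>\<open>Matrix.vec\<close>.\<close>

definition covariance_matrix :: "nat \<Rightarrow> real mat \<Rightarrow> bool" where
  "covariance_matrix p S \<longleftrightarrow>
     S \<in> carrier_mat p p \<and> S\<^sup>T = S \<and>
     (\<forall>v \<in> carrier_vec p. 0 \<le> scalar_prod v (S *\<^sub>v v))"

text \<open>Only applied to symmetric matrices of positive dimension, which have a finite nonempty set of
  real eigenvalues.\<close>

definition lambda_min :: "real mat \<Rightarrow> real" where
  "lambda_min A = Min {k. eigenvalue A k}"

text \<open>The nondegenerate Gaussian law N(0, S) on R^p, given by its Lebesgue density; meaningful for
  positive definite S only.\<close>

definition gaussian :: "nat \<Rightarrow> real mat \<Rightarrow> (nat \<Rightarrow> real) measure" where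
  "gaussian p S =
     density (\<Pi>\<^sub>M j\<in>{..<p}. lborel)
       (\<lambda>x. ennreal
          (1 / sqrt ((2 * pi) ^ p * Determinant.det S) *
           exp (- (scalar_prod (Matrix.vec p x) (the (mat_inverse S) *\<^sub>v Matrix.vec p x)) / 2)))"

text \<open>A data point \<open>\<omega>\<close> has \<open>\<omega> i\<close> as its (i+1)-st sample vector.\<close>

definition data_space :: "nat \<Rightarrow> nat \<Rightarrow> (nat \<Rightarrow> nat \<Rightarrow> real) measure" where
  "data_space n p = (\<Pi>\<^sub>M i\<in>{..<n}. \<Pi>\<^sub>M j\<in>{..<p}. borel)"

definition iid_gaussian :: "nat \<Rightarrow> nat \<Rightarrow> real mat \<Rightarrow> (nat \<Rightarrow> nat \<Rightarrow> real) measure" where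
  "iid_gaussian n p S = (\<Pi>\<^sub>M i\<in>{..<n}. gaussian p S)"

definition stiefel :: "nat \<Rightarrow> nat \<Rightarrow> real mat set" where
  "stiefel p r = {Q \<in> carrier_mat p r. Q\<^sup>T * Q = 1\<^sub>m r}"

text \<open>The Stiefel manifold with its Borel sigma-algebra, that is, the trace of the Borel
  sigma-algebra of the space of matrices, pulled back along the matrix entries.\<close>

definition stiefel_space :: "nat \<Rightarrow> nat \<Rightarrow> real mat measure" where
  "stiefel_space p r =
     vimage_algebra (stiefel p r) (\<lambda>Q. \<lambda>ij\<in>{..<p} \<times> {..<r}. Q $$ ij)
       (\<Pi>\<^sub>M ij\<in>{..<p} \<times> {..<r}. borel)"

text \<open>\<open>stiefel p p\<close> is the orthogonal group.\<close>

definition uniform_stiefel :: "nat \<Rightarrow> nat \<Rightarrow> real mat measure \<Rightarrow> bool" where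
  "uniform_stiefel p r \<mu> \<longleftrightarrow>
     prob_space \<mu> \<and> sets \<mu> = sets (stiefel_space p r) \<and>
     (\<forall>U \<in> stiefel p p. distr \<mu> \<mu> (\<lambda>Q. U * Q) = \<mu>)"

definition H0_law :: "nat \<Rightarrow> nat \<Rightarrow> real mat \<Rightarrow> (nat \<Rightarrow> nat \<Rightarrow> real) measure" where
  "H0_law n p S = iid_gaussian n p S"

definition H1_law ::
  "nat \<Rightarrow> nat \<Rightarrow> real \<Rightarrow> real mat \<Rightarrow> real mat measure \<Rightarrow> (nat \<Rightarrow> nat \<Rightarrow> real) measure" where
  "H1_law n p \<delta> S \<mu> =
     \<mu> \<bind> (\<lambda>Q. iid_gaussian n p (S + (\<delta> / (1 - \<delta>)) \<cdot>\<^sub>m (Q * Q\<^sup>T)))"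

text \<open>Randomized tests: \<open>\<phi> \<omega>\<close> is the probability of rejecting the null hypothesis upon observing
  \<open>\<omega>\<close>. Nonrandomized tests are the indicator functions of their rejection regions.\<close>

definition tests :: "nat \<Rightarrow> nat \<Rightarrow> ((nat \<Rightarrow> nat \<Rightarrow> real) \<Rightarrow> real) set" where
  "tests n p =
     {\<phi> \<in> borel_measurable (data_space n p). \<forall>\<omega> \<in> space (data_space n p). 0 \<le> \<phi> \<omega> \<and> \<phi> \<omega> \<le> 1}"

definition type_I_error ::
  "(nat \<Rightarrow> nat \<Rightarrow> real) measure \<Rightarrow> ((nat \<Rightarrow> nat \<Rightarrow> real) \<Rightarrow> real) \<Rightarrow> real" where
  "type_I_error P0 \<phi> = (\<integral>\<omega>. \<phi> \<omega> \<partial>P0)"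

definition type_II_error ::
  "(nat \<Rightarrow> nat \<Rightarrow> real) measure \<Rightarrow> ((nat \<Rightarrow> nat \<Rightarrow> real) \<Rightarrow> real) \<Rightarrow> real" where
  "type_II_error P1 \<phi> = (\<integral>\<omega>. (1 - \<phi> \<omega>) \<partial>P1)"

end

theory Submission
  imports Defs
begin

text \<open>
  With L the likelihood ratio of the mixture, the sum of the two errors of any test is at least
  1 - sqrt (E L^2 - 1) under the null. Here E L^2 is an average over two independent draws Q and W
  of a power of a Gaussian integral, which equals det (I - M' M) raised to -n/2 with
  M = t Q' \<Sigma>^-1 W and t = \<delta> / (1 - \<delta>); Hadamard's inequality bounds it by the exponential of
  s g(W), where s = n t^2 and g(W) is the squared Frobenius norm of Q' \<Sigma>^-1 W.

  The exponential moment of g over W only uses invariance under rotations in coordinate planes: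
  comparing W with its images under rotations by a small angle and by its negative gives,
  after summation over all planes, (p - O(s)) E (g exp (s g)) \<le> O(r^2) E exp (s g). Since
  exp (s g) - 1 \<le> s g exp (s g), E L^2 - 1 is of order s r^2 / p \<le> t^2 r^2, which is
  about n raised to 2 (1 - \<alpha> - \<beta>) and tends to 0.
\<close>

section \<open>Determinants and Gaussian integrals of positive definite forms\<close>

text \<open>The uniform law is known only through its invariance, so no density or Gaussian
  representation of W is at hand; small rotations take the place of integration by parts. Summed
  over the coordinate planes, the second-order change of g behaves like its Laplacian and the
  squared first-order change like its squared gradient. With N = \<Sigma>^-1 Q Q' \<Sigma>^-1 and g
  (W) = tr (W' N W), the former is a multiple of r tr N - p g and the latter at most a multiple of
  |N| g, so that the estimate closes in E (g exp (s g)). Q is held fixed all the while; the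
  resulting bound is uniform in Q. The second moment can be infinite for large t: the product of two
  likelihood ratios and the null density is integrable only if A^-1 + B^-1 - \<Sigma>^-1 is positive
  definite, A and B being the two spiked covariances. The condition t \<le> c / 2 secures this when
  \<Sigma> \<ge> c. The proof never diagonalizes a matrix; Schur complements and completed squares
  do the work.\<close>

lemma det_one_minus_mult_commute:
  fixes U V :: "'a :: idom mat"
  assumes U: "U \<in> carrier_mat p r" and V: "V \<in> carrier_mat r p"
  shows "Determinant.det (1\<^sub>m p - U * V) = Determinant.det (1\<^sub>m r - V * U)"
proof -
  let ?L = "four_block_mat (1\<^sub>m p) (0\<^sub>m p r) V (1\<^sub>m r)"
  let ?X = "four_block_mat (1\<^sub>m p - U * V) U (0\<^sub>m r p) (1\<^sub>m r)"
  let ?Y = "four_block_mat (1\<^sub>m p) U (0\<^sub>m r p) (1\<^sub>m r - V * U)"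
  have c: "?L \<in> carrier_mat (p + r) (p + r)" "?X \<in> carrier_mat (p + r) (p + r)"
    "?Y \<in> carrier_mat (p + r) (p + r)"
    using U V by auto
  \<comment> \<open>Sylvester's identity: the block matrix with rows (1, U) and (V, 1) has two
    factorizations into block triangular matrices, and comparing their determinants gives the
    claim.\<close>
  have "?X * ?L = four_block_mat (1\<^sub>m p) U V (1\<^sub>m r)"
    using U V by (subst mult_four_block_mat[of _ p p _ r _ r _ _ p _ r]) auto
  moreover have "?L * ?Y = four_block_mat (1\<^sub>m p) U V (1\<^sub>m r)"
    using U V by (subst mult_four_block_mat[of _ p p _ r _ r _ _ p _ r]) auto
  ultimately have "Determinant.det ?X * Determinant.det ?L
      = Determinant.det ?L * Determinant.det ?Y"
    using c by (metis det_mult)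
  moreover have "Determinant.det ?L = 1"
    using V by (subst det_four_block_mat_upper_right_zero[of _ p _ r]) auto
  moreover have "Determinant.det ?X = Determinant.det (1\<^sub>m p - U * V)"
    using U V by (subst det_four_block_mat_lower_left_zero[of _ p _ r]) auto
  moreover have "Determinant.det ?Y = Determinant.det (1\<^sub>m r - V * U)"
    using U V by (subst det_four_block_mat_lower_left_zero[of _ p _ r]) auto
  ultimately show ?thesis by simp
qed

text \<open>One step of Gaussian elimination with the last index as pivot: \<open>?U\<close> holds
  the Schur complement, \<open>?L\<close> the multipliers of the last row. Eliminating the last
  index rather than the first leaves the other indices unshifted.\<close>

lemma det_schur_complement:
  fixes b :: "nat \<Rightarrow> nat \<Rightarrow> 'a :: field"
  assumes nz: "b p p \<noteq> 0"
  shows "Determinant.det (mat (Suc p) (Suc p) (\<lambda>(i, j). b i j)) =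
    b p p * Determinant.det (mat p p (\<lambda>(i, j). b i j - b i p * b p j / b p p))"
proof -
  let ?S = "mat p p (\<lambda>(i, j). b i j - b i p * b p j / b p p)"
  let ?U = "four_block_mat ?S (mat p 1 (\<lambda>(i, j). b i p)) (0\<^sub>m 1 p) (mat 1 1 (\<lambda>(i, j). b p p))"
  let ?L = "four_block_mat (1\<^sub>m p) (0\<^sub>m p 1) (mat 1 p (\<lambda>(i, j). b p j / b p p)) (1\<^sub>m 1)"
  have c: "?U \<in> carrier_mat (p + 1) (p + 1)" "?L \<in> carrier_mat (p + 1) (p + 1)"
    by auto
  have UL: "mat (Suc p) (Suc p) (\<lambda>(i, j). b i j) = ?U * ?L"
    apply (subst mult_four_block_mat[of _ p p _ 1 _ 1 _ _ p _ 1])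
    using nz by (auto intro!: eq_matI simp: scalar_prod_def less_Suc_eq)
  have "Determinant.det (mat (Suc p) (Suc p) (\<lambda>(i, j). b i j))
      = Determinant.det ?U * Determinant.det ?L"
    unfolding UL by (rule det_mult[OF c])
  moreover have "Determinant.det ?U = Determinant.det ?S * b p p"
    by (subst det_four_block_mat_lower_left_zero[of _ p _ 1]) (auto simp: det_single)
  moreover have "Determinant.det ?L = 1"
    by (subst det_four_block_mat_upper_right_zero[of _ p _ 1]) auto
  ultimately show ?thesis by simp
qed

text \<open>With a coefficient function instead of a matrix, the Schur complement on the first p
  indices needs no change of type, and \<open>x\<close> can be a point of the product space
  itself.\<close>

definition quad_form :: "nat \<Rightarrow> (nat \<Rightarrow> nat \<Rightarrow> real) \<Rightarrow> (nat \<Rightarrow> real) \<Rightarrow> real" where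
  "quad_form p b x = (\<Sum>i<p. \<Sum>j<p. b i j * x i * x j)"

definition pos_def :: "nat \<Rightarrow> (nat \<Rightarrow> nat \<Rightarrow> real) \<Rightarrow> bool" where
  "pos_def p b \<longleftrightarrow> (\<forall>i<p. \<forall>j<p. b i j = b j i) \<and>
     (\<forall>x. (\<exists>i<p. x i \<noteq> 0) \<longrightarrow> 0 < quad_form p b x)"

text \<open>Completing the square in the coordinate \<open>x p\<close>.\<close>

lemma quad_form_Suc:
  assumes sym: "\<And>i. i < p \<Longrightarrow> b p i = b i p" and nz: "b p p \<noteq> 0"
  shows "quad_form (Suc p) b x =
    quad_form p (\<lambda>i j. b i j - b i p * b p j / b p p) x +
    b p p * (x p + (\<Sum>i<p. b i p * x i) / b p p)\<^sup>2"
proof -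
  define c where "c = (\<Sum>i<p. b i p * x i)"
  have c1: "(\<Sum>j<p. b p j * x p * x j) = x p * c"
    unfolding c_def sum_distrib_left by (rule sum.cong) (auto simp: sym)
  have c2: "(\<Sum>i<p. b i p * x i * x p) = x p * c"
    unfolding c_def sum_distrib_left by (rule sum.cong) auto
  have "c * c = (\<Sum>i<p. \<Sum>j<p. b i p * b p j * x i * x j)"
    unfolding c_def sum_product by (intro sum.cong refl) (auto simp: sym)
  then have c3: "c\<^sup>2 / b p p = (\<Sum>i<p. \<Sum>j<p. b i p * b p j / b p p * x i * x j)"
    by (simp add: power2_eq_square sum_divide_distrib)
  have "quad_form (Suc p) b x = quad_form p b x + 2 * (x p * c) + b p p * x p * x p"
    by (simp add: quad_form_def sum.distrib c1 c2)
  moreover have "quad_form p (\<lambda>i j. b i j - b i p * b p j / b p p) x = quad_form p b x - c\<^sup>2 / b p p"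
    unfolding c3 by (simp add: quad_form_def left_diff_distrib sum_subtractf)
  ultimately show ?thesis
    using nz unfolding c_def[symmetric] by (simp add: power2_eq_square distrib_left distrib_right add_divide_distrib)
qed

lemma quad_form_cong: "(\<And>i. i < p \<Longrightarrow> x i = y i) \<Longrightarrow> quad_form p b x = quad_form p b y"
  by (simp add: quad_form_def)

lemma pos_def_diag_pos:
  assumes "pos_def p b" "k < p"
  shows "0 < b k k"
proof -
  let ?x = "\<lambda>i. if i = k then 1 else 0 :: real"
  have "0 < quad_form p b ?x"
    using assms by (auto simp: pos_def_def)
  also have "quad_form p b ?x = b k k"
  proof -
    have "quad_form p b ?x = (\<Sum>i<p. \<Sum>j<p. if j = k then (if i = k then b k k else 0) else 0)"
      unfolding quad_form_def by (intro sum.cong) auto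
    then show ?thesis using assms(2) by simp
  qed
  finally show ?thesis .
qed

text \<open>The last coordinate of \<open>?y\<close> annihilates the completed square of
  \<open>quad_form_Suc\<close>, so every nonzero value of the reduced form is a value of the
  original one at a nonzero vector.\<close>

lemma pos_def_schur_complement:
  assumes "pos_def (Suc p) b"
  shows "pos_def p (\<lambda>i j. b i j - b i p * b p j / b p p)"
  unfolding pos_def_def
proof safe
  fix i j assume "i < p" "j < p"
  then show "b i j - b i p * b p j / b p p = b j i - b j p * b p i / b p p"
    using assms by (auto simp: pos_def_def)
next
  fix x i assume i: "i < p" "x i \<noteq> (0 :: real)"
  have pp: "b p p > 0" using pos_def_diag_pos[OF assms] by simp
  have sym: "b p i = b i p" if "i < p" for i using assms that by (auto simp: pos_def_def)
  let ?y = "x(p := - (\<Sum>i<p. b i p * x i) / b p p)"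
  have "\<exists>i<Suc p. ?y i \<noteq> 0"
    using i by (intro exI[of _ i]) simp
  then have "0 < quad_form (Suc p) b ?y"
    using assms unfolding pos_def_def by blast
  also have "\<dots> = quad_form p (\<lambda>i j. b i j - b i p * b p j / b p p) ?y"
    using pp by (subst quad_form_Suc) (auto simp: sym)
  also have "\<dots> = quad_form p (\<lambda>i j. b i j - b i p * b p j / b p p) x"
    by (rule quad_form_cong) auto
  finally show "0 < quad_form p (\<lambda>i j. b i j - b i p * b p j / b p p) x" .
qed

lemma nn_integral_gaussian_shift:
  fixes a c :: real
  assumes "0 < a"
  shows "(\<integral>\<^sup>+y. ennreal (exp (- (a * (y + c)\<^sup>2) / 2)) \<partial>lborel) = ennreal (sqrt (2 * pi / a))"
proof -
  have s: "0 < 1 / sqrt a" using assms by simp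
  have "exp (- (a * (y + c)\<^sup>2) / 2) = sqrt (2 * pi / a) * normal_density (- c) (1 / sqrt a) y" for y
  proof -
    have "(1 / sqrt a)\<^sup>2 = 1 / a" using assms by (simp add: power_divide)
    moreover have "sqrt (2 * pi / a) > 0" using assms by simp
    moreover have "- (y + c)\<^sup>2 / (2 * (1 / a)) = - (a * (y + c)\<^sup>2) / 2" by simp
    ultimately show ?thesis using assms by (simp add: normal_density_def)
  qed
  then have "(\<integral>\<^sup>+y. ennreal (exp (- (a * (y + c)\<^sup>2) / 2)) \<partial>lborel)
     = (\<integral>\<^sup>+y. ennreal (sqrt (2 * pi / a)) * ennreal (normal_density (- c) (1 / sqrt a) y) \<partial>lborel)"
    using assms by (simp add: ennreal_mult)
  also have "\<dots> = ennreal (sqrt (2 * pi / a)) * (\<integral>\<^sup>+y. ennreal (normal_density (- c) (1 / sqrt a) y) \<partial>lborel)"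
    by (rule nn_integral_cmult) auto
  also have "(\<integral>\<^sup>+y. ennreal (normal_density (- c) (1 / sqrt a) y) \<partial>lborel) = 1"
    using s by (subst nn_integral_eq_integral) auto
  finally show ?thesis by simp
qed

text \<open>All three claims obey the same recursion under elimination of the last index: the
  determinant gains the factor \<open>b p p\<close>, the other diagonal entries can only decrease in
  passing to the Schur complement, and integrating out the last coordinate leaves a shifted
  one-dimensional Gaussian integral.\<close>

lemma
  assumes "pos_def p b"
  shows det_pos_def_pos: "0 < Determinant.det (mat p p (\<lambda>(i, j). b i j))" (is ?pos)
    and hadamard_ineq: "Determinant.det (mat p p (\<lambda>(i, j). b i j)) \<le> (\<Prod>i<p. b i i)" (is ?had)
    and nn_integral_exp_quad_form:
      "(\<integral>\<^sup>+x. ennreal (exp (- quad_form p b x / 2)) \<partial>(\<Pi>\<^sub>M j\<in>{..<p}. lborel)) =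
       ennreal (sqrt ((2 * pi) ^ p / Determinant.det (mat p p (\<lambda>(i, j). b i j))))" (is ?int)
proof -
  have "?pos \<and> ?had \<and> ?int"
    using assms
  proof (induction p arbitrary: b)
    case 0
    interpret product_sigma_finite "\<lambda>_::nat. lborel :: real measure" ..
    have "Determinant.det (mat 0 0 (\<lambda>(i, j). b i j)) = 1"
      by (rule det_dim_zero) simp
    then show ?case
      by (simp add: quad_form_def PiM_empty)
  next
    case (Suc p)
    interpret product_sigma_finite "\<lambda>_::nat. lborel :: real measure" ..
    let ?b = "\<lambda>i j. b i j - b i p * b p j / b p p"
    let ?D = "Determinant.det (mat p p (\<lambda>(i, j). ?b i j))"
    note IH = Suc.IH[OF pos_def_schur_complement[OF Suc.prems]]
    have pp: "b p p > 0" using pos_def_diag_pos[OF Suc.prems] by simp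
    have sym: "b p i = b i p" if "i < p" for i using Suc.prems that by (auto simp: pos_def_def)
    have D: "Determinant.det (mat (Suc p) (Suc p) (\<lambda>(i, j). b i j)) = b p p * ?D"
      using pp by (intro det_schur_complement) auto
    have Dpos: "0 < ?D" using IH by blast
    have "?D \<le> (\<Prod>i<p. ?b i i)" using IH by blast
    also have "\<dots> \<le> (\<Prod>i<p. b i i)"
    proof (rule prod_mono)
      fix i assume "i \<in> {..<p}"
      then show "0 \<le> ?b i i \<and> ?b i i \<le> b i i"
        using pos_def_diag_pos[OF pos_def_schur_complement[OF Suc.prems], of i] pp sym[of i]
        by (auto simp: power2_eq_square[symmetric])
    qed
    finally have had: "?D \<le> (\<Prod>i<p. b i i)" .
    let ?c = "\<lambda>x. (\<Sum>i<p. b i p * x i) / b p p"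
    have "(\<integral>\<^sup>+x. ennreal (exp (- quad_form (Suc p) b x / 2)) \<partial>(\<Pi>\<^sub>M j\<in>{..<Suc p}. lborel))
      = (\<integral>\<^sup>+x. (\<integral>\<^sup>+y. ennreal (exp (- quad_form (Suc p) b (x(p := y)) / 2)) \<partial>lborel)
          \<partial>(\<Pi>\<^sub>M j\<in>{..<p}. lborel))"
      unfolding lessThan_Suc
      by (rule product_nn_integral_insert) (auto simp: quad_form_def)
    also have "\<dots> = (\<integral>\<^sup>+x. ennreal (exp (- quad_form p ?b x / 2)) * ennreal (sqrt (2 * pi / b p p))
          \<partial>(\<Pi>\<^sub>M j\<in>{..<p}. lborel))"
    proof (rule nn_integral_cong)
      fix x
      have "quad_form (Suc p) b (x(p := y)) = quad_form p ?b x + b p p * (y + ?c x)\<^sup>2" for y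
      proof -
        have "quad_form p ?b (x(p := y)) = quad_form p ?b x"
          by (rule quad_form_cong) auto
        then show ?thesis
          using pp by (subst quad_form_Suc) (auto simp: sym)
      qed
      then have "(\<integral>\<^sup>+y. ennreal (exp (- quad_form (Suc p) b (x(p := y)) / 2)) \<partial>lborel)
        = (\<integral>\<^sup>+y. ennreal (exp (- quad_form p ?b x / 2)) * ennreal (exp (- (b p p * (y + ?c x)\<^sup>2) / 2)) \<partial>lborel)"
        by (simp add: ennreal_mult[symmetric] mult_exp_exp diff_divide_distrib)
      also have "\<dots> = ennreal (exp (- quad_form p ?b x / 2)) * ennreal (sqrt (2 * pi / b p p))"
        by (subst nn_integral_cmult, simp, subst nn_integral_gaussian_shift[OF pp], rule refl)
      finally show "(\<integral>\<^sup>+y. ennreal (exp (- quad_form (Suc p) b (x(p := y)) / 2)) \<partial>lborel) = \<dots>" .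
    qed
    also have "\<dots> = ennreal (sqrt ((2 * pi) ^ p / ?D)) * ennreal (sqrt (2 * pi / b p p))"
      using IH by (subst nn_integral_multc) (auto simp: quad_form_def)
    also have "\<dots> = ennreal (sqrt ((2 * pi) ^ p / ?D) * sqrt (2 * pi / b p p))"
      by (rule ennreal_mult[symmetric]) (use Dpos pp in auto)
    also have "sqrt ((2 * pi) ^ p / ?D) * sqrt (2 * pi / b p p) = sqrt ((2 * pi) ^ Suc p / (b p p * ?D))"
      unfolding real_sqrt_mult[symmetric] by (simp add: mult.commute)
    finally show ?case
      using D had Dpos pp by (simp add: mult.commute)
  qed
  then show ?pos ?had ?int by auto
qed

section \<open>Exchangeable pairs\<close>

text \<open>Entries of Stiefel matrices are bounded, so all integrands of the exponential moment
  estimate lie in this class. Its closure rules \<open>bdd_meas\<close> reduce every integrability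
  question to the syntax of the integrand.\<close>

definition bdd_measurable :: "'a measure \<Rightarrow> ('a \<Rightarrow> real) \<Rightarrow> bool" where
  "bdd_measurable M f \<longleftrightarrow> f \<in> borel_measurable M \<and> (\<exists>K. \<forall>x\<in>space M. \<bar>f x\<bar> \<le> K)"

named_theorems bdd_meas

lemma bdd_measurable_const [bdd_meas]: "bdd_measurable M (\<lambda>x. c)"
  by (auto simp: bdd_measurable_def)

lemma bdd_measurable_add [bdd_meas]:
  assumes "bdd_measurable M f" "bdd_measurable M g"
  shows "bdd_measurable M (\<lambda>x. f x + g x)"
proof -
  obtain K L where "\<forall>x\<in>space M. \<bar>f x\<bar> \<le> K" "\<forall>x\<in>space M. \<bar>g x\<bar> \<le> L"
    using assms by (auto simp: bdd_measurable_def)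
  then have "\<forall>x\<in>space M. \<bar>f x + g x\<bar> \<le> K + L"
    by (meson abs_triangle_ineq add_mono order_trans)
  then show ?thesis using assms by (auto simp: bdd_measurable_def)
qed

lemma bdd_measurable_mult [bdd_meas]:
  assumes "bdd_measurable M f" "bdd_measurable M g"
  shows "bdd_measurable M (\<lambda>x. f x * g x)"
proof -
  obtain K L where "\<forall>x\<in>space M. \<bar>f x\<bar> \<le> K" "\<forall>x\<in>space M. \<bar>g x\<bar> \<le> L"
    using assms by (auto simp: bdd_measurable_def)
  then have "\<forall>x\<in>space M. \<bar>f x * g x\<bar> \<le> K * L"
    by (metis abs_ge_zero abs_mult mult_mono order_trans)
  then show ?thesis using assms by (auto simp: bdd_measurable_def)
qed

lemma bdd_measurable_uminus [bdd_meas]: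
  "bdd_measurable M f \<Longrightarrow> bdd_measurable M (\<lambda>x. - f x)"
  by (auto simp: bdd_measurable_def)

lemma bdd_measurable_diff [bdd_meas]:
  "bdd_measurable M f \<Longrightarrow> bdd_measurable M g \<Longrightarrow> bdd_measurable M (\<lambda>x. f x - g x)"
  using bdd_measurable_add[OF _ bdd_measurable_uminus, of M f g] by simp

lemma bdd_measurable_power [bdd_meas]:
  "bdd_measurable M f \<Longrightarrow> bdd_measurable M (\<lambda>x. f x ^ n)"
  by (induction n) (auto intro: bdd_meas)

lemma bdd_measurable_divide [bdd_meas]:
  "bdd_measurable M f \<Longrightarrow> bdd_measurable M (\<lambda>x. f x / c)"
  using bdd_measurable_mult[OF _ bdd_measurable_const, of M f "1 / c"] by simp

lemma bdd_measurable_sum [bdd_meas]: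
  "(\<And>i. i \<in> I \<Longrightarrow> bdd_measurable M (f i)) \<Longrightarrow> bdd_measurable M (\<lambda>x. \<Sum>i\<in>I. f i x)"
  by (induction I rule: infinite_finite_induct) (auto intro: bdd_meas)

lemma bdd_measurable_exp [bdd_meas]:
  assumes "bdd_measurable M f"
  shows "bdd_measurable M (\<lambda>x. exp (f x))"
proof -
  obtain K where "\<forall>x\<in>space M. \<bar>f x\<bar> \<le> K"
    using assms by (auto simp: bdd_measurable_def)
  then have "\<forall>x\<in>space M. \<bar>exp (f x)\<bar> \<le> exp K"
    by auto
  then show ?thesis using assms by (auto simp: bdd_measurable_def)
qed

lemma bdd_measurable_compose:
  "bdd_measurable N f \<Longrightarrow> T \<in> measurable M N \<Longrightarrow> bdd_measurable M (\<lambda>x. f (T x))"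
  unfolding bdd_measurable_def
  by (auto intro: measurable_compose dest: measurable_space)

lemma (in finite_measure) bdd_measurable_integrable:
  assumes "bdd_measurable M f"
  shows "integrable M f"
proof -
  obtain K where "\<forall>x\<in>space M. \<bar>f x\<bar> \<le> K" "f \<in> borel_measurable M"
    using assms by (auto simp: bdd_measurable_def)
  then show ?thesis
    by (intro integrable_const_bound[where B = K] AE_I2) auto
qed

text \<open>The estimate 1 + z \<le> exp z bounds the increment by the larger exponential; the
  smaller one is added for symmetry in x and y. This symmetry lets a change of variables turn both
  terms into integrals against exp (s g).\<close>

lemma diff_mult_exp_le:
  fixes x y s :: real
  assumes "0 \<le> s"
  shows "(y - x) * (exp (s * y) - exp (s * x)) \<le> s * (y - x)\<^sup>2 * (exp (s * y) + exp (s * x))"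
proof -
  have main: "(v - u) * (exp (s * v) - exp (s * u)) \<le> s * (v - u)\<^sup>2 * (exp (s * v) + exp (s * u))"
    if "u \<le> v" for u v :: real
  proof -
    have "exp (s * v) * (1 + (s * u - s * v)) \<le> exp (s * v) * exp (s * u - s * v)"
      by (intro mult_left_mono exp_ge_add_one_self) auto
    then have "exp (s * v) - exp (s * u) \<le> s * (v - u) * exp (s * v)"
      by (simp add: mult_exp_exp algebra_simps)
    also have "\<dots> \<le> s * (v - u) * (exp (s * v) + exp (s * u))"
      using that assms by (intro mult_left_mono) auto
    finally have "(v - u) * (exp (s * v) - exp (s * u))
        \<le> (v - u) * (s * (v - u) * (exp (s * v) + exp (s * u)))"
      using that by (intro mult_left_mono) auto
    then show ?thesis by (simp add: power2_eq_square mult_ac)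
  qed
  show ?thesis
    using main[of x y] main[of y x]
    by (cases "x \<le> y") (auto simp: power2_commute minus_mult_minus algebra_simps)
qed

text \<open>Under an invariant measure, \<open>(x, T x)\<close> with \<open>T\<close> replaced by its inverse with
  probability one half is an exchangeable pair; this is what turns invariance into a
  differential inequality for the moment generating function.\<close>

lemma (in prob_space) exchangeable_exp_bound:
  assumes T: "T \<in> measurable M M" "distr M M T = M"
    and T': "T' \<in> measurable M M" "distr M M T' = M"
    and inv: "\<And>x. x \<in> space M \<Longrightarrow> T (T' x) = x"
    and g: "bdd_measurable M g" and s: "0 \<le> s"
  shows "- (\<integral>x. (g (T x) + g (T' x) - 2 * g x) * exp (s * g x) \<partial>M)
    \<le> s * (\<integral>x. ((g (T x) - g x)\<^sup>2 + (g (T' x) - g x)\<^sup>2) * exp (s * g x) \<partial>M)"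
proof -
  define h where "h x = exp (s * g x)" for x
  have h: "bdd_measurable M h"
    unfolding h_def by (intro bdd_meas g)
  note bm = bdd_meas g h bdd_measurable_compose[OF g T(1)] bdd_measurable_compose[OF g T'(1)]
    bdd_measurable_compose[OF h T(1)] bdd_measurable_compose[OF h T'(1)]
  note int = bdd_measurable_integrable
  have invT: "(\<integral>x. f (T x) \<partial>M) = (\<integral>x. f x \<partial>M)" if "bdd_measurable M f" for f :: "'a \<Rightarrow> real"
    using integral_distr[OF T(1), of f] that T(2) by (simp add: bdd_measurable_def)
  have invT': "(\<integral>x. f (T' x) \<partial>M) = (\<integral>x. f x \<partial>M)" if "bdd_measurable M f" for f :: "'a \<Rightarrow> real"
    using integral_distr[OF T'(1), of f] that T'(2) by (simp add: bdd_measurable_def)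
  have cross: "(\<integral>x. g x * h (T x) \<partial>M) = (\<integral>x. g (T' x) * h x \<partial>M)"
  proof -
    have "(\<integral>x. g x * h (T x) \<partial>M) = (\<integral>x. g (T' x) * h (T (T' x)) \<partial>M)"
      by (rule invT'[symmetric]) (intro bm)
    then show ?thesis by (simp add: inv cong: Bochner_Integration.integral_cong)
  qed
  have sq: "(\<integral>x. (g (T x) - g x)\<^sup>2 * h (T x) \<partial>M) = (\<integral>x. (g (T' x) - g x)\<^sup>2 * h x \<partial>M)"
  proof -
    have "(\<integral>x. (g (T x) - g x)\<^sup>2 * h (T x) \<partial>M)
      = (\<integral>x. (g (T (T' x)) - g (T' x))\<^sup>2 * h (T (T' x)) \<partial>M)"
      by (rule invT'[symmetric]) (intro bm)
    then show ?thesis by (simp add: inv power2_commute cong: Bochner_Integration.integral_cong)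
  qed
  have "- (\<integral>x. (g (T x) + g (T' x) - 2 * g x) * h x \<partial>M)
    = 2 * (\<integral>x. g x * h x \<partial>M) - (\<integral>x. g (T x) * h x \<partial>M) - (\<integral>x. g (T' x) * h x \<partial>M)"
  proof -
    have "(g (T x) + g (T' x) - 2 * g x) * h x = g (T x) * h x + g (T' x) * h x - 2 * (g x * h x)" for x
      by (simp add: algebra_simps)
    then show ?thesis
      using int[of "\<lambda>x. g x * h x"] int[of "\<lambda>x. g (T x) * h x"] int[of "\<lambda>x. g (T' x) * h x"]
      by (simp add: bm)
  qed
  \<comment> \<open>One of the two copies of the integral of \<open>g x * h x\<close> is transported
    along \<open>T\<close>, and the term with \<open>T'\<close> is rewritten by
    \<open>cross\<close>; the four terms then factor into the product of the increments of
    \<open>g\<close> and \<open>h\<close>.\<close>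
  also have "\<dots> = (\<integral>x. g (T x) * h (T x) \<partial>M) + (\<integral>x. g x * h x \<partial>M)
     - (\<integral>x. g (T x) * h x \<partial>M) - (\<integral>x. g x * h (T x) \<partial>M)"
    using invT[of "\<lambda>x. g x * h x"] by (simp add: bm cross)
  also have "\<dots> = (\<integral>x. (g (T x) - g x) * (h (T x) - h x) \<partial>M)"
  proof -
    have "(g (T x) - g x) * (h (T x) - h x)
      = g (T x) * h (T x) + g x * h x - g (T x) * h x - g x * h (T x)" for x
      by (simp add: algebra_simps)
    then show ?thesis
      using int[of "\<lambda>x. g x * h x"] int[of "\<lambda>x. g (T x) * h x"] int[of "\<lambda>x. g x * h (T x)"]
        int[of "\<lambda>x. g (T x) * h (T x)"]
      by (simp add: bm)
  qed
  also have "\<dots> \<le> (\<integral>x. s * (g (T x) - g x)\<^sup>2 * (h (T x) + h x) \<partial>M)"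
    by (intro integral_mono int bm) (auto simp: h_def intro: diff_mult_exp_le[OF s])
  also have "\<dots> = s * ((\<integral>x. (g (T x) - g x)\<^sup>2 * h (T x) \<partial>M) + (\<integral>x. (g (T x) - g x)\<^sup>2 * h x \<partial>M))"
    using int[of "\<lambda>x. (g (T x) - g x)\<^sup>2 * h (T x)"] int[of "\<lambda>x. (g (T x) - g x)\<^sup>2 * h x"]
    by (simp add: distrib_left mult.assoc bm)
  also have "\<dots> = s * (\<integral>x. ((g (T x) - g x)\<^sup>2 + (g (T' x) - g x)\<^sup>2) * h x \<partial>M)"
    using int[of "\<lambda>x. (g (T' x) - g x)\<^sup>2 * h x"] int[of "\<lambda>x. (g (T x) - g x)\<^sup>2 * h x"]
    by (simp add: distrib_right sq bm)
  finally show ?thesis unfolding h_def .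
qed

text \<open>The bound for \<open>T t\<close> and \<open>T (- t)\<close> is divided by (S t)^2 before
  t tends to 0. First-order terms are odd in t: they cancel in the sum of the two increments and
  survive in the sum of their squares, so that \<open>a\<close> comes from the second order and (b
  x)^2 from the first, while \<open>a'\<close> and \<open>b'\<close> disappear in the limit.
  \<open>S t\<close> is the sine of the angle whose half has tangent t; this rational
  parametrization, with cosine 1 - t S t, makes all expansions polynomial in t and
  \<open>S t\<close>.\<close>

lemma (in prob_space) infinitesimal_exchangeable_exp_bound:
  fixes T :: "real \<Rightarrow> 'a \<Rightarrow> 'a" and S C :: "real \<Rightarrow> real"
  assumes T: "\<And>t. T t \<in> measurable M M" "\<And>t. distr M M (T t) = M"
    and inv: "\<And>t x. x \<in> space M \<Longrightarrow> T t (T (- t) x) = x"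
    and g: "bdd_measurable M g" and s: "0 \<le> s"
    and bdd: "bdd_measurable M a" "bdd_measurable M b" "bdd_measurable M a'" "bdd_measurable M b'"
    and S_def: "\<And>t. S t = 2 * t / (1 + t\<^sup>2)" 
    and expand: "\<And>t x. x \<in> space M \<Longrightarrow>
      g (T t x) - g x = S t * (2 * b x - 2 * t * S t * b' x) + (S t)\<^sup>2 * (t\<^sup>2 * a' x - 2 * a x)"
  shows "(\<integral>x. a x * exp (s * g x) \<partial>M) \<le> 2 * s * (\<integral>x. (b x)\<^sup>2 * exp (s * g x) \<partial>M)"
proof -
  define h where "h x = exp (s * g x)" for x
  have h: "bdd_measurable M h"
    unfolding h_def by (intro bdd_meas g)
  note bm = bdd_meas bdd g h
  note int = bdd_measurable_integrable
  have Sm: "S (- t) = - S t" for t by (simp add: S_def)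
  define I where "I f = (\<integral>x. f x * h x \<partial>M)" for f
  \<comment> \<open>The integrands below are written as nested sums ending in 0, so that this one
    rule evaluates them.\<close>
  have I_lin: "I (\<lambda>x. c * f x + f' x) = c * I f + I f'"
    if "bdd_measurable M f" "bdd_measurable M f'" for c f f'
    using int[of "\<lambda>x. f x * h x"] int[of "\<lambda>x. f' x * h x"] that
    unfolding I_def by (simp add: bm distrib_right mult.assoc)
  have I_cong: "I f = I f'" if "\<And>x. x \<in> space M \<Longrightarrow> f x = f' x" for f f'
    unfolding I_def using that by (intro Bochner_Integration.integral_cong) auto
  have I0: "I (\<lambda>x. 0) = 0" by (simp add: I_def)
  let ?L = "\<lambda>t. 4 * I a - 2 * t\<^sup>2 * I a'"
  let ?R = "\<lambda>t. s * (8 * I (\<lambda>x. (b x)\<^sup>2) - 16 * t * S t * I (\<lambda>x. b x * b' x)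
      + 8 * t\<^sup>2 * (S t)\<^sup>2 * I (\<lambda>x. (b' x)\<^sup>2)
      + 2 * (S t)\<^sup>2 * (t ^ 4 * I (\<lambda>x. (a' x)\<^sup>2) - 4 * t\<^sup>2 * I (\<lambda>x. a' x * a x) + 4 * I (\<lambda>x. (a x)\<^sup>2)))"
  have le: "?L t \<le> ?R t" if "0 < t" for t
  proof -
    have S0: "0 < S t" using that by (simp add: S_def add_pos_nonneg)
    have plus: "g (T t x) - g x = S t * (2 * b x - 2 * t * S t * b' x) + (S t)\<^sup>2 * (t\<^sup>2 * a' x - 2 * a x)"
      and minus: "g (T (- t) x) - g x
        = - S t * (2 * b x - 2 * t * S t * b' x) + (S t)\<^sup>2 * (t\<^sup>2 * a' x - 2 * a x)"
      if "x \<in> space M" for x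
      using expand[OF that, of t] expand[OF that, of "- t"] by (simp_all add: Sm)
    have "- I (\<lambda>x. g (T t x) + g (T (- t) x) - 2 * g x)
      \<le> s * I (\<lambda>x. (g (T t x) - g x)\<^sup>2 + (g (T (- t) x) - g x)\<^sup>2)"
      unfolding I_def h_def by (rule exchangeable_exp_bound) (use T inv g s in auto)
    also have "I (\<lambda>x. g (T t x) + g (T (- t) x) - 2 * g x)
      = I (\<lambda>x. (2 * (S t)\<^sup>2 * t\<^sup>2) * a' x + ((- 4 * (S t)\<^sup>2) * a x + 0))"
    proof (rule I_cong)
      fix x assume "x \<in> space M"
      note plus[OF this] minus[OF this]
      then have "g (T t x) + g (T (- t) x) - 2 * g x = 2 * ((S t)\<^sup>2 * (t\<^sup>2 * a' x - 2 * a x))"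
        by linarith
      then show "g (T t x) + g (T (- t) x) - 2 * g x = (2 * (S t)\<^sup>2 * t\<^sup>2) * a' x + ((- 4 * (S t)\<^sup>2) * a x + 0)"
        by (simp add: algebra_simps)
    qed
    also have "\<dots> = - ((S t)\<^sup>2 * ?L t)"
      by (subst I_lin, intro bm, intro bm, subst I_lin, intro bm, intro bm) (simp add: I0 algebra_simps)
    also have "I (\<lambda>x. (g (T t x) - g x)\<^sup>2 + (g (T (- t) x) - g x)\<^sup>2) =
      I (\<lambda>x. (8 * (S t)\<^sup>2) * (b x)\<^sup>2 + ((- 16 * t * S t * (S t)\<^sup>2) * (b x * b' x)
        + ((8 * t\<^sup>2 * (S t)\<^sup>2 * (S t)\<^sup>2) * (b' x)\<^sup>2 + ((2 * (S t)\<^sup>2 * (S t)\<^sup>2 * t ^ 4) * (a' x)\<^sup>2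
        + ((- 8 * (S t)\<^sup>2 * (S t)\<^sup>2 * t\<^sup>2) * (a' x * a x) + ((8 * (S t)\<^sup>2 * (S t)\<^sup>2) * (a x)\<^sup>2 + 0))))))"
      by (rule I_cong, simp only: plus minus) (simp add: power2_eq_square power4_eq_xxxx algebra_simps)
    also have "\<dots> = (S t)\<^sup>2 * (8 * I (\<lambda>x. (b x)\<^sup>2) - 16 * t * S t * I (\<lambda>x. b x * b' x)
      + 8 * t\<^sup>2 * (S t)\<^sup>2 * I (\<lambda>x. (b' x)\<^sup>2)
      + 2 * (S t)\<^sup>2 * (t ^ 4 * I (\<lambda>x. (a' x)\<^sup>2) - 4 * t\<^sup>2 * I (\<lambda>x. a' x * a x) + 4 * I (\<lambda>x. (a x)\<^sup>2)))"
      by (subst I_lin, (intro bm)+)+ (simp add: I0 algebra_simps)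
    finally have "(S t)\<^sup>2 * ?L t \<le> (S t)\<^sup>2 * ?R t"
      by (simp add: mult.left_commute)
    then show ?thesis using S0 by simp
  qed
  have "4 * I a - 2 * 0\<^sup>2 * I a' \<le> ?R 0"
  proof (rule tendsto_le[OF trivial_limit_at_right_real])
    show "(?L \<longlongrightarrow> 4 * I a - 2 * 0\<^sup>2 * I a') (at_right 0)"
      by (intro tendsto_intros)
    have "(S \<longlongrightarrow> 2 * 0 / (1 + 0\<^sup>2)) (at_right 0)"
      unfolding S_def[abs_def] by (intro tendsto_intros) auto
    then have "(S \<longlongrightarrow> S 0) (at_right 0)" by (simp add: S_def)
    then show "(?R \<longlongrightarrow> ?R 0) (at_right 0)"
      by (intro tendsto_intros)
    show "\<forall>\<^sub>F t in at_right 0. ?L t \<le> ?R t"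
      using eventually_at_right_less[of 0] by eventually_elim (rule le)
  qed
  then have "4 * I a \<le> s * (8 * I (\<lambda>x. (b x)\<^sup>2))"
    by (simp add: S_def)
  then show ?thesis by (simp add: I_def h_def)
qed

section \<open>Exponential moments on the Stiefel manifold\<close>

definition plane_rotation :: "nat \<Rightarrow> nat \<Rightarrow> nat \<Rightarrow> real \<Rightarrow> real \<Rightarrow> real mat" where
  "plane_rotation p j k c s = mat p p (\<lambda>(i, l).
     if i = j then (if l = j then c else if l = k then - s else 0)
     else if i = k then (if l = j then s else if l = k then c else 0)
     else if i = l then 1 else 0)"

lemma plane_rotation_carrier [simp]: "plane_rotation p j k c s \<in> carrier_mat p p"
  by (simp add: plane_rotation_def)

lemma index_plane_rotation_mult:
  assumes "j < p" "k < p" "j \<noteq> k" "i < p" "m < r" "Q \<in> carrier_mat p r"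
  shows "(plane_rotation p j k c s * Q) $$ (i, m) =
    (if i = j then c * Q $$ (j, m) - s * Q $$ (k, m)
     else if i = k then s * Q $$ (j, m) + c * Q $$ (k, m) else Q $$ (i, m))"
proof -
  have "(plane_rotation p j k c s * Q) $$ (i, m) = (\<Sum>l = 0..<p.
     (if i = j then (if l = j then c else if l = k then - s else 0)
     else if i = k then (if l = j then s else if l = k then c else 0)
     else if i = l then 1 else 0) * Q $$ (l, m))"
    using assms by (simp add: plane_rotation_def scalar_prod_def)
  also have "\<dots> = (\<Sum>l = 0..<p.
     (if l = j then (if i = j then c else if i = k then s else 0) * Q $$ (j, m) else 0)
     + (if l = k then (if i = j then - s else if i = k then c else 0) * Q $$ (k, m) else 0)
     + (if l = i then (if i = j \<or> i = k then 0 else 1) * Q $$ (i, m) else 0))"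
    using assms(3) by (intro sum.cong refl) auto
  also have "\<dots> = (if i = j then c * Q $$ (j, m) - s * Q $$ (k, m)
     else if i = k then s * Q $$ (j, m) + c * Q $$ (k, m) else Q $$ (i, m))"
    using assms by (simp add: sum.distrib)
  finally show ?thesis .
qed

lemma plane_rotation_inverse:
  assumes jk: "j < p" "k < p" "j \<noteq> k" and cs: "c\<^sup>2 + s\<^sup>2 = 1" and Q: "Q \<in> carrier_mat p r"
  shows "plane_rotation p j k c s * (plane_rotation p j k c (- s) * Q) = Q"
proof (rule eq_matI)
  have c: "plane_rotation p j k c (- s) * Q \<in> carrier_mat p r"
    using Q by (metis mult_carrier_mat plane_rotation_carrier)
  fix i m assume "i < dim_row Q" "m < dim_col Q"
  then have im: "i < p" "m < r" using Q by auto
  have key: "c * (c * x) + s * (s * x) = x" for x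
    using cs by (simp add: power2_eq_square distrib_right[symmetric] mult.assoc[symmetric])
  show "(plane_rotation p j k c s * (plane_rotation p j k c (- s) * Q)) $$ (i, m) = Q $$ (i, m)"
    using jk im by (simp add: index_plane_rotation_mult[OF jk _ _ c] index_plane_rotation_mult[OF jk _ _ Q]
      algebra_simps key)
qed (use Q in \<open>auto simp: plane_rotation_def\<close>)

lemma plane_rotation_stiefel:
  assumes jk: "j < p" "k < p" "j \<noteq> k" and cs: "c\<^sup>2 + s\<^sup>2 = 1"
  shows "plane_rotation p j k c s \<in> stiefel p p"
proof -
  have t: "(plane_rotation p j k c s)\<^sup>T = plane_rotation p j k c (- s)"
    using jk by (auto simp: plane_rotation_def intro!: eq_matI)
  \<comment> \<open>Orthogonality is the inversion rule applied to the identity matrix, with the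
    sign of \<open>s\<close> reversed.\<close>
  have "plane_rotation p j k c (- s) * (plane_rotation p j k c (- (- s)) * 1\<^sub>m p) = 1\<^sub>m p"
    by (rule plane_rotation_inverse[OF jk]) (use cs in auto)
  then have "(plane_rotation p j k c s)\<^sup>T * plane_rotation p j k c s = 1\<^sub>m p"
    unfolding t by (simp add: right_mult_one_mat[OF plane_rotation_carrier])
  then show ?thesis by (simp add: stiefel_def)
qed

section \<open>Bounds and measurability on the Stiefel manifold\<close>

lemma uniform_stiefelD:
  assumes "uniform_stiefel p r \<mu>"
  shows "prob_space \<mu>" "space \<mu> = stiefel p r" "sets \<mu> = sets (stiefel_space p r)"
    "\<And>U. U \<in> stiefel p p \<Longrightarrow> distr \<mu> \<mu> (\<lambda>Q. U * Q) = \<mu>"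
proof -
  show "sets \<mu> = sets (stiefel_space p r)" using assms by (simp add: uniform_stiefel_def)
  from sets_eq_imp_space_eq[OF this] show "space \<mu> = stiefel p r"
    by (simp add: stiefel_space_def)
qed (use assms in \<open>auto simp: uniform_stiefel_def\<close>)

lemma stiefel_carrier: "Q \<in> stiefel p r \<Longrightarrow> Q \<in> carrier_mat p r"
  by (simp add: stiefel_def)

lemma stiefel_orthonormal:
  assumes "Q \<in> stiefel p r" "m < r" "n < r"
  shows "(\<Sum>i<p. Q $$ (i, m) * Q $$ (i, n)) = (if m = n then 1 else 0)"
proof -
  have "(Q\<^sup>T * Q) $$ (m, n) = (\<Sum>i<p. Q $$ (i, m) * Q $$ (i, n))"
    using assms stiefel_carrier[OF assms(1)] by (simp add: scalar_prod_def atLeast0LessThan)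
  then show ?thesis using assms by (simp add: stiefel_def)
qed

lemma stiefel_entry_bound:
  assumes "Q \<in> stiefel p r" "i < p" "m < r"
  shows "\<bar>Q $$ (i, m)\<bar> \<le> 1"
proof -
  have "(Q $$ (i, m))\<^sup>2 \<le> (\<Sum>i<p. Q $$ (i, m) * Q $$ (i, m))"
    using assms unfolding power2_eq_square
    by (intro member_le_sum[where f = "\<lambda>i. Q $$ (i, m) * Q $$ (i, m)"]) auto
  also have "\<dots> = 1" using stiefel_orthonormal[OF assms(1,3,3)] by simp
  finally show ?thesis by (simp add: abs_square_le_1)
qed

lemma stiefel_mult:
  assumes "U \<in> stiefel p p" "Q \<in> stiefel p r"
  shows "U * Q \<in> stiefel p r"
proof -
  have c: "U \<in> carrier_mat p p" "Q \<in> carrier_mat p r" "U\<^sup>T * U = 1\<^sub>m p" "Q\<^sup>T * Q = 1\<^sub>m r"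
    using assms by (auto simp: stiefel_def)
  have "(U * Q)\<^sup>T * (U * Q) = Q\<^sup>T * (U\<^sup>T * (U * Q))"
    using c by (subst transpose_mult[of _ p p], simp, simp, subst assoc_mult_mat[of _ r p _ p _ r]) auto
  also have "U\<^sup>T * (U * Q) = Q"
    using c by (subst assoc_mult_mat[of _ p p _ p _ r, symmetric]) auto
  finally show ?thesis using c by (auto simp: stiefel_def)
qed

lemma stiefel_space_measurable_entry:
  assumes "sets \<mu> = sets (stiefel_space p r)" "i < p" "m < r"
  shows "(\<lambda>Q. Q $$ (i, m)) \<in> borel_measurable \<mu>"
proof -
  let ?f = "\<lambda>Q :: real mat. \<lambda>ij\<in>{..<p} \<times> {..<r}. Q $$ ij"
  have "?f \<in> measurable (stiefel_space p r) (\<Pi>\<^sub>M ij\<in>{..<p} \<times> {..<r}. borel)"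
    unfolding stiefel_space_def by (rule measurable_vimage_algebra1) (auto simp: space_PiM)
  then have "(\<lambda>Q. ?f Q (i, m)) \<in> borel_measurable (stiefel_space p r)"
    by (rule measurable_compose[OF _ measurable_component_singleton]) (use assms in auto)
  then have "(\<lambda>Q. Q $$ (i, m)) \<in> borel_measurable (stiefel_space p r)"
    using assms by simp
  then show ?thesis
    using measurable_cong_sets[OF assms(1) refl] by auto
qed

lemma stiefel_space_measurable_mult:
  assumes \<mu>: "sets \<mu> = sets (stiefel_space p r)" and U: "U \<in> stiefel p p"
  shows "(\<lambda>Q. U * Q) \<in> measurable \<mu> \<mu>"
proof -
  have sp: "space \<mu> = stiefel p r"
    using sets_eq_imp_space_eq[OF \<mu>] by (simp add: stiefel_space_def)
  have "(\<lambda>Q. U * Q) \<in> measurable \<mu> (stiefel_space p r)"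
    unfolding stiefel_space_def
  proof (rule measurable_vimage_algebra2)
    show "(*) U \<in> space \<mu> \<rightarrow> stiefel p r" using U by (auto simp: sp intro: stiefel_mult)
    show "(\<lambda>Q. \<lambda>ij\<in>{..<p} \<times> {..<r}. (U * Q) $$ ij) \<in> measurable \<mu> (\<Pi>\<^sub>M ij\<in>{..<p} \<times> {..<r}. borel)"
    proof (rule measurable_restrict)
      fix ij assume "ij \<in> {..<p} \<times> {..<r}"
      then obtain i m where ij: "ij = (i, m)" "i < p" "m < r" by auto
      have "(\<lambda>Q. \<Sum>l<p. U $$ (i, l) * Q $$ (l, m)) \<in> borel_measurable \<mu>"
        by (intro borel_measurable_sum borel_measurable_times borel_measurable_const
            stiefel_space_measurable_entry[OF \<mu>]) (use ij in auto)
      also have "(\<lambda>Q. \<Sum>l<p. U $$ (i, l) * Q $$ (l, m)) \<in> borel_measurable \<mu> \<longleftrightarrow>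
        (\<lambda>Q. (U * Q) $$ ij) \<in> borel_measurable \<mu>"
        by (rule measurable_cong) (use U ij in \<open>auto simp: sp stiefel_def scalar_prod_def atLeast0LessThan\<close>)
      finally show "(\<lambda>Q. (U * Q) $$ ij) \<in> borel_measurable \<mu>" .
    qed
  qed
  then show ?thesis using measurable_cong_sets[OF refl \<mu>] by auto
qed

section \<open>Quadratic forms under a plane rotation\<close>

lemma quad_form_add_plane:
  fixes u v :: real
  assumes jk: "j < p" "k < p" "j \<noteq> k" and sym: "\<And>i l. i < p \<Longrightarrow> l < p \<Longrightarrow> N i l = N l i"
    and y: "\<And>i. i < p \<Longrightarrow> y i = x i + (if i = j then u else 0) + (if i = k then v else 0)"
  shows "quad_form p N y = quad_form p N x + 2 * u * (\<Sum>l<p. N j l * x l) + 2 * v * (\<Sum>l<p. N k l * x l)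
    + u\<^sup>2 * N j j + v\<^sup>2 * N k k + 2 * u * v * N j k"
proof -
  \<comment> \<open>The displacement lives on the two indices j and k; \<open>d_sum\<close>
    collapses every sum against it, so the expansion of the form is exact and short.\<close>
  define d where "d i = (if i = j then u else 0) + (if i = k then v else 0)" for i
  have d_sum: "(\<Sum>i<p. d i * f i) = u * f j + v * f k" for f
  proof -
    have "(\<Sum>i<p. d i * f i) = (\<Sum>i<p. (if i = j then u * f j else 0) + (if i = k then v * f k else 0))"
      by (intro sum.cong) (auto simp: d_def distrib_right)
    then show ?thesis using jk by (simp add: sum.distrib)
  qed
  have "quad_form p N y = (\<Sum>i<p. \<Sum>l<p. N i l * (x i + d i) * (x l + d l))"
    unfolding quad_form_def by (intro sum.cong refl) (simp add: y d_def add.assoc)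
  also have "\<dots> = (\<Sum>i<p. \<Sum>l<p. N i l * x i * x l) + (\<Sum>i<p. \<Sum>l<p. N i l * x i * d l)
    + (\<Sum>i<p. \<Sum>l<p. N i l * d i * x l) + (\<Sum>i<p. \<Sum>l<p. N i l * d i * d l)"
    by (simp add: sum.distrib algebra_simps)
  also have "(\<Sum>i<p. \<Sum>l<p. N i l * x i * d l) = (\<Sum>i<p. \<Sum>l<p. N i l * d i * x l)"
    by (subst sum.swap) (intro sum.cong refl, simp add: sym mult_ac)
  also have "(\<Sum>i<p. \<Sum>l<p. N i l * d i * x l) = (\<Sum>i<p. d i * (\<Sum>l<p. N i l * x l))"
    by (simp add: sum_distrib_left mult_ac)
  also have "(\<Sum>i<p. \<Sum>l<p. N i l * d i * d l) = (\<Sum>i<p. d i * (\<Sum>l<p. d l * N i l))"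
    by (simp add: sum_distrib_left mult_ac)
  also have "\<dots> = u * (u * N j j + v * N j k) + v * (u * N k j + v * N k k)"
    by (simp only: d_sum)
  also have "(\<Sum>i<p. d i * (\<Sum>l<p. N i l * x l)) = u * (\<Sum>l<p. N j l * x l) + v * (\<Sum>l<p. N k l * x l)"
    by (simp only: d_sum)
  finally show ?thesis
    using sym[of k j] jk by (simp add: quad_form_def algebra_simps power2_eq_square)
qed

text \<open>The right-hand side is grouped as in the hypothesis \<open>expand\<close> of
  \<open>infinitesimal_exchangeable_exp_bound\<close>: the part led by S is odd in t, the part led
  by S^2 is even.\<close>

lemma quad_form_rotation:
  fixes t S :: real
  assumes jk: "j < p" "k < p" "j \<noteq> k" and sym: "\<And>i l. i < p \<Longrightarrow> l < p \<Longrightarrow> N i l = N l i"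
    and S: "S = 2 * t / (1 + t\<^sup>2)"
    and y: "\<And>i. i < p \<Longrightarrow> y i = (if i = j then (1 - t * S) * x j - S * x k
       else if i = k then S * x j + (1 - t * S) * x k else x i)"
  defines "w \<equiv> \<lambda>i. \<Sum>l<p. N i l * x l"
  shows "quad_form p N y - quad_form p N x =
     S * (2 * (x j * w k - x k * w j)
       - 2 * t * S * (x j * x k * (N k k - N j j) + ((x j)\<^sup>2 - (x k)\<^sup>2) * N j k))
     + S\<^sup>2 * (t\<^sup>2 * (- (x j * w j) - x k * w k + (x j)\<^sup>2 * N j j + (x k)\<^sup>2 * N k k + 2 * (x j * x k * N j k))
       - (x j * w j + x k * w k - (x k)\<^sup>2 * N j j - (x j)\<^sup>2 * N k k + 2 * (x j * x k * N j k)))"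
proof -
  define C where "C = - t * S"
  define a where "a = x j"
  define b where "b = x k"
  have "1 + t\<^sup>2 \<noteq> 0" by (simp add: add_nonneg_eq_0_iff)
  then have "(1 + t\<^sup>2) * S = 2 * t" by (simp add: S)
  then have "S * ((1 + t\<^sup>2) * S) = S * (2 * t)" by simp
  then have "2 * t * S = S * S * (1 + t\<^sup>2)"
    by (simp only: mult_ac)
  \<comment> \<open>\<open>C\<close> is the cosine minus 1, hence of second order in t. This
    identity moves the terms linear in \<open>C\<close> to those with the factor S^2.\<close>
  then have C: "2 * C = - (S\<^sup>2 * (1 + t\<^sup>2))"
    by (simp add: C_def power2_eq_square)
  have CS: "C * S = - t * S\<^sup>2" "C\<^sup>2 = t\<^sup>2 * S\<^sup>2"
    by (simp_all add: C_def power2_eq_square)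
  have "quad_form p N y = quad_form p N x + 2 * (C * a - S * b) * w j + 2 * (S * a + C * b) * w k
    + (C * a - S * b)\<^sup>2 * N j j + (S * a + C * b)\<^sup>2 * N k k + 2 * (C * a - S * b) * (S * a + C * b) * N j k"
    unfolding w_def
    by (rule quad_form_add_plane[OF jk sym]) (use y jk(3) in \<open>auto simp: C_def a_def b_def algebra_simps\<close>)
  also have "(C * a - S * b)\<^sup>2 = C\<^sup>2 * a\<^sup>2 - 2 * (C * S) * (a * b) + S\<^sup>2 * b\<^sup>2"
    by (simp add: power2_eq_square algebra_simps)
  also have "(S * a + C * b)\<^sup>2 = S\<^sup>2 * a\<^sup>2 + 2 * (C * S) * (a * b) + C\<^sup>2 * b\<^sup>2"
    by (simp add: power2_eq_square algebra_simps)
  also have "2 * (C * a - S * b) * (S * a + C * b) = 2 * ((C * S) * (a\<^sup>2 - b\<^sup>2) + (C\<^sup>2 - S\<^sup>2) * (a * b))"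
    by (simp add: power2_eq_square algebra_simps)
  also have "2 * (C * a - S * b) * w j = (2 * C) * (a * w j) - 2 * S * (b * w j)"
    by (simp add: algebra_simps)
  also have "2 * (S * a + C * b) * w k = (2 * C) * (b * w k) + 2 * S * (a * w k)"
    by (simp add: algebra_simps)
  finally show ?thesis
    unfolding C CS a_def[symmetric] b_def[symmetric] by (simp add: algebra_simps power2_eq_square)
qed

text \<open>For the matrix q w', orthonormal columns of q give the Frobenius norm of w;
  antisymmetrizing it costs a factor 4 in the square. With q = W and w = N W the left side is the
  squared gradient of g up to a constant, collected over all planes.\<close>

lemma sum_sq_commutator_le:
  fixes q w :: "nat \<Rightarrow> nat \<Rightarrow> real"
  assumes orth: "\<And>m n. m < r \<Longrightarrow> n < r \<Longrightarrow> (\<Sum>i<p. q i m * q i n) = (if m = n then 1 else 0)"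
  shows "(\<Sum>j<p. \<Sum>k<p. (\<Sum>m<r. q j m * w k m - q k m * w j m)\<^sup>2) \<le> 4 * (\<Sum>m<r. \<Sum>k<p. (w k m)\<^sup>2)"
proof -
  define Y where "Y j k = (\<Sum>m<r. q j m * w k m)" for j k
  have "(\<Sum>j<p. \<Sum>k<p. (\<Sum>m<r. q j m * w k m - q k m * w j m)\<^sup>2) = (\<Sum>j<p. \<Sum>k<p. (Y j k - Y k j)\<^sup>2)"
    by (simp add: Y_def sum_subtractf)
  also have "\<dots> \<le> (\<Sum>j<p. \<Sum>k<p. 2 * (Y j k)\<^sup>2 + 2 * (Y k j)\<^sup>2)"
  proof (intro sum_mono)
    fix j k
    have "0 \<le> (Y j k + Y k j)\<^sup>2" by simp
    then show "(Y j k - Y k j)\<^sup>2 \<le> 2 * (Y j k)\<^sup>2 + 2 * (Y k j)\<^sup>2"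
      by (simp add: power2_eq_square algebra_simps)
  qed
  also have "\<dots> = 2 * (\<Sum>j<p. \<Sum>k<p. (Y j k)\<^sup>2) + 2 * (\<Sum>j<p. \<Sum>k<p. (Y k j)\<^sup>2)"
    by (simp add: sum.distrib sum_distrib_left)
  also have "(\<Sum>j<p. \<Sum>k<p. (Y k j)\<^sup>2) = (\<Sum>j<p. \<Sum>k<p. (Y j k)\<^sup>2)"
    by (rule sum.swap)
  also have "(\<Sum>j<p. \<Sum>k<p. (Y j k)\<^sup>2)
    = (\<Sum>j<p. \<Sum>k<p. \<Sum>m<r. \<Sum>n<r. (q j m * q j n) * (w k m * w k n))"
    unfolding Y_def power2_eq_square sum_product by (intro sum.cong refl) (simp add: mult_ac)
  also have "\<dots> = (\<Sum>k<p. \<Sum>j<p. \<Sum>m<r. \<Sum>n<r. (q j m * q j n) * (w k m * w k n))"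
    by (rule sum.swap)
  also have "\<dots> = (\<Sum>k<p. \<Sum>m<r. \<Sum>j<p. \<Sum>n<r. (q j m * q j n) * (w k m * w k n))"
    by (rule sum.cong[OF refl], rule sum.swap)
  also have "\<dots> = (\<Sum>k<p. \<Sum>m<r. \<Sum>n<r. \<Sum>j<p. (q j m * q j n) * (w k m * w k n))"
    by (rule sum.cong[OF refl], rule sum.cong[OF refl], rule sum.swap)
  also have "\<dots> = (\<Sum>k<p. \<Sum>m<r. \<Sum>n<r. (if m = n then 1 else 0) * (w k m * w k n))"
    by (intro sum.cong refl) (simp add: sum_distrib_right[symmetric] orth)
  also have "\<dots> = (\<Sum>k<p. \<Sum>m<r. (w k m)\<^sup>2)"
  proof (intro sum.cong refl)
    fix k m assume "m \<in> {..<r}"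
    have "(\<Sum>n<r. (if m = n then 1 else 0) * (w k m * w k n)) = (\<Sum>n<r. if m = n then w k m * w k n else 0)"
      by (intro sum.cong) auto
    then show "(\<Sum>n<r. (if m = n then 1 else 0) * (w k m * w k n)) = (w k m)\<^sup>2"
      using \<open>m \<in> {..<r}\<close> by (simp add: power2_eq_square)
  qed
  also have "\<dots> = (\<Sum>m<r. \<Sum>k<p. (w k m)\<^sup>2)" by (rule sum.swap)
  finally show ?thesis by simp
qed

text \<open>Hypothesis \<open>bound\<close> says that N^2 \<le> \<nu> N, which turns the squared
  gradient back into a multiple of g. The 8 is the 2 of the infinitesimal bound times the 4 of the
  commutator estimate. The first condition in \<open>small\<close> makes s r tr N / (p - 8 s \<nu>),
  the resulting bound on the relative excess of E exp (s g) over 1, at most \<epsilon>.\<close>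

lemma uniform_stiefel_exp_moment:
  fixes N :: "nat \<Rightarrow> nat \<Rightarrow> real"
  assumes \<mu>: "uniform_stiefel p r \<mu>"
    and sym: "\<And>i l. i < p \<Longrightarrow> l < p \<Longrightarrow> N i l = N l i"
    and bound: "\<And>x. (\<Sum>k<p. (\<Sum>l<p. N k l * x l)\<^sup>2) \<le> \<nu> * quad_form p N x"
    and nonneg: "\<And>x. 0 \<le> quad_form p N x"
    and s: "0 \<le> s"
    and small: "s * (\<Sum>i<p. N i i) * real r \<le> \<epsilon> * (real p - 8 * s * \<nu>)" "8 * s * \<nu> < real p" "\<epsilon> < 1"
  shows "integrable \<mu> (\<lambda>Q. exp (s * (\<Sum>m<r. quad_form p N (\<lambda>i. Q $$ (i, m)))))"
    and "(\<integral>Q. exp (s * (\<Sum>m<r. quad_form p N (\<lambda>i. Q $$ (i, m)))) \<partial>\<mu>) \<le> 1 / (1 - \<epsilon>)"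
proof -
  interpret prob_space \<mu> using uniform_stiefelD(1)[OF \<mu>] .
  note sp = uniform_stiefelD(2)[OF \<mu>] and sets = uniform_stiefelD(3)[OF \<mu>]
  define g where "g Q = (\<Sum>m<r. quad_form p N (\<lambda>i. Q $$ (i, m)))" for Q :: "real mat"
  define w where "w Q i m = (\<Sum>l<p. N i l * Q $$ (l, m))" for Q :: "real mat" and i m
  define h where "h Q = exp (s * g Q)" for Q
  have entry [bdd_meas]: "bdd_measurable \<mu> (\<lambda>Q. Q $$ (i, m))" if "i < p" "m < r" for i m
    unfolding bdd_measurable_def
    using stiefel_space_measurable_entry[OF sets that] stiefel_entry_bound[OF _ that] sp by blast
  have bm_g: "bdd_measurable \<mu> g"
    unfolding g_def quad_form_def by (intro bdd_meas) auto
  have bm_w: "bdd_measurable \<mu> (\<lambda>Q. w Q i m)" if "m < r" for i m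
    unfolding w_def by (intro bdd_meas) (use that in auto)
  have bm_h: "bdd_measurable \<mu> h"
    unfolding h_def by (intro bdd_meas bm_g)
  note bm = bdd_meas bm_g bm_w bm_h
  \<comment> \<open>\<open>A\<close>, \<open>B\<close>, \<open>A'\<close> and \<open>B'\<close> are
    the coefficients of \<open>quad_form_rotation\<close> summed over the columns; the halving in
    \<open>A\<close> matches the term - 2 a in \<open>expand\<close>.\<close>
  define A where "A j k Q = (\<Sum>m<r. Q $$ (j, m) * w Q j m + Q $$ (k, m) * w Q k m
    - (Q $$ (k, m))\<^sup>2 * N j j - (Q $$ (j, m))\<^sup>2 * N k k + 2 * (Q $$ (j, m) * Q $$ (k, m) * N j k)) / 2"
    for j k and Q :: "real mat"
  have two_A: "2 * A j k Q = (\<Sum>m<r. Q $$ (j, m) * w Q j m + Q $$ (k, m) * w Q k m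
    - (Q $$ (k, m))\<^sup>2 * N j j - (Q $$ (j, m))\<^sup>2 * N k k + 2 * (Q $$ (j, m) * Q $$ (k, m) * N j k))"
    for j k Q by (simp add: A_def)
  define B where "B j k Q = (\<Sum>m<r. Q $$ (j, m) * w Q k m - Q $$ (k, m) * w Q j m)"
    for j k and Q :: "real mat"
  define A' where "A' j k Q = (\<Sum>m<r. - (Q $$ (j, m) * w Q j m) - Q $$ (k, m) * w Q k m
    + (Q $$ (j, m))\<^sup>2 * N j j + (Q $$ (k, m))\<^sup>2 * N k k + 2 * (Q $$ (j, m) * Q $$ (k, m) * N j k))"
    for j k and Q :: "real mat"
  define B' where "B' j k Q = (\<Sum>m<r. Q $$ (j, m) * Q $$ (k, m) * (N k k - N j j)
    + ((Q $$ (j, m))\<^sup>2 - (Q $$ (k, m))\<^sup>2) * N j k)" for j k and Q :: "real mat"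
  have bm_A: "bdd_measurable \<mu> (A j k)" "bdd_measurable \<mu> (B j k)" "bdd_measurable \<mu> (A' j k)"
    "bdd_measurable \<mu> (B' j k)" if "j < p" "k < p" for j k
    unfolding A_def B_def A'_def B'_def by (intro bm; use that in simp)+
  have pair: "(\<integral>Q. A j k Q * h Q \<partial>\<mu>) \<le> 2 * s * (\<integral>Q. (B j k Q)\<^sup>2 * h Q \<partial>\<mu>)"
    if jk: "j < p" "k < p" "j \<noteq> k" for j k
    unfolding h_def
  proof (rule infinitesimal_exchangeable_exp_bound[where a' = "A' j k" and b' = "B' j k"])
    define S where "S t = 2 * t / (1 + t\<^sup>2)" for t :: real
    define R where "R t = plane_rotation p j k (1 - t * S t) (S t)" for t
    have circle: "(1 - t * S t)\<^sup>2 + (S t)\<^sup>2 = 1" for t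
    proof -
      have "1 + t\<^sup>2 \<noteq> 0" by (simp add: add_nonneg_eq_0_iff)
      then have "(1 + t\<^sup>2) * S t = 2 * t" by (simp add: S_def)
      then have "S t * ((1 + t\<^sup>2) * S t) = S t * (2 * t)" by simp
      then show ?thesis by (simp add: power2_eq_square algebra_simps)
    qed
    have R: "R t \<in> stiefel p p" for t
      unfolding R_def by (rule plane_rotation_stiefel[OF jk circle])
    show "(\<lambda>Q. R t * Q) \<in> measurable \<mu> \<mu>" for t
      by (rule stiefel_space_measurable_mult[OF sets R])
    show "distr \<mu> \<mu> (\<lambda>Q. R t * Q) = \<mu>" for t
      by (rule uniform_stiefelD(4)[OF \<mu> R])
    show "R t * (R (- t) * Q) = Q" if "Q \<in> space \<mu>" for t Q
    proof -
      have "R (- t) = plane_rotation p j k (1 - t * S t) (- S t)"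
        by (simp add: R_def S_def)
      then show ?thesis
        using plane_rotation_inverse[OF jk circle stiefel_carrier, of Q r t] that sp
        by (simp add: R_def)
    qed
    show "bdd_measurable \<mu> g" by (rule bm_g)
    show "bdd_measurable \<mu> (A j k)" "bdd_measurable \<mu> (B j k)" "bdd_measurable \<mu> (A' j k)"
      "bdd_measurable \<mu> (B' j k)" using bm_A jk by auto
    show "S t = 2 * t / (1 + t\<^sup>2)" for t by (simp add: S_def)
    show "g (R t * Q) - g Q = S t * (2 * B j k Q - 2 * t * S t * B' j k Q)
      + (S t)\<^sup>2 * (t\<^sup>2 * A' j k Q - 2 * A j k Q)" if Q: "Q \<in> space \<mu>" for t Q
    proof -
      have "g (R t * Q) - g Q = (\<Sum>m<r. quad_form p N (\<lambda>i. (R t * Q) $$ (i, m)) - quad_form p N (\<lambda>i. Q $$ (i, m)))"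
        by (simp add: g_def sum_subtractf)
      also have "\<dots> = (\<Sum>m<r. S t * (2 * (Q $$ (j, m) * w Q k m - Q $$ (k, m) * w Q j m)
         - 2 * t * S t * (Q $$ (j, m) * Q $$ (k, m) * (N k k - N j j)
         + ((Q $$ (j, m))\<^sup>2 - (Q $$ (k, m))\<^sup>2) * N j k))
         + (S t)\<^sup>2 * (t\<^sup>2 * (- (Q $$ (j, m) * w Q j m) - Q $$ (k, m) * w Q k m
           + (Q $$ (j, m))\<^sup>2 * N j j + (Q $$ (k, m))\<^sup>2 * N k k + 2 * (Q $$ (j, m) * Q $$ (k, m) * N j k))
         - (Q $$ (j, m) * w Q j m + Q $$ (k, m) * w Q k m
           - (Q $$ (k, m))\<^sup>2 * N j j - (Q $$ (j, m))\<^sup>2 * N k k + 2 * (Q $$ (j, m) * Q $$ (k, m) * N j k))))"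
        unfolding w_def
      proof (intro sum.cong refl quad_form_rotation[OF jk sym S_def])
        fix m i assume "m \<in> {..<r}" "i < p"
        then show "(R t * Q) $$ (i, m) = (if i = j then (1 - t * S t) * Q $$ (j, m) - S t * Q $$ (k, m)
          else if i = k then S t * Q $$ (j, m) + (1 - t * S t) * Q $$ (k, m) else Q $$ (i, m))"
          unfolding R_def using Q sp by (intro index_plane_rotation_mult[OF jk] stiefel_carrier) auto
      qed
      also have "\<dots> = S t * (2 * B j k Q - 2 * t * S t * B' j k Q)
        + (S t)\<^sup>2 * (t\<^sup>2 * A' j k Q - 2 * A j k Q)"
        unfolding B_def B'_def A'_def two_A
        by (simp only: sum.distrib sum_subtractf sum_distrib_left[symmetric])
      finally show ?thesis .
    qed
  qed (rule s)
  \<comment> \<open>The sum over all ordered pairs is p g - r tr N + g. The pairs with j = k, which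
    are no rotations, account for the extra g and are taken out. Thus g - r tr N / p is an
    eigenfunction of the operator obtained by summing over the planes.\<close>
  have A_sum: "(\<Sum>j<p. \<Sum>k\<in>{..<p} - {j}. A j k Q) = real p * g Q - real r * (\<Sum>i<p. N i i)"
    if "Q \<in> space \<mu>" for Q
  proof -
    have unit: "(\<Sum>i<p. (Q $$ (i, m))\<^sup>2) = 1" if "m < r" for m
      using stiefel_orthonormal[of Q p r m m] that \<open>Q \<in> space \<mu>\<close> sp by (simp add: power2_eq_square)
    have qw: "(\<Sum>i<p. Q $$ (i, m) * w Q i m) = quad_form p N (\<lambda>i. Q $$ (i, m))" for m
      by (simp add: w_def quad_form_def sum_distrib_left mult_ac)
    have "(\<Sum>j<p. \<Sum>k<p. 2 * A j k Q) = (\<Sum>m<r. \<Sum>j<p. \<Sum>k<p. Q $$ (j, m) * w Q j m + Q $$ (k, m) * w Q k m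
      - (Q $$ (k, m))\<^sup>2 * N j j - (Q $$ (j, m))\<^sup>2 * N k k + 2 * (Q $$ (j, m) * Q $$ (k, m) * N j k))"
      unfolding two_A
      by (rule trans[OF sum.cong[OF refl sum.swap] sum.swap])
    also have "\<dots> = (\<Sum>m<r. 2 * (real p * quad_form p N (\<lambda>i. Q $$ (i, m)) - (\<Sum>i<p. N i i)
      + quad_form p N (\<lambda>i. Q $$ (i, m))))"
    proof (intro sum.cong refl)
      fix m assume "m \<in> {..<r}"
      then have m: "m < r" by simp
      have tr: "(\<Sum>j<p. \<Sum>k<p. (Q $$ (k, m))\<^sup>2 * N j j) = (\<Sum>i<p. N i i)"
        "(\<Sum>j<p. \<Sum>k<p. (Q $$ (j, m))\<^sup>2 * N k k) = (\<Sum>i<p. N i i)"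
        by (simp_all add: sum_distrib_right[symmetric] sum_distrib_left[symmetric] unit[OF m])
      have cross: "(\<Sum>j<p. \<Sum>k<p. 2 * (Q $$ (j, m) * Q $$ (k, m) * N j k)) = 2 * quad_form p N (\<lambda>i. Q $$ (i, m))"
        by (simp add: quad_form_def sum_distrib_left mult_ac)
      have "(\<Sum>j<p. \<Sum>k<p. Q $$ (j, m) * w Q j m) = real p * quad_form p N (\<lambda>i. Q $$ (i, m))"
        "(\<Sum>j<p. \<Sum>k<p. Q $$ (k, m) * w Q k m) = real p * quad_form p N (\<lambda>i. Q $$ (i, m))"
        by (simp_all add: sum_distrib_left[symmetric] qw)
      then show "(\<Sum>j<p. \<Sum>k<p. Q $$ (j, m) * w Q j m + Q $$ (k, m) * w Q k m
        - (Q $$ (k, m))\<^sup>2 * N j j - (Q $$ (j, m))\<^sup>2 * N k k + 2 * (Q $$ (j, m) * Q $$ (k, m) * N j k))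
        = 2 * (real p * quad_form p N (\<lambda>i. Q $$ (i, m)) - (\<Sum>i<p. N i i)
        + quad_form p N (\<lambda>i. Q $$ (i, m)))"
        unfolding sum.distrib sum_subtractf tr cross by simp
    qed
    also have "\<dots> = 2 * (real p * g Q - real r * (\<Sum>i<p. N i i) + g Q)"
      by (simp add: g_def sum.distrib sum_subtractf sum_distrib_left[symmetric])
    finally have all: "(\<Sum>j<p. \<Sum>k<p. A j k Q) = real p * g Q - real r * (\<Sum>i<p. N i i) + g Q"
      by (simp add: sum_distrib_left[symmetric])
    have "(\<Sum>j<p. A j j Q) = (\<Sum>j<p. \<Sum>m<r. Q $$ (j, m) * w Q j m)"
    proof (intro sum.cong refl)
      fix j
      have "2 * A j j Q = 2 * (\<Sum>m<r. Q $$ (j, m) * w Q j m)"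
        unfolding two_A sum_distrib_left by (intro sum.cong refl) (simp add: power2_eq_square)
      then show "A j j Q = (\<Sum>m<r. Q $$ (j, m) * w Q j m)" by simp
    qed
    also have "\<dots> = g Q"
      by (subst sum.swap) (simp add: g_def qw)
    finally have diag: "(\<Sum>j<p. A j j Q) = g Q" .
    have "(\<Sum>j<p. \<Sum>k\<in>{..<p} - {j}. A j k Q) = (\<Sum>j<p. (\<Sum>k<p. A j k Q) - A j j Q)"
      by (intro sum.cong refl) (simp add: sum_diff1)
    then show ?thesis using all diag by (simp add: sum_subtractf)
  qed
  \<comment> \<open>Here the diagonal pairs may be added freely, since \<open>B j j\<close>
    vanishes.\<close>
  have B_sum: "(\<Sum>j<p. \<Sum>k\<in>{..<p} - {j}. (B j k Q)\<^sup>2) \<le> 4 * \<nu> * g Q" if "Q \<in> space \<mu>" for Q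
  proof -
    have "(\<Sum>j<p. \<Sum>k\<in>{..<p} - {j}. (B j k Q)\<^sup>2) \<le> (\<Sum>j<p. \<Sum>k<p. (B j k Q)\<^sup>2)"
      by (intro sum_mono sum_mono2) auto
    also have "\<dots> \<le> 4 * (\<Sum>m<r. \<Sum>k<p. (w Q k m)\<^sup>2)"
      unfolding B_def
      by (rule sum_sq_commutator_le) (use stiefel_orthonormal that sp in auto)
    also have "\<dots> \<le> 4 * (\<Sum>m<r. \<nu> * quad_form p N (\<lambda>i. Q $$ (i, m)))"
      unfolding w_def by (intro mult_left_mono sum_mono bound) auto
    finally show ?thesis by (simp add: g_def sum_distrib_left[symmetric] mult.assoc)
  qed
  note int = bdd_measurable_integrable
  let ?tr = "\<Sum>i<p. N i i"
  have "real p * (\<integral>Q. g Q * h Q \<partial>\<mu>) - real r * ?tr * (\<integral>Q. h Q \<partial>\<mu>)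
    = (\<integral>Q. (real p * g Q - real r * ?tr) * h Q \<partial>\<mu>)"
  proof -
    have "(real p * g Q - real r * ?tr) * h Q = real p * (g Q * h Q) - real r * ?tr * h Q" for Q
      by (simp add: algebra_simps)
    then show ?thesis using int[of "\<lambda>Q. g Q * h Q"] int[of h] by (simp add: bm)
  qed
  also have "\<dots> = (\<integral>Q. (\<Sum>j<p. \<Sum>k\<in>{..<p} - {j}. A j k Q * h Q) \<partial>\<mu>)"
    by (intro Bochner_Integration.integral_cong refl) (simp add: A_sum[symmetric] sum_distrib_right)
  also have "\<dots> = (\<Sum>j<p. \<Sum>k\<in>{..<p} - {j}. \<integral>Q. A j k Q * h Q \<partial>\<mu>)"
    by (subst Bochner_Integration.integral_sum, (intro int bm bm_A; simp))
      (intro sum.cong refl Bochner_Integration.integral_sum int bm bm_A; simp)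
  also have "\<dots> \<le> (\<Sum>j<p. \<Sum>k\<in>{..<p} - {j}. 2 * s * (\<integral>Q. (B j k Q)\<^sup>2 * h Q \<partial>\<mu>))"
    by (intro sum_mono pair) auto
  also have "\<dots> = 2 * s * (\<integral>Q. (\<Sum>j<p. \<Sum>k\<in>{..<p} - {j}. (B j k Q)\<^sup>2) * h Q \<partial>\<mu>)"
  proof -
    have "(\<integral>Q. (\<Sum>j<p. \<Sum>k\<in>{..<p} - {j}. (B j k Q)\<^sup>2) * h Q \<partial>\<mu>)
      = (\<integral>Q. (\<Sum>j<p. \<Sum>k\<in>{..<p} - {j}. (B j k Q)\<^sup>2 * h Q) \<partial>\<mu>)"
      by (simp add: sum_distrib_right)
    also have "\<dots> = (\<Sum>j<p. \<Sum>k\<in>{..<p} - {j}. \<integral>Q. (B j k Q)\<^sup>2 * h Q \<partial>\<mu>)"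
      by (subst Bochner_Integration.integral_sum, (intro int bm bm_A; simp))
        (intro sum.cong refl Bochner_Integration.integral_sum int bm bm_A; simp)
    finally show ?thesis by (simp add: sum_distrib_left)
  qed
  also have "\<dots> \<le> 2 * s * (\<integral>Q. 4 * \<nu> * (g Q * h Q) \<partial>\<mu>)"
  proof (intro mult_left_mono integral_mono int bm bm_A)
    show "(\<Sum>j<p. \<Sum>k\<in>{..<p} - {j}. (B j k Q)\<^sup>2) * h Q \<le> 4 * \<nu> * (g Q * h Q)" if "Q \<in> space \<mu>" for Q
      using mult_right_mono[OF B_sum[OF that], of "h Q"] by (simp add: h_def mult.assoc)
  qed (use s in auto)
  also have "\<dots> = 8 * s * \<nu> * (\<integral>Q. g Q * h Q \<partial>\<mu>)"
    by simp
  finally have main: "(real p - 8 * s * \<nu>) * (\<integral>Q. g Q * h Q \<partial>\<mu>) \<le> real r * ?tr * (\<integral>Q. h Q \<partial>\<mu>)"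
    by (simp add: algebra_simps)
  have h_le: "h Q - 1 \<le> s * (g Q * h Q)" for Q
  proof -
    have "h Q * (1 + - (s * g Q)) \<le> h Q * exp (- (s * g Q))"
      by (intro mult_left_mono exp_ge_add_one_self) (simp add: h_def)
    also have "\<dots> = 1" by (simp add: h_def mult_exp_exp)
    finally show ?thesis by (simp add: algebra_simps)
  qed
  have "(\<integral>Q. h Q \<partial>\<mu>) - 1 = (\<integral>Q. h Q - 1 \<partial>\<mu>)"
    using int[of h] by (simp add: bm prob_space)
  also have "\<dots> \<le> (\<integral>Q. s * (g Q * h Q) \<partial>\<mu>)"
    by (intro integral_mono int bm h_le)
  finally have h1: "(\<integral>Q. h Q \<partial>\<mu>) - 1 \<le> s * (\<integral>Q. g Q * h Q \<partial>\<mu>)" by simp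
  have hpos: "0 \<le> (\<integral>Q. h Q \<partial>\<mu>)" by (simp add: h_def)
  let ?d = "real p - 8 * s * \<nu>"
  have dpos: "0 < ?d" using small by simp
  have "?d * ((\<integral>Q. h Q \<partial>\<mu>) - 1) \<le> ?d * (s * (\<integral>Q. g Q * h Q \<partial>\<mu>))"
    using h1 dpos by (intro mult_left_mono) auto
  also have "\<dots> = s * (?d * (\<integral>Q. g Q * h Q \<partial>\<mu>))" by (simp add: mult_ac)
  also have "\<dots> \<le> s * (real r * ?tr * (\<integral>Q. h Q \<partial>\<mu>))"
    by (rule mult_left_mono[OF main s])
  also have "\<dots> = (s * ?tr * real r) * (\<integral>Q. h Q \<partial>\<mu>)" by (simp add: mult_ac)
  also have "\<dots> \<le> (\<epsilon> * ?d) * (\<integral>Q. h Q \<partial>\<mu>)"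
    by (rule mult_right_mono[OF small(1) hpos])
  finally have "?d * ((\<integral>Q. h Q \<partial>\<mu>) - 1) \<le> ?d * (\<epsilon> * (\<integral>Q. h Q \<partial>\<mu>))" by (simp add: mult_ac)
  then have "(\<integral>Q. h Q \<partial>\<mu>) - 1 \<le> \<epsilon> * (\<integral>Q. h Q \<partial>\<mu>)" using dpos by simp
  then have "(\<integral>Q. h Q \<partial>\<mu>) * (1 - \<epsilon>) \<le> 1" by (simp add: algebra_simps)
  then show "(\<integral>Q. exp (s * (\<Sum>m<r. quad_form p N (\<lambda>i. Q $$ (i, m)))) \<partial>\<mu>) \<le> 1 / (1 - \<epsilon>)"
    using small(3) by (simp add: h_def[symmetric] g_def[symmetric] pos_le_divide_eq)
  show "integrable \<mu> (\<lambda>Q. exp (s * (\<Sum>m<r. quad_form p N (\<lambda>i. Q $$ (i, m)))))"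
    using int[OF bm_h] by (simp add: h_def[abs_def] g_def)
qed

section \<open>Positive definite matrices\<close>

abbreviation mat_form :: "real mat \<Rightarrow> real vec \<Rightarrow> real" where
  "mat_form A v \<equiv> scalar_prod v (A *\<^sub>v v)"

definition pd_mat :: "nat \<Rightarrow> real mat \<Rightarrow> bool" where
  "pd_mat p A \<longleftrightarrow> A \<in> carrier_mat p p \<and> A\<^sup>T = A \<and>
     (\<forall>v\<in>carrier_vec p. v \<noteq> 0\<^sub>v p \<longrightarrow> 0 < mat_form A v)"

lemma pd_matD:
  assumes "pd_mat p A"
  shows "A \<in> carrier_mat p p" "A\<^sup>T = A" "v \<in> carrier_vec p \<Longrightarrow> v \<noteq> 0\<^sub>v p \<Longrightarrow> 0 < mat_form A v"
  using assms by (auto simp: pd_mat_def)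

lemma pd_mat_form_nonneg: "pd_mat p A \<Longrightarrow> v \<in> carrier_vec p \<Longrightarrow> 0 \<le> mat_form A v"
  using pd_matD(1)[of p A] pd_matD(3)[of p A v] by (cases "v = 0\<^sub>v p") (auto simp: less_imp_le)

lemma scalar_prod_self_nonneg: "0 \<le> scalar_prod v (v :: real vec)"
  by (simp add: scalar_prod_def sum_nonneg)

lemma scalar_prod_self_pos:
  fixes v :: "real vec"
  assumes "v \<in> carrier_vec p" "v \<noteq> 0\<^sub>v p"
  shows "0 < scalar_prod v v"
proof -
  have "\<exists>i<p. v $ i \<noteq> 0"
  proof (rule ccontr)
    assume "\<not> (\<exists>i<p. v $ i \<noteq> 0)"
    then have "v = 0\<^sub>v p" using assms(1) by (intro eq_vecI) auto
    then show False using assms(2) by simp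
  qed
  then show ?thesis
    using assms(1) by (auto simp: scalar_prod_def zero_less_mult_iff neq_iff intro!: sum_pos2)
qed

lemma symmetric_scalar_prod:
  fixes A :: "real mat"
  assumes "A \<in> carrier_mat p p" "A\<^sup>T = A" "u \<in> carrier_vec p" "v \<in> carrier_vec p"
  shows "scalar_prod (A *\<^sub>v u) v = scalar_prod u (A *\<^sub>v v)"
  using transpose_vec_mult_scalar[OF assms(1,4,3)] assms(2) by simp

lemma mat_form_gram:
  fixes K :: "real mat"
  assumes "K \<in> carrier_mat p r" "v \<in> carrier_vec r"
  shows "mat_form (K\<^sup>T * K) v = scalar_prod (K *\<^sub>v v) (K *\<^sub>v v)"
  using assms transpose_vec_mult_scalar[OF assms(1,2), of "K *\<^sub>v v"]
  by (simp add: comm_scalar_prod[of _ r v])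

lemma mat_form_diff_scaled:
  fixes A :: "real mat"
  assumes A: "A \<in> carrier_mat p p" "A\<^sup>T = A" and uv: "u \<in> carrier_vec p" "v \<in> carrier_vec p"
  shows "mat_form A (v - l \<cdot>\<^sub>v u) = mat_form A v - 2 * l * scalar_prod v (A *\<^sub>v u) + l\<^sup>2 * mat_form A u"
proof -
  have "A *\<^sub>v (v - l \<cdot>\<^sub>v u) = A *\<^sub>v v - l \<cdot>\<^sub>v (A *\<^sub>v u)"
    using A uv by (simp add: mult_minus_distrib_mat_vec mult_mat_vec)
  then have "mat_form A (v - l \<cdot>\<^sub>v u) = mat_form A v - l * scalar_prod v (A *\<^sub>v u)
    - l * scalar_prod u (A *\<^sub>v v) + l * l * mat_form A u"
    using A uv by (simp add: minus_scalar_prod_distrib[of _ p] scalar_prod_minus_distrib[of _ p] algebra_simps)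
  moreover have "scalar_prod u (A *\<^sub>v v) = scalar_prod v (A *\<^sub>v u)"
    using A uv by (metis comm_scalar_prod mult_mat_vec_carrier symmetric_scalar_prod)
  ultimately show ?thesis by (simp add: power2_eq_square)
qed

lemma quad_form_mat:
  assumes "A \<in> carrier_mat p p"
  shows "quad_form p (\<lambda>i j. A $$ (i, j)) x = mat_form A (vec p x)"
  using assms by (simp add: quad_form_def scalar_prod_def sum_distrib_left atLeast0LessThan mult_ac)

lemma symmetric_entries:
  assumes "A \<in> carrier_mat p p" "A\<^sup>T = A" "i < p" "j < p"
  shows "A $$ (i, j) = A $$ (j, i)"
proof -
  have "A $$ (i, j) = A\<^sup>T $$ (i, j)" by (simp only: assms(2))
  also have "\<dots> = A $$ (j, i)" using assms(1,3,4) by simp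
  finally show ?thesis .
qed

lemma pd_mat_pos_def:
  assumes "pd_mat p A"
  shows "pos_def p (\<lambda>i j. A $$ (i, j))"
  unfolding pos_def_def
proof safe
  note A = pd_matD(1,2)[OF assms]
  fix i j assume "i < p" "j < p"
  then show "A $$ (i, j) = A $$ (j, i)" by (rule symmetric_entries[OF A])
next
  note A = pd_matD(1,2)[OF assms]
  fix x :: "nat \<Rightarrow> real" and i assume "i < p" "x i \<noteq> 0"
  then have "vec p x \<noteq> 0\<^sub>v p" by (auto simp: vec_eq_iff)
  then show "0 < quad_form p (\<lambda>i j. A $$ (i, j)) x"
    using A pd_matD(3)[OF assms, of "vec p x"] by (simp add: quad_form_mat)
qed

lemma mat_of_entries: "A \<in> carrier_mat p p \<Longrightarrow> mat p p (\<lambda>(i, j). A $$ (i, j)) = A"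
  by (auto intro: eq_matI)

lemma pd_mat_det_pos:
  assumes "pd_mat p A"
  shows "0 < Determinant.det A"
  using det_pos_def_pos[OF pd_mat_pos_def[OF assms]] mat_of_entries[OF pd_matD(1)[OF assms]] by simp

lemma det_nonzero_mat_inverse:
  fixes A :: "real mat"
  assumes A: "A \<in> carrier_mat p p" and det: "Determinant.det A \<noteq> 0"
  defines "B \<equiv> the (mat_inverse A)"
  shows "B \<in> carrier_mat p p" "A * B = 1\<^sub>m p" "B * A = 1\<^sub>m p"
proof -
  have "A \<in> Units (ring_mat TYPE(real) p (undefined :: unit))"
    by (rule det_non_zero_imp_unit[OF A det])
  then obtain C where C: "mat_inverse A = Some C"
    using mat_inverse(1)[OF A, of "()"] by (cases "mat_inverse A") auto
  show "B \<in> carrier_mat p p" "A * B = 1\<^sub>m p" "B * A = 1\<^sub>m p"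
    using mat_inverse(2)[OF A C] C by (auto simp: B_def)
qed

lemma symmetric_inverse:
  fixes A B :: "real mat"
  assumes "A \<in> carrier_mat p p" "B \<in> carrier_mat p p" "A\<^sup>T = A" "A * B = 1\<^sub>m p" "B * A = 1\<^sub>m p"
  shows "B\<^sup>T = B"
proof -
  have "B\<^sup>T = B\<^sup>T * (A * B)" using assms by simp
  also have "\<dots> = (B\<^sup>T * A) * B"
    using assms by (intro assoc_mult_mat[symmetric, of _ p p _ p _ p]) auto
  also have "B\<^sup>T * A = (A * B)\<^sup>T"
    using transpose_mult[OF assms(1,2)] assms(3) by simp
  finally show ?thesis using assms by simp
qed

lemma inverse_mult_vec:
  fixes A :: "'a :: comm_ring_1 mat"
  assumes "A \<in> carrier_mat p p" "B \<in> carrier_mat p p" "A * B = 1\<^sub>m p" "v \<in> carrier_vec p"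
  shows "A *\<^sub>v (B *\<^sub>v v) = v"
  using assms by (simp add: assoc_mult_mat_vec[symmetric, of _ p p _ p])

lemma pd_mat_inverse:
  assumes "pd_mat p A"
  defines "B \<equiv> the (mat_inverse A)"
  shows "pd_mat p B" "A * B = 1\<^sub>m p" "B * A = 1\<^sub>m p"
proof -
  note A = pd_matD(1,2)[OF assms(1)]
  have det: "Determinant.det A \<noteq> 0" using pd_mat_det_pos[OF assms(1)] by simp
  note B = det_nonzero_mat_inverse[OF A(1) det, folded B_def]
  show "A * B = 1\<^sub>m p" "B * A = 1\<^sub>m p" using B by auto
  have sym: "B\<^sup>T = B" by (rule symmetric_inverse[OF A(1) B(1) A(2) B(2,3)])
  have "0 < mat_form B v" if v: "v \<in> carrier_vec p" "v \<noteq> 0\<^sub>v p" for v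
  proof -
    have "A *\<^sub>v (B *\<^sub>v v) = v" by (rule inverse_mult_vec[OF A(1) B(1,2) v(1)])
    moreover have "A *\<^sub>v 0\<^sub>v p = 0\<^sub>v p" using A(1) by (intro eq_vecI) auto
    ultimately have "B *\<^sub>v v \<noteq> 0\<^sub>v p" using v by auto
    then show ?thesis
      using pd_matD(3)[OF assms(1), of "B *\<^sub>v v"] B v \<open>A *\<^sub>v (B *\<^sub>v v) = v\<close>
      by (simp add: comm_scalar_prod[of v p])
  qed
  then show "pd_mat p B" using B sym by (auto simp: pd_mat_def)
qed

text \<open>A crude constant suffices, as only its existence matters. The summand 1 keeps it
  positive because its reciprocal serves as a step length in
  \<open>lambda_min_le_mat_form\<close>.\<close>

lemma mat_form_upper_bound:
  fixes A :: "real mat"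
  assumes A: "A \<in> carrier_mat p p"
  shows "\<exists>K>0. \<forall>v\<in>carrier_vec p. mat_form A v \<le> K * scalar_prod v v"
proof (intro exI[of _ "1 + (\<Sum>i<p. \<Sum>j<p. \<bar>A $$ (i, j)\<bar>)"] conjI ballI)
  show "0 < 1 + (\<Sum>i<p. \<Sum>j<p. \<bar>A $$ (i, j)\<bar>)"
    by (simp add: add_pos_nonneg sum_nonneg)
  fix v :: "real vec" assume v: "v \<in> carrier_vec p"
  have sq: "(v $ i)\<^sup>2 \<le> scalar_prod v v" if "i < p" for i
    using v that unfolding scalar_prod_def power2_eq_square
    by (intro member_le_sum[where f = "\<lambda>i. v $ i * v $ i"]) auto
  have vij: "\<bar>v $ i * v $ j\<bar> \<le> scalar_prod v v" if "i < p" "j < p" for i j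
  proof -
    have "2 * \<bar>v $ i * v $ j\<bar> \<le> (v $ i)\<^sup>2 + (v $ j)\<^sup>2"
      using sum_squares_bound[of "\<bar>v $ i\<bar>" "\<bar>v $ j\<bar>"] by (simp add: abs_mult mult.assoc)
    then show ?thesis using sq[OF that(1)] sq[OF that(2)] by linarith
  qed
  have "mat_form A v = (\<Sum>i<p. \<Sum>j<p. A $$ (i, j) * (v $ i * v $ j))"
    using A v by (simp add: scalar_prod_def sum_distrib_left atLeast0LessThan mult_ac)
  also have "\<dots> \<le> (\<Sum>i<p. \<Sum>j<p. \<bar>A $$ (i, j)\<bar> * scalar_prod v v)"
  proof (intro sum_mono)
    fix i j assume "i \<in> {..<p}" "j \<in> {..<p}"
    then have "\<bar>A $$ (i, j)\<bar> * \<bar>v $ i * v $ j\<bar> \<le> \<bar>A $$ (i, j)\<bar> * scalar_prod v v"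
      using vij by (intro mult_left_mono) auto
    then show "A $$ (i, j) * (v $ i * v $ j) \<le> \<bar>A $$ (i, j)\<bar> * scalar_prod v v"
      by (metis abs_ge_self abs_mult order_trans)
  qed
  also have "\<dots> = (\<Sum>i<p. \<Sum>j<p. \<bar>A $$ (i, j)\<bar>) * scalar_prod v v"
    by (simp add: sum_distrib_right)
  also have "\<dots> \<le> (1 + (\<Sum>i<p. \<Sum>j<p. \<bar>A $$ (i, j)\<bar>)) * scalar_prod v v"
    using scalar_prod_self_nonneg[of v] by (intro mult_right_mono) auto
  finally show "mat_form A v \<le> (1 + (\<Sum>i<p. \<Sum>j<p. \<bar>A $$ (i, j)\<bar>)) * scalar_prod v v" .
qed

text \<open>The supremum m of all c such that S - c I is positive semidefinite is an eigenvalue: if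
  S - m I were invertible, its form would be bounded below by a positive multiple of the
  squared norm, and m could be increased.\<close>

lemma lambda_min_le_mat_form:
  assumes S: "covariance_matrix p S" and p: "0 < p" and v: "v \<in> carrier_vec p"
  shows "lambda_min S * scalar_prod v v \<le> mat_form S v"
proof -
  have c: "S \<in> carrier_mat p p" "S\<^sup>T = S" and psd: "\<And>v. v \<in> carrier_vec p \<Longrightarrow> 0 \<le> mat_form S v"
    using S by (auto simp: covariance_matrix_def)
  define L where "L = {c. \<forall>v\<in>carrier_vec p. c * scalar_prod v v \<le> mat_form S v}"
  have L0: "0 \<in> L" using psd by (auto simp: L_def)
  obtain K where K: "\<And>v. v \<in> carrier_vec p \<Longrightarrow> mat_form S v \<le> K * scalar_prod v v"
    using mat_form_upper_bound[OF c(1)] by blast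
  \<comment> \<open>Testing with a unit vector, available since p is positive, bounds
    \<open>L\<close> from above.\<close>
  have "l \<le> K" if "l \<in> L" for l
    using that K[of "unit_vec p 0"] p
    by (force simp: L_def dest: bspec[of _ _ "unit_vec p 0"])
  then have bdd: "bdd_above L" by (auto simp: bdd_above_def)
  define m where "m = Sup L"
  have mL: "m * scalar_prod v v \<le> mat_form S v" if v: "v \<in> carrier_vec p" for v
  proof (cases "v = 0\<^sub>v p")
    case False
    then have pos: "0 < scalar_prod v v" using scalar_prod_self_pos v by blast
    have "m \<le> mat_form S v / scalar_prod v v"
      unfolding m_def
    proof (rule cSup_least)
      show "L \<noteq> {}" using L0 by auto
      show "l \<le> mat_form S v / scalar_prod v v" if "l \<in> L" for l
        using that v pos by (simp add: L_def pos_le_divide_eq)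
    qed
    then show ?thesis using pos by (simp add: pos_le_divide_eq)
  qed (use c in simp)
  define B where "B = S - m \<cdot>\<^sub>m 1\<^sub>m p"
  have B: "B \<in> carrier_mat p p" "B\<^sup>T = B"
    using c symmetric_entries[OF c] by (auto simp: B_def intro!: eq_matI)
  have B_form: "mat_form B v = mat_form S v - m * scalar_prod v v" if "v \<in> carrier_vec p" for v
  proof -
    have "B *\<^sub>v v = S *\<^sub>v v - m \<cdot>\<^sub>v v"
      unfolding B_def using c that
      by (intro eq_vecI) (auto simp: minus_mult_distrib_mat_vec[of _ p p] minus_scalar_prod_distrib[of _ p])
    then show ?thesis
      using c that by (simp add: scalar_prod_minus_distrib[of _ p])
  qed
  have "Determinant.det B = 0"
  proof (rule ccontr)
    assume det: "Determinant.det B \<noteq> 0"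
    define C where "C = the (mat_inverse B)"
    note C = det_nonzero_mat_inverse[OF B(1) det, folded C_def]
    obtain K where K: "0 < K" "\<And>v. v \<in> carrier_vec p \<Longrightarrow> mat_form C v \<le> K * scalar_prod v v"
      using mat_form_upper_bound[OF C(1)] by blast
    have "m + 1 / K \<in> L"
      unfolding L_def
    proof safe
      fix v :: "real vec" assume v: "v \<in> carrier_vec p"
      have BC: "B *\<^sub>v (C *\<^sub>v v) = v" by (rule inverse_mult_vec[OF B(1) C(1,2) v])
      have Cv: "C *\<^sub>v v \<in> carrier_vec p" using C v by simp
      \<comment> \<open>Moving from v by l C v changes the form by at most (- 2 l + K l^2) |v|^2.
        The choice l = 1 / K minimizes this and leaves the gain |v|^2 / K.\<close>
      have "0 \<le> mat_form B (v - (1 / K) \<cdot>\<^sub>v (C *\<^sub>v v))"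
        using mL[of "v - (1 / K) \<cdot>\<^sub>v (C *\<^sub>v v)"] B_form[of "v - (1 / K) \<cdot>\<^sub>v (C *\<^sub>v v)"] v Cv by simp
      also have "\<dots> = mat_form B v - 2 * (1 / K) * scalar_prod v v + (1 / K)\<^sup>2 * mat_form C v"
        using mat_form_diff_scaled[OF B Cv v] BC comm_scalar_prod[OF Cv v] by simp
      also have "\<dots> \<le> mat_form B v - 2 * (1 / K) * scalar_prod v v + (1 / K)\<^sup>2 * (K * scalar_prod v v)"
        using K v by (intro add_left_mono mult_left_mono) auto
      also have "(1 / K)\<^sup>2 * (K * scalar_prod v v) = (1 / K) * scalar_prod v v"
        using K by (simp add: power2_eq_square)
      finally show "(m + 1 / K) * scalar_prod v v \<le> mat_form S v"
        using B_form[OF v] by (simp add: algebra_simps)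
    qed
    then have "m + 1 / K \<le> m" unfolding m_def by (rule cSup_upper) (rule bdd)
    then show False using K by simp
  qed
  moreover have "char_matrix S m = B"
    using c by (auto simp: char_matrix_def B_def intro!: eq_matI)
  ultimately have ev: "eigenvalue S m" using eigenvalue_det[OF c(1)] by simp
  \<comment> \<open>\<open>Min\<close> is a lower bound of a set only if the set is finite; the
    eigenvalues are the roots of a nonzero polynomial.\<close>
  have "char_poly S \<noteq> 0"
    using degree_monic_char_poly[OF c(1)] by auto
  then have "finite {k. eigenvalue S k}"
    unfolding eigenvalue_root_char_poly[OF c(1)] by (rule poly_roots_finite)
  then have "lambda_min S \<le> m" unfolding lambda_min_def using ev by (intro Min_le) auto
  then have "lambda_min S * scalar_prod v v \<le> m * scalar_prod v v"
    by (intro mult_right_mono scalar_prod_self_nonneg)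
  with mL[OF v] show ?thesis by simp
qed

lemma pd_mat_coercive:
  assumes "A \<in> carrier_mat p p" "A\<^sup>T = A" "0 < c"
    and "\<And>v. v \<in> carrier_vec p \<Longrightarrow> c * scalar_prod v v \<le> mat_form A v"
  shows "pd_mat p A"
  unfolding pd_mat_def
proof (intro conjI ballI impI)
  fix v :: "real vec" assume v: "v \<in> carrier_vec p" "v \<noteq> 0\<^sub>v p"
  have "0 < c * scalar_prod v v" using scalar_prod_self_pos[OF v] assms(3) by simp
  also have "\<dots> \<le> mat_form A v" by (rule assms(4)[OF v(1)])
  finally show "0 < mat_form A v" .
qed (use assms in auto)

text \<open>With S u = v, the square |v - c u|^2 \<ge> 0 is expanded and coercivity in the form c
  |u|^2 \<le> u.v is inserted; this takes the place of the Cauchy-Schwarz inequality and needs no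
  norms.\<close>

lemma norm_inverse_coercive_le:
  assumes S: "pd_mat p S" and c: "0 < c"
    and coercive: "\<And>v. v \<in> carrier_vec p \<Longrightarrow> c * scalar_prod v v \<le> mat_form S v"
    and v: "v \<in> carrier_vec p"
  defines "u \<equiv> the (mat_inverse S) *\<^sub>v v"
  shows "c\<^sup>2 * scalar_prod u u \<le> scalar_prod v v"
proof -
  let ?T = "the (mat_inverse S)"
  note T = pd_mat_inverse[OF S]
  have u: "u \<in> carrier_vec p" using pd_matD(1)[OF T(1)] v by (simp add: u_def)
  have Su: "S *\<^sub>v u = v"
    unfolding u_def by (rule inverse_mult_vec[OF pd_matD(1)[OF S] pd_matD(1)[OF T(1)] T(2) v])
  have "0 \<le> scalar_prod (v - c \<cdot>\<^sub>v u) (v - c \<cdot>\<^sub>v u)" by (rule scalar_prod_self_nonneg)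
  also have "\<dots> = scalar_prod v v - 2 * c * scalar_prod u v + c\<^sup>2 * scalar_prod u u"
    using u v comm_scalar_prod[OF v u]
    by (simp add: minus_scalar_prod_distrib[of _ p] scalar_prod_minus_distrib[of _ p] power2_eq_square algebra_simps)
  finally have "2 * c * scalar_prod u v - c\<^sup>2 * scalar_prod u u \<le> scalar_prod v v" by simp
  moreover have "c * (c * scalar_prod u u) \<le> c * scalar_prod u v"
    using coercive[OF u] Su c by (intro mult_left_mono) auto
  ultimately show ?thesis by (simp add: power2_eq_square)
qed

text \<open>Inversion reverses the order of positive definite forms. The inequality is the
  nonnegativity of the form of A at A^-1 v - (1 / k) S^-1 v, where A \<le> k S is used for the
  quadratic term.\<close>

lemma mat_form_inverse_antimono:
  assumes A: "pd_mat p A" and S: "pd_mat p S" and k: "0 < k"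
    and le: "\<And>v. v \<in> carrier_vec p \<Longrightarrow> mat_form A v \<le> k * mat_form S v"
    and v: "v \<in> carrier_vec p"
  shows "mat_form (the (mat_inverse S)) v \<le> k * mat_form (the (mat_inverse A)) v"
proof -
  let ?a = "the (mat_inverse A) *\<^sub>v v" and ?s = "the (mat_inverse S) *\<^sub>v v"
  note Ai = pd_mat_inverse[OF A] and Si = pd_mat_inverse[OF S]
  have c: "?a \<in> carrier_vec p" "?s \<in> carrier_vec p"
    using pd_matD(1)[OF Ai(1)] pd_matD(1)[OF Si(1)] v by simp_all
  have Aa: "A *\<^sub>v ?a = v" by (rule inverse_mult_vec[OF pd_matD(1)[OF A] pd_matD(1)[OF Ai(1)] Ai(2) v])
  have Ss: "S *\<^sub>v ?s = v" by (rule inverse_mult_vec[OF pd_matD(1)[OF S] pd_matD(1)[OF Si(1)] Si(2) v])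
  have "0 \<le> mat_form A (?a - (1 / k) \<cdot>\<^sub>v ?s)"
    by (rule pd_mat_form_nonneg[OF A]) (use c in simp)
  also have "\<dots> = scalar_prod v ?a - 2 * (1 / k) * scalar_prod v ?s + (1 / k)\<^sup>2 * mat_form A ?s"
    using mat_form_diff_scaled[OF pd_matD(1,2)[OF A] c(2,1), of "1 / k"]
      symmetric_scalar_prod[OF pd_matD(1,2)[OF A] c] Aa comm_scalar_prod[OF v c(1)]
    by simp
  also have "\<dots> \<le> scalar_prod v ?a - 2 * (1 / k) * scalar_prod v ?s + (1 / k)\<^sup>2 * (k * scalar_prod v ?s)"
    using le[OF c(2)] Ss comm_scalar_prod[OF v c(2)] by (intro add_left_mono mult_left_mono) auto
  also have "(1 / k)\<^sup>2 * (k * scalar_prod v ?s) = (1 / k) * scalar_prod v ?s"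
    using k by (simp add: power2_eq_square)
  finally have "(1 / k) * scalar_prod v ?s \<le> scalar_prod v ?a" by simp
  then show ?thesis using k by (simp add: field_simps)
qed

text \<open>Ai + Bi - T will be the precision matrix of the product of two likelihood ratios and the
  null density. Multiplying by A from the left and by B from the right removes both inverses and
  leaves S - K K' T L L'. After S is factored out, the rest is 1 minus a product through dimension
  r, and Sylvester's identity passes from size p to size r.\<close>

lemma det_inverse_comb:
  fixes S K L :: "real mat"
  assumes c: "S \<in> carrier_mat p p" "T \<in> carrier_mat p p" "Ai \<in> carrier_mat p p" "Bi \<in> carrier_mat p p"
    "K \<in> carrier_mat p r" "L \<in> carrier_mat p r"
  defines "A \<equiv> S + K * K\<^sup>T" and "B \<equiv> S + L * L\<^sup>T"
  assumes inv: "S * T = 1\<^sub>m p" "T * S = 1\<^sub>m p" "A * Ai = 1\<^sub>m p" "Bi * B = 1\<^sub>m p" and sym: "T\<^sup>T = T"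
  defines "M \<equiv> K\<^sup>T * T * L"
  shows "Determinant.det A * Determinant.det (Ai + Bi - T) * Determinant.det B =
    Determinant.det S * Determinant.det (1\<^sub>m r - M\<^sup>T * M)"
proof -
  have Mc: "M \<in> carrier_mat r r" using c by (auto simp: M_def)
  define P where "P = K * K\<^sup>T"
  define R where "R = L * L\<^sup>T"
  have PR: "P \<in> carrier_mat p p" "R \<in> carrier_mat p p" using c by (auto simp: P_def R_def)
  have AB: "A \<in> carrier_mat p p" "B \<in> carrier_mat p p" using c by (auto simp: A_def B_def)
  note cs = c PR AB
  have AT: "A * T = 1\<^sub>m p + P * T"
    using cs inv by (simp add: A_def P_def[symmetric] add_mult_distrib_mat[of _ p p _ _ p])
  have ATB: "A * T * B = B + (P + P * T * R)"
  proof -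
    have "A * T * B = B + P * T * B"
      unfolding AT using cs by (simp add: add_mult_distrib_mat[of _ p p _ _ p])
    also have "P * T * B = P * (T * S) + P * T * R"
      using cs unfolding B_def R_def[symmetric]
      by (simp add: mult_add_distrib_mat[of _ p p _ p] assoc_mult_mat[of _ p p _ p _ p] del: assoc_mult_mat)
    finally show ?thesis using cs inv by simp
  qed
  have "A * (Ai + Bi - T) * B = (1\<^sub>m p + A * Bi - A * T) * B"
    using cs inv by (simp add: mult_add_distrib_mat[of _ p p _ p] mult_minus_distrib_mat[of _ p p _ p])
  also have "\<dots> = B + A * Bi * B - A * T * B"
    using cs by (simp add: add_mult_distrib_mat[of _ p p _ _ p] minus_mult_distrib_mat[of _ p p _ _ p])
  also have "A * Bi * B = A"
    using cs inv by (simp add: assoc_mult_mat[of _ p p _ p _ p])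
  also have "B + A - A * T * B = S - P * T * R"
  proof -
    define X where "X = P * T * R"
    have "X \<in> carrier_mat p p" using cs by (simp add: X_def)
    then show ?thesis
      unfolding ATB X_def[symmetric] using PR c(1) unfolding A_def P_def[symmetric]
      by (intro eq_matI) (use AB(2) in auto)
  qed
  also have "S - P * T * R = S * (1\<^sub>m p - T * (P * T * R))"
  proof -
    have "S * (1\<^sub>m p - T * (P * T * R)) = S - S * (T * (P * T * R))"
      using cs by (simp add: mult_minus_distrib_mat[of _ p p _ p])
    also have "S * (T * (P * T * R)) = (S * T) * (P * T * R)"
      using cs by (intro assoc_mult_mat[symmetric, of _ p p _ p _ p]) auto
    finally show ?thesis using cs inv by simp
  qed
  also have "T * (P * T * R) = (T * K * M) * L\<^sup>T"
  proof -
    have "P * T * R = K * K\<^sup>T * T * (L * L\<^sup>T)" by (simp add: P_def R_def)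
    also have "\<dots> = K * (K\<^sup>T * (T * (L * L\<^sup>T)))"
      using c by (simp add: assoc_mult_mat[of _ r p _ p _ p] assoc_mult_mat[of _ p r _ p _ p] assoc_mult_mat[of _ p p _ p _ p])
    also have "T * \<dots> = (T * K) * (K\<^sup>T * (T * (L * L\<^sup>T)))"
      using c by (intro assoc_mult_mat[symmetric, of _ p p _ r _ p]) auto
    also have "T * (L * L\<^sup>T) = T * L * L\<^sup>T"
      using c by (intro assoc_mult_mat[symmetric, of _ p p _ r _ p]) auto
    also have "K\<^sup>T * (T * L * L\<^sup>T) = K\<^sup>T * (T * L) * L\<^sup>T"
      using c by (intro assoc_mult_mat[symmetric, of _ r p _ r _ p]) auto
    also have "K\<^sup>T * (T * L) = M"
      unfolding M_def using c by (intro assoc_mult_mat[symmetric, of _ r p _ p _ r]) auto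
    also have "(T * K) * (M * L\<^sup>T) = (T * K * M) * L\<^sup>T"
      using c Mc by (intro assoc_mult_mat[symmetric, of _ p r _ r _ p]) auto
    finally show ?thesis .
  qed
  finally have "A * (Ai + Bi - T) * B = S * (1\<^sub>m p - (T * K * M) * L\<^sup>T)" .
  then have "Determinant.det (A * (Ai + Bi - T) * B)
    = Determinant.det S * Determinant.det (1\<^sub>m p - (T * K * M) * L\<^sup>T)"
    using det_mult[of S p "1\<^sub>m p - (T * K * M) * L\<^sup>T"] Mc c
    by (metis minus_carrier_mat mult_carrier_mat transpose_carrier_mat)
  moreover have "Determinant.det (A * (Ai + Bi - T) * B)
    = Determinant.det A * Determinant.det (Ai + Bi - T) * Determinant.det B"
  proof -
    have "Ai + Bi - T \<in> carrier_mat p p" using c by auto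
    then show ?thesis
      using det_mult[of "A * (Ai + Bi - T)" p B] det_mult[of A p "Ai + Bi - T"] AB by simp
  qed
  moreover have "Determinant.det (1\<^sub>m p - (T * K * M) * L\<^sup>T) = Determinant.det (1\<^sub>m r - L\<^sup>T * (T * K * M))"
    using c Mc by (intro det_one_minus_mult_commute[of _ p r]) auto
  moreover have "L\<^sup>T * (T * K * M) = M\<^sup>T * M"
  proof -
    have "M\<^sup>T = L\<^sup>T * (K\<^sup>T * T)\<^sup>T"
      unfolding M_def using c by (intro transpose_mult[of _ r p _ r]) auto
    also have "(K\<^sup>T * T)\<^sup>T = T * K"
      using c sym transpose_mult[of "K\<^sup>T" r p T p] by simp
    finally have "M\<^sup>T = L\<^sup>T * (T * K)" .
    moreover have "L\<^sup>T * (T * K * M) = L\<^sup>T * (T * K) * M"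
      using c Mc by (intro assoc_mult_mat[symmetric, of _ r p _ r _ r]) auto
    ultimately show ?thesis by simp
  qed
  ultimately show ?thesis by simp
qed

text \<open>Hadamard's inequality for the inverse of B = I - M' M, whose diagonal entries are estimated by
  the variational formula: the form of the inverse at e is 2 e.w - w.(B w) at w with B w = e.\<close>

lemma det_one_minus_gram_ge:
  fixes M :: "real mat"
  assumes M: "M \<in> carrier_mat r r"
    and small: "\<And>v. v \<in> carrier_vec r \<Longrightarrow> 2 * scalar_prod (M *\<^sub>v v) (M *\<^sub>v v) \<le> scalar_prod v v"
  shows "exp (- 2 * (\<Sum>i<r. scalar_prod (col M i) (col M i))) \<le> Determinant.det (1\<^sub>m r - M\<^sup>T * M)"
proof -
  define B where "B = 1\<^sub>m r - M\<^sup>T * M"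
  have B: "B \<in> carrier_mat r r" "B\<^sup>T = B"
    using M by (auto simp: B_def transpose_minus[of _ r r] transpose_mult[of _ r r _ r])
  have B_form: "mat_form B v = scalar_prod v v - scalar_prod (M *\<^sub>v v) (M *\<^sub>v v)" if "v \<in> carrier_vec r" for v
  proof -
    have "B *\<^sub>v v = v - M\<^sup>T * M *\<^sub>v v"
      unfolding B_def using M that by (simp add: minus_mult_distrib_mat_vec[of _ r r])
    then show ?thesis
      using M that mat_form_gram[OF M that] by (simp add: scalar_prod_minus_distrib[of _ r])
  qed
  have "pd_mat r B"
    by (rule pd_mat_coercive[OF B, of "1 / 2"]) (use small B_form in \<open>fastforce+\<close>)
  define C where "C = the (mat_inverse B)"
  note C = pd_mat_inverse[OF \<open>pd_mat r B\<close>, folded C_def]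
  have Cc: "C \<in> carrier_mat r r" using pd_matD(1)[OF C(1)] .
  have diag: "0 \<le> C $$ (i, i) \<and> C $$ (i, i) \<le> exp (2 * scalar_prod (col M i) (col M i))" if i: "i < r" for i
  proof -
    define e where "e = (unit_vec r i :: real vec)"
    define w where "w = C *\<^sub>v e"
    have e: "e \<in> carrier_vec r" by (simp add: e_def)
    have w: "w \<in> carrier_vec r" using Cc e by (simp add: w_def)
    have Cii: "C $$ (i, i) = scalar_prod e w"
      using Cc i by (simp add: w_def e_def)
    have ee: "scalar_prod e e = 1" using i by (simp add: e_def)
    have Me: "M *\<^sub>v e = col M i" using M i by (auto simp: e_def intro!: eq_vecI)
    have "B *\<^sub>v w = e"
      unfolding w_def by (rule inverse_mult_vec[OF B(1) Cc C(2) e])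
    then have "scalar_prod e w = scalar_prod w w - scalar_prod (M *\<^sub>v w) (M *\<^sub>v w)"
      using B_form[OF w] comm_scalar_prod[OF e w] by simp
    \<comment> \<open>With this d, the diagonal entry equals 1 - |d|^2 + |M w|^2. Splitting M w = M
      e + M d costs a factor 2, and |d|^2 absorbs 2 |M d|^2; hence the factor 2 in
      \<open>small\<close>.\<close>
    define d where "d = w - e"
    have d: "d \<in> carrier_vec r" using w e by (simp add: d_def)
    have dd: "scalar_prod d d = scalar_prod w w - 2 * scalar_prod e w + 1"
      using e w ee comm_scalar_prod[OF e w]
      by (simp add: d_def minus_scalar_prod_distrib[of _ r] scalar_prod_minus_distrib[of _ r])
    have Mc: "M *\<^sub>v e \<in> carrier_vec r" "M *\<^sub>v d \<in> carrier_vec r" "M *\<^sub>v w \<in> carrier_vec r"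
      using M e d w by simp_all
    have Md: "M *\<^sub>v d = M *\<^sub>v w - M *\<^sub>v e"
      using M w e by (simp add: d_def mult_minus_distrib_mat_vec)
    have "0 \<le> scalar_prod (M *\<^sub>v d - M *\<^sub>v e) (M *\<^sub>v d - M *\<^sub>v e)" by (rule scalar_prod_self_nonneg)
    then have Mw: "scalar_prod (M *\<^sub>v w) (M *\<^sub>v w)
       \<le> 2 * scalar_prod (M *\<^sub>v e) (M *\<^sub>v e) + 2 * scalar_prod (M *\<^sub>v d) (M *\<^sub>v d)"
      using Mc comm_scalar_prod[OF Mc(1,3)] unfolding Md
      by (simp add: minus_scalar_prod_distrib[of _ r] scalar_prod_minus_distrib[of _ r])
    have "C $$ (i, i) \<le> 1 + 2 * scalar_prod (col M i) (col M i)"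
      using \<open>scalar_prod e w = _\<close> dd Mw small[OF d] unfolding Cii Me by linarith
    also have "\<dots> \<le> exp (2 * scalar_prod (col M i) (col M i))" by (rule exp_ge_add_one_self)
    finally have "C $$ (i, i) \<le> exp (2 * scalar_prod (col M i) (col M i))" .
    moreover have "0 \<le> C $$ (i, i)"
      unfolding Cii w_def by (rule pd_mat_form_nonneg[OF C(1) e])
    ultimately show ?thesis by simp
  qed
  \<comment> \<open>Hadamard's inequality bounds determinants from above, whereas det B is wanted
    from below; therefore it is applied to the inverse.\<close>
  have "Determinant.det C \<le> (\<Prod>i<r. C $$ (i, i))"
    using hadamard_ineq[OF pd_mat_pos_def[OF C(1)]] mat_of_entries[OF Cc] by simp
  also have "\<dots> \<le> (\<Prod>i<r. exp (2 * scalar_prod (col M i) (col M i)))"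
    by (rule prod_mono) (use diag in auto)
  also have "\<dots> = exp (2 * (\<Sum>i<r. scalar_prod (col M i) (col M i)))"
    by (simp add: exp_sum[symmetric] sum_distrib_left)
  finally have Cle: "Determinant.det C \<le> exp (2 * (\<Sum>i<r. scalar_prod (col M i) (col M i)))" .
  have "Determinant.det B * Determinant.det C = 1"
    using C(2) det_mult[OF B(1) Cc] by simp
  moreover have "0 < Determinant.det B" by (rule pd_mat_det_pos) fact
  ultimately have "1 \<le> Determinant.det B * exp (2 * (\<Sum>i<r. scalar_prod (col M i) (col M i)))"
    using mult_left_mono[OF Cle, of "Determinant.det B"] by simp
  then show ?thesis
    unfolding B_def by (simp add: exp_minus field_simps)
qed

section \<open>Gaussian likelihood ratios\<close>

definition gauss_density :: "nat \<Rightarrow> real mat \<Rightarrow> (nat \<Rightarrow> real) \<Rightarrow> real" where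
  "gauss_density p S x = 1 / sqrt ((2 * pi) ^ p * Determinant.det S) *
     exp (- (mat_form (the (mat_inverse S)) (Matrix.vec p x)) / 2)"

lemma gaussian_eq:
  "gaussian p S = density (\<Pi>\<^sub>M j\<in>{..<p}. lborel) (\<lambda>x. ennreal (gauss_density p S x))"
  by (simp add: gaussian_def gauss_density_def)

lemma gauss_density_pos: "pd_mat p S \<Longrightarrow> 0 < gauss_density p S x"
  using pd_mat_det_pos[of p S] by (simp add: gauss_density_def)

lemma borel_measurable_mat_form:
  assumes "A \<in> carrier_mat p p"
  shows "(\<lambda>x. mat_form A (Matrix.vec p x)) \<in> borel_measurable (\<Pi>\<^sub>M j\<in>{..<p}. lborel)"
  unfolding quad_form_mat[OF assms, symmetric] quad_form_def by measurable

lemma borel_measurable_gauss_density: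
  assumes "pd_mat p S"
  shows "gauss_density p S \<in> borel_measurable (\<Pi>\<^sub>M j\<in>{..<p}. lborel)"
  unfolding gauss_density_def[abs_def]
  using borel_measurable_mat_form[OF pd_matD(1)[OF pd_mat_inverse(1)[OF assms]]] by measurable

lemma nn_integral_exp_mat_form:
  assumes "pd_mat p C"
  shows "(\<integral>\<^sup>+x. ennreal (exp (- (mat_form C (Matrix.vec p x)) / 2)) \<partial>(\<Pi>\<^sub>M j\<in>{..<p}. lborel)) =
    ennreal (sqrt ((2 * pi) ^ p / Determinant.det C))"
  using nn_integral_exp_quad_form[OF pd_mat_pos_def[OF assms]] mat_of_entries[OF pd_matD(1)[OF assms]]
  by (simp add: quad_form_mat[OF pd_matD(1)[OF assms]])

lemma prob_space_gaussian:
  assumes S: "pd_mat p S"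
  shows "prob_space (gaussian p S)"
proof
  let ?T = "the (mat_inverse S)"
  note T = pd_mat_inverse[OF S]
  have S0: "0 < Determinant.det S" by (rule pd_mat_det_pos[OF S])
  have "Determinant.det S * Determinant.det ?T = 1"
    using det_mult[OF pd_matD(1)[OF S] pd_matD(1)[OF T(1)]] T(2) by simp
  then have dT: "Determinant.det ?T = 1 / Determinant.det S" using S0 by (simp add: field_simps)
  have "(\<integral>\<^sup>+x. ennreal (gauss_density p S x) \<partial>(\<Pi>\<^sub>M j\<in>{..<p}. lborel)) =
    (\<integral>\<^sup>+x. ennreal (1 / sqrt ((2 * pi) ^ p * Determinant.det S)) *
       ennreal (exp (- (mat_form ?T (Matrix.vec p x)) / 2)) \<partial>(\<Pi>\<^sub>M j\<in>{..<p}. lborel))"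
    unfolding gauss_density_def using S0 by (intro nn_integral_cong ennreal_mult) auto
  also have "\<dots> = ennreal (1 / sqrt ((2 * pi) ^ p * Determinant.det S)) *
       ennreal (sqrt ((2 * pi) ^ p / Determinant.det ?T))"
    using borel_measurable_mat_form[OF pd_matD(1)[OF T(1)]]
    unfolding nn_integral_exp_mat_form[OF T(1), symmetric] by (intro nn_integral_cmult) auto
  also have "\<dots> = ennreal (1 / sqrt ((2 * pi) ^ p * Determinant.det S) * sqrt ((2 * pi) ^ p * Determinant.det S))"
    using S0 by (subst ennreal_mult[symmetric]) (auto simp: dT)
  also have "\<dots> = 1"
    using S0 by simp
  finally show "emeasure (gaussian p S) (space (gaussian p S)) = 1"
    using borel_measurable_gauss_density[OF S] unfolding gaussian_eq
    by (simp add: emeasure_density)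
qed

definition gauss_ratio :: "nat \<Rightarrow> real mat \<Rightarrow> real mat \<Rightarrow> (nat \<Rightarrow> real) \<Rightarrow> real" where
  "gauss_ratio p S A x = gauss_density p A x / gauss_density p S x"

lemma borel_measurable_gauss_ratio:
  assumes "pd_mat p S" "pd_mat p A"
  shows "gauss_ratio p S A \<in> borel_measurable (gaussian p S)"
  unfolding gauss_ratio_def[abs_def] gaussian_eq
  using borel_measurable_gauss_density[OF assms(1)] borel_measurable_gauss_density[OF assms(2)]
  by simp

lemma gaussian_density_ratio:
  assumes S: "pd_mat p S" and A: "pd_mat p A"
  shows "gaussian p A = density (gaussian p S) (\<lambda>x. ennreal (gauss_ratio p S A x))"
proof -
  note meas [measurable] = borel_measurable_gauss_density[OF S] borel_measurable_gauss_density[OF A]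
  have "ennreal (gauss_density p S x) * ennreal (gauss_ratio p S A x) = ennreal (gauss_density p A x)" for x
    using gauss_density_pos[OF S, of x] gauss_density_pos[OF A, of x]
    by (simp add: gauss_ratio_def ennreal_mult[symmetric])
  then show ?thesis
    unfolding gaussian_eq by (subst density_density_eq) (auto simp: gauss_ratio_def)
qed

lemma gauss_ratio_pos: "pd_mat p S \<Longrightarrow> pd_mat p A \<Longrightarrow> 0 < gauss_ratio p S A x"
  by (simp add: gauss_ratio_def gauss_density_pos)

text \<open>The null density times the two ratios is again a constant times a Gaussian exponential,
  now with precision matrix \<open>?C\<close>; positive definiteness of \<open>?C\<close> makes the
  integral finite. The constant \<open>k\<close> collects the normalizations, and its powers of 2 pi
  cancel against those of the integral.\<close>

lemma nn_integral_gauss_ratio_pair: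
  assumes S: "pd_mat p S" and A: "pd_mat p A" and B: "pd_mat p B"
    and C: "pd_mat p (the (mat_inverse A) + the (mat_inverse B) - the (mat_inverse S))" (is "pd_mat p ?C")
  shows "(\<integral>\<^sup>+x. ennreal (gauss_ratio p S A x) * ennreal (gauss_ratio p S B x) \<partial>gaussian p S) =
    ennreal (sqrt (Determinant.det S / (Determinant.det A * Determinant.det ?C * Determinant.det B)))"
proof -
  note meas [measurable] = borel_measurable_gauss_density[OF S] borel_measurable_gauss_density[OF A]
    borel_measurable_gauss_density[OF B]
  note carrier = pd_matD(1)[OF pd_mat_inverse(1)[OF S]] pd_matD(1)[OF pd_mat_inverse(1)[OF A]]
    pd_matD(1)[OF pd_mat_inverse(1)[OF B]]
  note det = pd_mat_det_pos[OF S] pd_mat_det_pos[OF A] pd_mat_det_pos[OF B] pd_mat_det_pos[OF C]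
  define k where "k = sqrt ((2 * pi) ^ p * Determinant.det S)
    / (sqrt ((2 * pi) ^ p * Determinant.det A) * sqrt ((2 * pi) ^ p * Determinant.det B))"
  have k: "0 \<le> k" using det by (simp add: k_def)
  have form: "mat_form ?C (Matrix.vec p x) = mat_form (the (mat_inverse A)) (Matrix.vec p x)
    + mat_form (the (mat_inverse B)) (Matrix.vec p x) - mat_form (the (mat_inverse S)) (Matrix.vec p x)" for x
    using carrier
    by (simp add: add_mult_distrib_mat_vec[of _ p p] minus_mult_distrib_mat_vec[of _ p p]
      scalar_prod_add_distrib[of _ p] scalar_prod_minus_distrib[of _ p])
  have eq: "gauss_density p S x * (gauss_ratio p S A x * gauss_ratio p S B x)
    = k * exp (- (mat_form ?C (Matrix.vec p x)) / 2)" for x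
  proof -
    have "gauss_density p S x * (gauss_ratio p S A x * gauss_ratio p S B x)
      = gauss_density p A x * gauss_density p B x / gauss_density p S x"
      using gauss_density_pos[OF S, of x] by (simp add: gauss_ratio_def)
    also have "\<dots> = k * (exp (- (mat_form (the (mat_inverse A)) (Matrix.vec p x)) / 2) *
       exp (- (mat_form (the (mat_inverse B)) (Matrix.vec p x)) / 2)
       / exp (- (mat_form (the (mat_inverse S)) (Matrix.vec p x)) / 2))"
      by (simp add: gauss_density_def k_def)
    also have "\<dots> = k * exp (- (mat_form ?C (Matrix.vec p x)) / 2)"
      unfolding form by (simp add: exp_add[symmetric] exp_diff[symmetric] add_divide_distrib diff_divide_distrib)
    finally show ?thesis .
  qed
  have "(\<integral>\<^sup>+x. ennreal (gauss_ratio p S A x) * ennreal (gauss_ratio p S B x) \<partial>gaussian p S)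
    = (\<integral>\<^sup>+x. ennreal (gauss_density p S x) * (ennreal (gauss_ratio p S A x) * ennreal (gauss_ratio p S B x))
       \<partial>(\<Pi>\<^sub>M j\<in>{..<p}. lborel))"
    unfolding gaussian_eq by (subst nn_integral_density) (auto simp: gauss_ratio_def)
  also have "\<dots> = (\<integral>\<^sup>+x. ennreal k * ennreal (exp (- (mat_form ?C (Matrix.vec p x)) / 2)) \<partial>(\<Pi>\<^sub>M j\<in>{..<p}. lborel))"
  proof (rule nn_integral_cong)
    fix x
    show "ennreal (gauss_density p S x) * (ennreal (gauss_ratio p S A x) * ennreal (gauss_ratio p S B x))
      = ennreal k * ennreal (exp (- (mat_form ?C (Matrix.vec p x)) / 2))"
      using gauss_density_pos[OF S, of x] gauss_ratio_pos[OF S A, of x] gauss_ratio_pos[OF S B, of x] k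
      by (simp add: ennreal_mult[symmetric] eq)
  qed
  also have "\<dots> = ennreal k * ennreal (sqrt ((2 * pi) ^ p / Determinant.det ?C))"
    using borel_measurable_mat_form[OF pd_matD(1)[OF C]]
    unfolding nn_integral_exp_mat_form[OF C, symmetric] by (intro nn_integral_cmult) auto
  also have "\<dots> = ennreal (k * sqrt ((2 * pi) ^ p / Determinant.det ?C))"
    using k det by (simp add: ennreal_mult)
  also have "k * sqrt ((2 * pi) ^ p / Determinant.det ?C) =
    sqrt (Determinant.det S / (Determinant.det A * Determinant.det ?C * Determinant.det B))"
  proof -
    have "(2 * pi) ^ p > (0 :: real)" by simp
    then show ?thesis
      unfolding k_def real_sqrt_mult[symmetric] real_sqrt_divide[symmetric] using det
      by (simp add: mult_ac)
  qed
  finally show ?thesis .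
qed

section \<open>Spiked covariances and the integral for a pair of spikes\<close>

lemma stiefel_isometry:
  assumes "Q \<in> stiefel p r" "v \<in> carrier_vec r"
  shows "scalar_prod (Q *\<^sub>v v) (Q *\<^sub>v v) = scalar_prod v v"
  using mat_form_gram[OF stiefel_carrier[OF assms(1)] assms(2)] assms by (simp add: stiefel_def)

text \<open>Bessel's inequality: |v - Q Q' v|^2 = |v|^2 - |Q' v|^2.\<close>

lemma stiefel_transpose_contraction:
  assumes Q: "Q \<in> stiefel p r" and v: "v \<in> carrier_vec p"
  shows "scalar_prod (Q\<^sup>T *\<^sub>v v) (Q\<^sup>T *\<^sub>v v) \<le> scalar_prod v v"
proof -
  let ?y = "Q\<^sup>T *\<^sub>v v"
  note Qc = stiefel_carrier[OF Q]
  have y: "?y \<in> carrier_vec r" "Q *\<^sub>v ?y \<in> carrier_vec p" using Qc v by simp_all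
  have "scalar_prod v (Q *\<^sub>v ?y) = scalar_prod ?y ?y"
    using transpose_vec_mult_scalar[OF Qc y(1) v] by simp
  then show ?thesis
    using scalar_prod_self_nonneg[of "v - Q *\<^sub>v ?y"] v y stiefel_isometry[OF Q y(1)] comm_scalar_prod[OF v y(2)]
    by (simp add: minus_scalar_prod_distrib[of _ p] scalar_prod_minus_distrib[of _ p])
qed

definition spiked :: "real mat \<Rightarrow> real \<Rightarrow> real mat \<Rightarrow> real mat" where
  "spiked S t Q = S + t \<cdot>\<^sub>m (Q * Q\<^sup>T)"

text \<open>For symmetric S this is N = S^-1 Q Q' S^-1. Summing its form over the columns of a
  second draw W gives the squared Frobenius norm of Q' S^-1 W, and the Gram shape makes symmetry and
  nonnegativity immediate.\<close>

definition overlap :: "real mat \<Rightarrow> real mat \<Rightarrow> real mat" where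
  "overlap S Q = (the (mat_inverse S) * Q) * (the (mat_inverse S) * Q)\<^sup>T"

lemma mat_form_spiked:
  assumes S: "S \<in> carrier_mat p p" and Q: "Q \<in> carrier_mat p r" and v: "v \<in> carrier_vec p"
  shows "mat_form (spiked S t Q) v = mat_form S v + t * scalar_prod (Q\<^sup>T *\<^sub>v v) (Q\<^sup>T *\<^sub>v v)"
proof -
  have smult: "(t \<cdot>\<^sub>m R) *\<^sub>v v = t \<cdot>\<^sub>v (R *\<^sub>v v)" if "R \<in> carrier_mat p p" for R
    using that v by (intro eq_vecI) auto
  have "Q * Q\<^sup>T \<in> carrier_mat p p" using Q by simp
  then have "spiked S t Q *\<^sub>v v = S *\<^sub>v v + t \<cdot>\<^sub>v (Q * Q\<^sup>T *\<^sub>v v)"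
    unfolding spiked_def using S v
    by (subst add_mult_distrib_mat_vec[of _ p p]) (auto simp only: smult smult_carrier_mat)
  then show ?thesis
    using mat_form_gram[of "Q\<^sup>T" r p v] S Q v by (simp add: scalar_prod_add_distrib[of _ p])
qed

lemma pd_mat_spiked:
  assumes S: "pd_mat p S" and Q: "Q \<in> carrier_mat p r" and t: "0 \<le> t"
  shows "pd_mat p (spiked S t Q)"
  unfolding pd_mat_def
proof (intro conjI ballI impI)
  note Sc = pd_matD(1,2)[OF S]
  show c: "spiked S t Q \<in> carrier_mat p p" using Sc Q by (simp add: spiked_def)
  have QQ: "(Q * Q\<^sup>T)\<^sup>T = Q * Q\<^sup>T" "Q * Q\<^sup>T \<in> carrier_mat p p" using Q by (auto simp: transpose_mult[of _ p r])
  show "(spiked S t Q)\<^sup>T = spiked S t Q"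
  proof (rule eq_matI)
    fix i j assume ij: "i < dim_row (spiked S t Q)" "j < dim_col (spiked S t Q)"
    then have "i < p" "j < p" using c by auto
    then show "(spiked S t Q)\<^sup>T $$ (i, j) = spiked S t Q $$ (i, j)"
      using symmetric_entries[OF Sc, of i j] symmetric_entries[OF QQ(2,1), of i j] Sc QQ(2)
      by (simp add: spiked_def del: index_mult_mat)
  qed (use c in auto)
  fix v :: "real vec" assume v: "v \<in> carrier_vec p" "v \<noteq> 0\<^sub>v p"
  show "0 < mat_form (spiked S t Q) v"
    unfolding mat_form_spiked[OF Sc(1) Q v(1)]
    using pd_matD(3)[OF S v] t by (intro add_pos_nonneg mult_nonneg_nonneg scalar_prod_self_nonneg)
qed

text \<open>Brings the spike into the shape K K' expected by
  \<open>det_inverse_comb\<close>.\<close>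

lemma spiked_sqrt:
  assumes "0 \<le> t" "S \<in> carrier_mat p p" "Q \<in> carrier_mat p r"
  shows "spiked S t Q = S + (sqrt t \<cdot>\<^sub>m Q) * (sqrt t \<cdot>\<^sub>m Q)\<^sup>T"
proof -
  have "(sqrt t \<cdot>\<^sub>m Q) * (sqrt t \<cdot>\<^sub>m Q)\<^sup>T = t \<cdot>\<^sub>m (Q * Q\<^sup>T)"
    using assms by (intro eq_matI) (auto simp: mult.assoc[symmetric] scalar_prod_def sum_distrib_left intro!: sum.cong)
  then show ?thesis by (simp add: spiked_def)
qed

text \<open>From here on, the eigenvalue condition enters only as coercivity of the form, which
  \<open>lambda_min_le_mat_form\<close> supplies.\<close>

locale coercive_matrix =
  fixes p :: nat and S :: "real mat" and c :: real
  assumes carrier: "S \<in> carrier_mat p p" and sym: "S\<^sup>T = S" and c_pos: "0 < c"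
    and coercive: "v \<in> carrier_vec p \<Longrightarrow> c * scalar_prod v v \<le> mat_form S v"
begin

abbreviation T where "T \<equiv> the (mat_inverse S)"

lemma pd: "pd_mat p S"
  by (rule pd_mat_coercive[OF carrier sym c_pos coercive])

lemma T_carrier: "T \<in> carrier_mat p p" and T_sym: "T\<^sup>T = T"
  and S_T: "S * T = 1\<^sub>m p" and T_S: "T * S = 1\<^sub>m p"
  using pd_mat_inverse[OF pd] pd_matD by blast+

lemma T_norm_le:
  "v \<in> carrier_vec p \<Longrightarrow> scalar_prod (T *\<^sub>v v) (T *\<^sub>v v) \<le> scalar_prod v v / c\<^sup>2"
  using norm_inverse_coercive_le[OF pd c_pos coercive, of v] c_pos by (simp add: field_simps)

lemma T_stiefel_norm_le:
  assumes Q: "Q \<in> stiefel p r" and v: "v \<in> carrier_vec r"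
  shows "scalar_prod ((T * Q) *\<^sub>v v) ((T * Q) *\<^sub>v v) \<le> scalar_prod v v / c\<^sup>2"
proof -
  have "(T * Q) *\<^sub>v v = T *\<^sub>v (Q *\<^sub>v v)"
    using T_carrier stiefel_carrier[OF Q] v by (intro assoc_mult_mat_vec)
  then show ?thesis
    using T_norm_le[of "Q *\<^sub>v v"] stiefel_carrier[OF Q] stiefel_isometry[OF Q v] v by simp
qed

lemma overlap_carrier:
  assumes "Q \<in> stiefel p r"
  shows "overlap S Q \<in> carrier_mat p p"
proof -
  have "T * Q \<in> carrier_mat p r" using T_carrier stiefel_carrier[OF assms] by simp
  then show ?thesis unfolding overlap_def by (metis mult_carrier_mat transpose_carrier_mat)
qed

lemma overlap_form:
  assumes Q: "Q \<in> stiefel p r" and v: "v \<in> carrier_vec p"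
  shows "mat_form (overlap S Q) v = scalar_prod ((T * Q)\<^sup>T *\<^sub>v v) ((T * Q)\<^sup>T *\<^sub>v v)"
  unfolding overlap_def
  using mat_form_gram[of "(T * Q)\<^sup>T" r p v] T_carrier stiefel_carrier[OF Q] v by simp

lemma overlap_symmetric:
  assumes "Q \<in> stiefel p r" "i < p" "j < p"
  shows "overlap S Q $$ (i, j) = overlap S Q $$ (j, i)"
proof (rule symmetric_entries[OF overlap_carrier[OF assms(1)] _ assms(2,3)])
  show "(overlap S Q)\<^sup>T = overlap S Q"
    unfolding overlap_def using T_carrier stiefel_carrier[OF assms(1)]
    by (subst transpose_mult[of _ p r _ p]) auto
qed

lemma overlap_quad_nonneg:
  assumes "Q \<in> stiefel p r"
  shows "0 \<le> quad_form p (\<lambda>i j. overlap S Q $$ (i, j)) x"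
  unfolding quad_form_mat[OF overlap_carrier[OF assms]]
  by (subst overlap_form[OF assms]) (auto intro: scalar_prod_self_nonneg)

text \<open>With G = T Q one has N = G G', and |G y|^2 \<le> |y|^2 / c^2 is applied to y = G' x,
  whose squared norm is the form of N at x. This is hypothesis \<open>bound\<close> of
  \<open>uniform_stiefel_exp_moment\<close> with \<nu> = 1 / c^2.\<close>

lemma overlap_square_le:
  assumes Q: "Q \<in> stiefel p r"
  shows "(\<Sum>k<p. (\<Sum>l<p. overlap S Q $$ (k, l) * x l)\<^sup>2)
    \<le> 1 / c\<^sup>2 * quad_form p (\<lambda>i j. overlap S Q $$ (i, j)) x"
proof -
  let ?N = "overlap S Q" and ?v = "Matrix.vec p x" and ?G = "T * Q"
  have N: "?N \<in> carrier_mat p p" by (rule overlap_carrier[OF Q])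
  have G: "?G \<in> carrier_mat p r" using T_carrier stiefel_carrier[OF Q] by simp
  have "(\<Sum>k<p. (\<Sum>l<p. ?N $$ (k, l) * x l)\<^sup>2) = scalar_prod (?N *\<^sub>v ?v) (?N *\<^sub>v ?v)"
    using N by (simp add: scalar_prod_def power2_eq_square atLeast0LessThan)
  also have "?N *\<^sub>v ?v = ?G *\<^sub>v (?G\<^sup>T *\<^sub>v ?v)"
    unfolding overlap_def using G by (intro assoc_mult_mat_vec) auto
  also have "scalar_prod (?G *\<^sub>v (?G\<^sup>T *\<^sub>v ?v)) (?G *\<^sub>v (?G\<^sup>T *\<^sub>v ?v))
    \<le> scalar_prod (?G\<^sup>T *\<^sub>v ?v) (?G\<^sup>T *\<^sub>v ?v) / c\<^sup>2"
    by (rule T_stiefel_norm_le[OF Q]) (use G in simp)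
  finally show ?thesis
    by (simp add: quad_form_mat[OF N] overlap_form[OF Q])
qed

text \<open>The trace of G G' is summed by columns of G, of which there are r, and not by its p
  rows. One of the two factors r in the final rate comes from here, the other from the number of
  columns of W.\<close>

lemma overlap_trace_le:
  assumes Q: "Q \<in> stiefel p r"
  shows "(\<Sum>i<p. overlap S Q $$ (i, i)) \<le> real r / c\<^sup>2"
proof -
  let ?G = "T * Q"
  have G: "?G \<in> carrier_mat p r" using T_carrier stiefel_carrier[OF Q] by simp
  have entries: "(H * H\<^sup>T) $$ (i, i) = (\<Sum>m<r. H $$ (i, m) * H $$ (i, m))"
    if "H \<in> carrier_mat p r" "i < p" for H :: "real mat" and i
    using that by (simp add: scalar_prod_def atLeast0LessThan)
  have column: "(\<Sum>i<p. H $$ (i, m) * H $$ (i, m)) = scalar_prod (H *\<^sub>v unit_vec r m) (H *\<^sub>v unit_vec r m)"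
    if "H \<in> carrier_mat p r" "m < r" for H :: "real mat" and m
  proof -
    have "H *\<^sub>v unit_vec r m = col H m" using that by (auto intro!: eq_vecI)
    then show ?thesis using that by (simp add: scalar_prod_def atLeast0LessThan)
  qed
  have "(\<Sum>i<p. overlap S Q $$ (i, i)) = (\<Sum>i<p. \<Sum>m<r. ?G $$ (i, m) * ?G $$ (i, m))"
    unfolding overlap_def by (intro sum.cong refl entries[OF G]) simp
  also have "\<dots> = (\<Sum>m<r. \<Sum>i<p. ?G $$ (i, m) * ?G $$ (i, m))" by (rule sum.swap)
  also have "\<dots> = (\<Sum>m<r. scalar_prod (?G *\<^sub>v unit_vec r m) (?G *\<^sub>v unit_vec r m))"
    by (intro sum.cong refl column[OF G]) simp
  also have "\<dots> \<le> (\<Sum>m<r. scalar_prod (unit_vec r m) (unit_vec r m :: real vec) / c\<^sup>2)"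
    by (intro sum_mono T_stiefel_norm_le[OF Q]) simp
  also have "\<dots> = real r / c\<^sup>2" by simp
  finally show ?thesis .
qed

text \<open>The condition t \<le> c / 2 serves twice: it makes the combined precision matrix
  positive definite, and it gives |M v|^2 \<le> |v|^2 / 4, which is enough for
  \<open>det_one_minus_gram_ge\<close>.\<close>

lemma gauss_ratio_spiked_pair:
  assumes Q: "Q \<in> stiefel p r" and W: "W \<in> stiefel p r" and t: "0 \<le> t" "t \<le> c / 2"
  shows "(\<integral>\<^sup>+x. ennreal (gauss_ratio p S (spiked S t Q) x) * ennreal (gauss_ratio p S (spiked S t W) x)
      \<partial>gaussian p S)
    \<le> ennreal (exp (t\<^sup>2 * (\<Sum>m<r. quad_form p (\<lambda>i j. overlap S Q $$ (i, j)) (\<lambda>i. W $$ (i, m)))))"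
proof -
  note Qc = stiefel_carrier[OF Q] and Wc = stiefel_carrier[OF W]
  let ?A = "spiked S t Q" and ?B = "spiked S t W"
  let ?Ai = "the (mat_inverse ?A)" and ?Bi = "the (mat_inverse ?B)"
  have A: "pd_mat p ?A" by (rule pd_mat_spiked[OF pd Qc t(1)])
  have B: "pd_mat p ?B" by (rule pd_mat_spiked[OF pd Wc t(1)])
  note Ai = pd_mat_inverse[OF A] and Bi = pd_mat_inverse[OF B]
  note cs = carrier T_carrier pd_matD(1)[OF A] pd_matD(1)[OF B] pd_matD(1)[OF Ai(1)] pd_matD(1)[OF Bi(1)]
  \<comment> \<open>Both spiked forms are at most k times the null form, so each inverse is at least
    T / k. As k \<le> 3 / 2, the two inverses together dominate (4 / 3) T, and subtracting T leaves
    a positive form.\<close>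
  define k where "k = 1 + t / c"
  have k: "1 \<le> k" "k \<le> 3 / 2" using t c_pos by (auto simp: k_def field_simps)
  have dom: "mat_form (spiked S t V) v \<le> k * mat_form S v"
    if V: "V \<in> stiefel p r" and v: "v \<in> carrier_vec p" for V v
  proof -
    have "t * scalar_prod (V\<^sup>T *\<^sub>v v) (V\<^sup>T *\<^sub>v v) \<le> t * scalar_prod v v"
      by (rule mult_left_mono[OF stiefel_transpose_contraction[OF V v] t(1)])
    also have "\<dots> = t / c * (c * scalar_prod v v)" using c_pos by simp
    also have "\<dots> \<le> t / c * mat_form S v"
      using coercive[OF v] t c_pos by (intro mult_left_mono) auto
    finally show ?thesis
      unfolding mat_form_spiked[OF carrier stiefel_carrier[OF V] v] k_def by (simp add: algebra_simps)
  qed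
  have kpos: "0 < k" using k by simp
  let ?C = "?Ai + ?Bi - T"
  have C: "pd_mat p ?C"
    unfolding pd_mat_def
  proof (intro conjI ballI impI)
    show "?C \<in> carrier_mat p p" by (rule minus_carrier_mat[OF T_carrier])
    have "?C\<^sup>T = ?Ai\<^sup>T + ?Bi\<^sup>T - T\<^sup>T"
      using cs by (subst transpose_minus[of _ p p]) (auto simp: transpose_add[of _ p p])
    then show "?C\<^sup>T = ?C" using pd_matD(2)[OF Ai(1)] pd_matD(2)[OF Bi(1)] T_sym by simp
    fix v :: "real vec" assume v: "v \<in> carrier_vec p" "v \<noteq> 0\<^sub>v p"
    have Tv: "0 < mat_form T v" using pd_matD(3)[OF pd_mat_inverse(1)[OF pd] v] .
    have "mat_form T v \<le> k * mat_form ?Ai v" "mat_form T v \<le> k * mat_form ?Bi v"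
      using mat_form_inverse_antimono[OF A pd kpos dom[OF Q] v(1)]
        mat_form_inverse_antimono[OF B pd kpos dom[OF W] v(1)] by auto
    then have "2 * mat_form T v \<le> k * (mat_form ?Ai v + mat_form ?Bi v)"
      unfolding distrib_left by linarith
    moreover have "k * mat_form T v \<le> 3 / 2 * mat_form T v"
      using k Tv by (intro mult_right_mono) auto
    ultimately have "0 < k * (mat_form ?Ai v + mat_form ?Bi v - mat_form T v)"
      using Tv unfolding right_diff_distrib by linarith
    then have "0 < mat_form ?Ai v + mat_form ?Bi v - mat_form T v"
      using kpos by (simp add: zero_less_mult_iff)
    then show "0 < mat_form ?C v"
      using cs v by (simp add: add_mult_distrib_mat_vec[of _ p p] minus_mult_distrib_mat_vec[of _ p p]
        scalar_prod_add_distrib[of _ p] scalar_prod_minus_distrib[of _ p])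
  qed
  define K where "K = sqrt t \<cdot>\<^sub>m Q"
  define L where "L = sqrt t \<cdot>\<^sub>m W"
  define M where "M = K\<^sup>T * T * L"
  have KL: "K \<in> carrier_mat p r" "L \<in> carrier_mat p r" using Qc Wc by (auto simp: K_def L_def)
  have M: "M \<in> carrier_mat r r" using KL T_carrier by (simp add: M_def)
  have AK: "?A = S + K * K\<^sup>T" and BL: "?B = S + L * L\<^sup>T"
    using spiked_sqrt[OF t(1) carrier] Qc Wc by (auto simp: K_def L_def)
  have det: "Determinant.det ?A * Determinant.det ?C * Determinant.det ?B =
    Determinant.det S * Determinant.det (1\<^sub>m r - M\<^sup>T * M)"
    unfolding AK BL M_def
    by (rule det_inverse_comb)
      (use cs KL S_T T_S T_sym Ai Bi in \<open>simp_all add: AK BL\<close>)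
  have Mv: "M *\<^sub>v v = t \<cdot>\<^sub>v ((T * Q)\<^sup>T *\<^sub>v (W *\<^sub>v v))" if v: "v \<in> carrier_vec r" for v
  proof -
    have smult: "(s \<cdot>\<^sub>m R) *\<^sub>v u = s \<cdot>\<^sub>v (R *\<^sub>v u)" if "R \<in> carrier_mat m n" "u \<in> carrier_vec n"
      for R :: "real mat" and m n s u
      using that by (intro eq_vecI) auto
    have Wv: "W *\<^sub>v v \<in> carrier_vec p" using Wc v by simp
    have "M *\<^sub>v v = (K\<^sup>T * T) *\<^sub>v (L *\<^sub>v v)"
      unfolding M_def using KL T_carrier v by (intro assoc_mult_mat_vec) auto
    also have "L *\<^sub>v v = sqrt t \<cdot>\<^sub>v (W *\<^sub>v v)" unfolding L_def by (rule smult[OF Wc v])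
    also have "K\<^sup>T * T = sqrt t \<cdot>\<^sub>m (Q\<^sup>T * T)"
      unfolding K_def using Qc T_carrier by (intro eq_matI) auto
    also have "Q\<^sup>T * T = (T * Q)\<^sup>T"
      using transpose_mult[OF T_carrier Qc] T_sym by simp
    also have "(sqrt t \<cdot>\<^sub>m (T * Q)\<^sup>T) *\<^sub>v (sqrt t \<cdot>\<^sub>v (W *\<^sub>v v))
      = sqrt t \<cdot>\<^sub>v ((T * Q)\<^sup>T *\<^sub>v (sqrt t \<cdot>\<^sub>v (W *\<^sub>v v)))"
      by (rule smult[of _ r p]) (use Qc T_carrier Wv in auto)
    also have "(T * Q)\<^sup>T *\<^sub>v (sqrt t \<cdot>\<^sub>v (W *\<^sub>v v)) = sqrt t \<cdot>\<^sub>v ((T * Q)\<^sup>T *\<^sub>v (W *\<^sub>v v))"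
      by (rule mult_mat_vec[of _ r p]) (use Qc T_carrier Wv in auto)
    finally show ?thesis using t by (simp add: smult_smult_assoc)
  qed
  have MM: "scalar_prod (M *\<^sub>v v) (M *\<^sub>v v) = t\<^sup>2 * mat_form (overlap S Q) (W *\<^sub>v v)"
    if v: "v \<in> carrier_vec r" for v
  proof -
    have "(T * Q)\<^sup>T \<in> carrier_mat r p" using Qc T_carrier by auto
    moreover have "W *\<^sub>v v \<in> carrier_vec p" using Wc v by simp
    ultimately have "W *\<^sub>v v \<in> carrier_vec p" "(T * Q)\<^sup>T *\<^sub>v (W *\<^sub>v v) \<in> carrier_vec r"
      using mult_mat_vec_carrier by blast+
    then show ?thesis
      unfolding Mv[OF v] by (simp add: overlap_form[OF Q] power2_eq_square)
  qed
  have small: "2 * scalar_prod (M *\<^sub>v v) (M *\<^sub>v v) \<le> scalar_prod v v" if v: "v \<in> carrier_vec r" for v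
  proof -
    let ?u = "T *\<^sub>v (W *\<^sub>v v)"
    have Wv: "W *\<^sub>v v \<in> carrier_vec p" "?u \<in> carrier_vec p" using Wc T_carrier v by auto
    have "(T * Q)\<^sup>T *\<^sub>v (W *\<^sub>v v) = Q\<^sup>T *\<^sub>v ?u"
      using transpose_mult[OF T_carrier Qc] T_sym T_carrier Qc Wv by simp
    then have "mat_form (overlap S Q) (W *\<^sub>v v) \<le> scalar_prod ?u ?u"
      using stiefel_transpose_contraction[OF Q Wv(2)] by (simp add: overlap_form[OF Q Wv(1)])
    also have "\<dots> \<le> scalar_prod v v / c\<^sup>2"
      using T_norm_le[OF Wv(1)] stiefel_isometry[OF W v] by simp
    finally have "scalar_prod (M *\<^sub>v v) (M *\<^sub>v v) \<le> t\<^sup>2 * (scalar_prod v v / c\<^sup>2)"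
      unfolding MM[OF v] by (intro mult_left_mono) auto
    also have "\<dots> \<le> (c / 2)\<^sup>2 * (scalar_prod v v / c\<^sup>2)"
      using t scalar_prod_self_nonneg[of v] by (intro mult_right_mono power_mono) auto
    also have "\<dots> = scalar_prod v v / 4" using c_pos by (simp add: power2_eq_square)
    finally show ?thesis using scalar_prod_self_nonneg[of v] by linarith
  qed
  have col: "scalar_prod (col M m) (col M m)
    = t\<^sup>2 * quad_form p (\<lambda>i j. overlap S Q $$ (i, j)) (\<lambda>i. W $$ (i, m))" if m: "m < r" for m
  proof -
    have "col M m = M *\<^sub>v unit_vec r m" using M m by (auto intro!: eq_vecI)
    moreover have "W *\<^sub>v unit_vec r m = Matrix.vec p (\<lambda>i. W $$ (i, m))"
      using Wc m by (auto intro!: eq_vecI)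
    ultimately show ?thesis
      using MM[of "unit_vec r m"] by (simp add: quad_form_mat[OF overlap_carrier[OF Q]])
  qed
  let ?g = "\<Sum>m<r. quad_form p (\<lambda>i j. overlap S Q $$ (i, j)) (\<lambda>i. W $$ (i, m))"
  \<comment> \<open>The factor 2 in the exponent is undone by the square root in the Gaussian
    integral.\<close>
  have "exp (- 2 * (t\<^sup>2 * ?g)) \<le> Determinant.det (1\<^sub>m r - M\<^sup>T * M)"
    using det_one_minus_gram_ge[OF M small] by (simp add: col sum_distrib_left)
  moreover have S0: "0 < Determinant.det S" by (rule pd_mat_det_pos[OF pd])
  ultimately have "Determinant.det S / (Determinant.det S * Determinant.det (1\<^sub>m r - M\<^sup>T * M))
    \<le> 1 / exp (- 2 * (t\<^sup>2 * ?g))"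
    by (simp add: frac_le)
  also have "\<dots> = (exp (t\<^sup>2 * ?g))\<^sup>2"
    by (simp add: exp_minus power2_eq_square mult_exp_exp field_simps)
  finally have "sqrt (Determinant.det S / (Determinant.det ?A * Determinant.det ?C * Determinant.det ?B))
    \<le> exp (t\<^sup>2 * ?g)"
    unfolding det by (intro real_le_lsqrt) auto
  then show ?thesis
    unfolding nn_integral_gauss_ratio_pair[OF pd A B C] by (rule ennreal_leI)
qed

end

section \<open>The second moment method\<close>

text \<open>A product measure is determined by its values on rectangles, where both sides factor;
  the probability assumptions provide sigma-finiteness of both families.\<close>

lemma PiM_density:
  fixes M :: "'i \<Rightarrow> 'a measure" and f :: "'i \<Rightarrow> 'a \<Rightarrow> ennreal"
  assumes I: "finite I" and M: "\<And>i. prob_space (M i)"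
    and f [measurable]: "\<And>i. f i \<in> borel_measurable (M i)" and D: "\<And>i. prob_space (density (M i) (f i))"
  shows "(\<Pi>\<^sub>M i\<in>I. density (M i) (f i)) = density (\<Pi>\<^sub>M i\<in>I. M i) (\<lambda>x. \<Prod>i\<in>I. f i (x i))"
proof -
  interpret P: product_sigma_finite M
    using M by (auto simp: product_sigma_finite_def intro: prob_space_imp_sigma_finite)
  interpret Q: product_sigma_finite "\<lambda>i. density (M i) (f i)"
    using D by (auto simp: product_sigma_finite_def intro: prob_space_imp_sigma_finite)
  show ?thesis
  proof (rule Q.PiM_eqI[symmetric, OF I])
    show "sets (density (Pi\<^sub>M I M) (\<lambda>x. \<Prod>i\<in>I. f i (x i))) = sets (Pi\<^sub>M I (\<lambda>i. density (M i) (f i)))"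
      by (simp cong: sets_PiM_cong)
    fix A assume "\<And>i. i \<in> I \<Longrightarrow> A i \<in> sets (density (M i) (f i))"
    then have A [measurable]: "\<And>i. i \<in> I \<Longrightarrow> A i \<in> sets (M i)" by simp
    have PA: "Pi\<^sub>E I A \<in> sets (Pi\<^sub>M I M)" using I A by (intro sets_PiM_I_finite) auto
    have "emeasure (density (Pi\<^sub>M I M) (\<lambda>x. \<Prod>i\<in>I. f i (x i))) (Pi\<^sub>E I A)
      = (\<integral>\<^sup>+x. (\<Prod>i\<in>I. f i (x i)) * indicator (Pi\<^sub>E I A) x \<partial>Pi\<^sub>M I M)"
      using I PA by (intro emeasure_density) auto
    also have "\<dots> = (\<integral>\<^sup>+x. (\<Prod>i\<in>I. f i (x i) * indicator (A i) (x i)) \<partial>Pi\<^sub>M I M)"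
    proof (rule nn_integral_cong)
      fix x assume "x \<in> space (Pi\<^sub>M I M)"
      then have "x \<in> extensional I" by (auto simp: space_PiM PiE_def)
      then have "(indicator (Pi\<^sub>E I A) x :: ennreal) = (\<Prod>i\<in>I. indicator (A i) (x i))"
        using I by (auto simp: indicator_def PiE_def Pi_def prod_zero_iff)
      then show "(\<Prod>i\<in>I. f i (x i)) * indicator (Pi\<^sub>E I A) x = (\<Prod>i\<in>I. f i (x i) * indicator (A i) (x i))"
        by (simp add: prod.distrib)
    qed
    also have "\<dots> = (\<Prod>i\<in>I. \<integral>\<^sup>+x. f i x * indicator (A i) x \<partial>M i)"
      using I by (intro P.product_nn_integral_prod) auto
    also have "\<dots> = (\<Prod>i\<in>I. emeasure (density (M i) (f i)) (A i))"
      by (intro prod.cong refl emeasure_density[symmetric]) auto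
    finally show "emeasure (density (Pi\<^sub>M I M) (\<lambda>x. \<Prod>i\<in>I. f i (x i))) (Pi\<^sub>E I A)
      = (\<Prod>i\<in>I. emeasure (density (M i) (f i)) (A i))" .
  qed
qed

text \<open>The pointwise inequality behind the second moment method, with all subtractions moved to
  the other side so that it makes sense in the extended nonnegative reals.\<close>

lemma second_moment_pointwise:
  fixes l :: ennreal and \<phi> \<epsilon> :: real
  assumes \<phi>: "0 \<le> \<phi>" "\<phi> \<le> 1" and \<epsilon>: "0 < \<epsilon>"
  shows "1 + ennreal (1 / \<epsilon>) * l \<le> ennreal \<phi> + ennreal (1 - \<phi>) * l + ennreal (\<epsilon> / 2)
    + ennreal (1 / (2 * \<epsilon>)) * (1 + l * l)"
proof (cases l)
  case (real x)
  have "(1 - \<phi>) * (1 - x) \<le> \<bar>1 - x\<bar>"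
    using \<phi> by (cases "x \<le> 1") (auto simp: mult_left_le_one_le intro: order_trans[OF mult_nonneg_nonpos])
  \<comment> \<open>The arithmetic-geometric mean inequality with weight \<epsilon>. After
    integration it replaces Cauchy-Schwarz: a second moment of at most 1 + \<epsilon>^2 gives
    \<epsilon> / 2 + \<epsilon>^2 / (2 \<epsilon>) = \<epsilon>.\<close>
  also have "\<bar>1 - x\<bar> \<le> \<epsilon> / 2 + 1 / (2 * \<epsilon>) * (1 - x)\<^sup>2"
  proof -
    have "0 \<le> (\<epsilon> - \<bar>1 - x\<bar>)\<^sup>2" by simp
    then have "2 * \<epsilon> * \<bar>1 - x\<bar> \<le> \<epsilon>\<^sup>2 + (1 - x)\<^sup>2"
      by (simp add: power2_diff)
    then show ?thesis using \<epsilon> by (simp add: field_simps power2_eq_square)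
  qed
  also have "\<dots> = \<epsilon> / 2 + 1 / (2 * \<epsilon>) * (1 + x * x) - 1 / \<epsilon> * x"
    using \<epsilon> by (simp add: field_simps power2_eq_square)
  finally have "1 + 1 / \<epsilon> * x \<le> \<phi> + (1 - \<phi>) * x + \<epsilon> / 2 + 1 / (2 * \<epsilon>) * (1 + x * x)"
    by (simp add: algebra_simps)
  then have "ennreal (1 + 1 / \<epsilon> * x) \<le> ennreal (\<phi> + (1 - \<phi>) * x + \<epsilon> / 2 + 1 / (2 * \<epsilon>) * (1 + x * x))"
    by (rule ennreal_leI)
  then show ?thesis
    using \<phi> \<epsilon> real
    by (simp add: ennreal_plus[symmetric] ennreal_mult[symmetric] ennreal_1[symmetric] del: ennreal_plus ennreal_1)
next
  case top
  then show ?thesis using \<epsilon> by (simp add: ennreal_mult_top)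
qed

text \<open>Nonnegative integrals are kept until the end, so that Tonelli's theorem applies to the
  mixture density \<open>l\<close> before anything is known about its finiteness. The second moment
  is assumed bounded for each fixed first draw, and averaging over that draw bounds the integral of
  \<open>l w * l w\<close>.\<close>

lemma second_moment_testing_bound:
  fixes L :: "'q \<Rightarrow> 'w \<Rightarrow> ennreal" and \<phi> :: "'w \<Rightarrow> real"
  assumes \<mu>: "prob_space \<mu>" and P: "prob_space P"
    and L: "(\<lambda>(q, w). L q w) \<in> borel_measurable (\<mu> \<Otimes>\<^sub>M P)"
    and K: "\<And>q. q \<in> space \<mu> \<Longrightarrow> K q = density P (L q)" "\<And>q. q \<in> space \<mu> \<Longrightarrow> prob_space (K q)"
    and second_moment: "\<And>q. q \<in> space \<mu> \<Longrightarrow>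
      (\<integral>\<^sup>+q'. \<integral>\<^sup>+w. L q w * L q' w \<partial>P \<partial>\<mu>) \<le> ennreal (1 + \<epsilon>\<^sup>2)"
    and \<phi>: "\<phi> \<in> borel_measurable P" "\<And>w. w \<in> space P \<Longrightarrow> 0 \<le> \<phi> w \<and> \<phi> w \<le> 1"
    and \<epsilon>: "0 < \<epsilon>"
  shows "1 - \<epsilon> \<le> (\<integral>w. \<phi> w \<partial>P) + (\<integral>w. 1 - \<phi> w \<partial>(\<mu> \<bind> K))"
proof -
  interpret \<mu>: prob_space \<mu> by fact
  interpret P: prob_space P by fact
  interpret pair_sigma_finite \<mu> P ..
  note [measurable] = L \<phi>(1)
  have Lq [measurable]: "L q \<in> borel_measurable P" if "q \<in> space \<mu>" for q
    using measurable_compose[OF measurable_Pair1'[OF that] L] by simp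
  have Lw [measurable]: "(\<lambda>q. L q w) \<in> borel_measurable \<mu>" if "w \<in> space P" for w
    using measurable_compose[OF measurable_Pair2'[OF that] L] by simp
  define l where "l w = (\<integral>\<^sup>+q. L q w \<partial>\<mu>)" for w
  have l [measurable]: "l \<in> borel_measurable P"
    unfolding l_def[abs_def]
    by (rule \<mu>.borel_measurable_nn_integral) (use L measurable_pair_swap[OF L] in \<open>simp add: case_prod_unfold\<close>)
  have Kmeas: "K \<in> measurable \<mu> (subprob_algebra P)"
  proof (rule measurable_subprob_algebra)
    show "subprob_space (K q)" if "q \<in> space \<mu>" for q
      using K(2)[OF that] by (rule prob_space_imp_subprob_space)
    show "sets (K q) = sets P" if "q \<in> space \<mu>" for q using K(1)[OF that] by simp
    fix A assume A [measurable]: "A \<in> sets P"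
    have "(\<lambda>q. \<integral>\<^sup>+w. L q w * indicator A w \<partial>P) \<in> borel_measurable \<mu>"
      using L A by measurable
    also have "?this \<longleftrightarrow> (\<lambda>q. emeasure (K q) A) \<in> borel_measurable \<mu>"
      by (rule measurable_cong) (use K(1) Lq A in \<open>simp add: emeasure_density\<close>)
    finally show "(\<lambda>q. emeasure (K q) A) \<in> borel_measurable \<mu>" .
  qed
  have bind_sets: "sets (\<mu> \<bind> K) = sets P"
    by (rule sets_bind_measurable[OF Kmeas \<mu>.not_empty])
  then have bind_space: "space (\<mu> \<bind> K) = space P" by (rule sets_eq_imp_space_eq)
  have mass: "(\<integral>\<^sup>+w. L q w \<partial>P) = 1" if "q \<in> space \<mu>" for q
    using prob_space.emeasure_space_1[OF K(2)[OF that]] K(1)[OF that] Lq[OF that]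
    by (simp add: emeasure_density cong: nn_integral_cong)
  have swap: "(\<integral>\<^sup>+w. l w * f w \<partial>P) = (\<integral>\<^sup>+q. \<integral>\<^sup>+w. L q w * f w \<partial>P \<partial>\<mu>)"
    if [measurable]: "f \<in> borel_measurable P" for f
  proof -
    have "(\<integral>\<^sup>+w. l w * f w \<partial>P) = (\<integral>\<^sup>+w. \<integral>\<^sup>+q. L q w * f w \<partial>\<mu> \<partial>P)"
      unfolding l_def by (intro nn_integral_cong nn_integral_multc[symmetric]) simp
    also have "\<dots> = (\<integral>\<^sup>+q. \<integral>\<^sup>+w. L q w * f w \<partial>P \<partial>\<mu>)"
      by (rule Fubini') measurable
    finally show ?thesis .
  qed
  have l1: "(\<integral>\<^sup>+w. l w \<partial>P) = 1"
    using swap[of "\<lambda>_. 1"] mass by (simp add: \<mu>.emeasure_space_1 cong: nn_integral_cong)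
  have l2: "(\<integral>\<^sup>+w. l w * l w \<partial>P) \<le> ennreal (1 + \<epsilon>\<^sup>2)"
  proof -
    have "(\<integral>\<^sup>+w. l w * l w \<partial>P) = (\<integral>\<^sup>+q. \<integral>\<^sup>+w. L q w * l w \<partial>P \<partial>\<mu>)"
      by (rule swap[OF l])
    also have "\<dots> \<le> (\<integral>\<^sup>+q. ennreal (1 + \<epsilon>\<^sup>2) \<partial>\<mu>)"
    proof (rule nn_integral_mono)
      fix q assume q: "q \<in> space \<mu>"
      note [measurable] = Lq[OF q]
      have "(\<integral>\<^sup>+w. L q w * l w \<partial>P) = (\<integral>\<^sup>+w. l w * L q w \<partial>P)" by (simp add: mult.commute)
      also have "\<dots> = (\<integral>\<^sup>+q'. \<integral>\<^sup>+w. L q' w * L q w \<partial>P \<partial>\<mu>)" by (rule swap) simp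
      also have "\<dots> = (\<integral>\<^sup>+q'. \<integral>\<^sup>+w. L q w * L q' w \<partial>P \<partial>\<mu>)" by (simp add: mult.commute)
      finally show "(\<integral>\<^sup>+w. L q w * l w \<partial>P) \<le> ennreal (1 + \<epsilon>\<^sup>2)" using second_moment[OF q] by simp
    qed
    finally show ?thesis by (simp add: \<mu>.emeasure_space_1)
  qed
  have typeII: "(\<integral>\<^sup>+w. ennreal (1 - \<phi> w) * l w \<partial>P) = (\<integral>\<^sup>+w. ennreal (1 - \<phi> w) \<partial>(\<mu> \<bind> K))"
  proof -
    have "(\<integral>\<^sup>+w. ennreal (1 - \<phi> w) \<partial>(\<mu> \<bind> K)) = (\<integral>\<^sup>+q. \<integral>\<^sup>+w. ennreal (1 - \<phi> w) \<partial>K q \<partial>\<mu>)"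
      by (rule nn_integral_bind[OF _ Kmeas]) measurable
    also have "\<dots> = (\<integral>\<^sup>+q. \<integral>\<^sup>+w. L q w * ennreal (1 - \<phi> w) \<partial>P \<partial>\<mu>)"
      by (intro nn_integral_cong) (simp add: K(1) nn_integral_density Lq)
    also have "\<dots> = (\<integral>\<^sup>+w. l w * ennreal (1 - \<phi> w) \<partial>P)"
      by (rule swap[symmetric]) measurable
    finally show ?thesis by (simp add: mult.commute)
  qed
  have int0: "(\<integral>\<^sup>+w. ennreal (\<phi> w) \<partial>P) = ennreal (\<integral>w. \<phi> w \<partial>P)"
    using \<phi> by (intro nn_integral_eq_integral P.integrable_const_bound[where B = 1] AE_I2) auto
  have int1: "(\<integral>\<^sup>+w. ennreal (1 - \<phi> w) \<partial>(\<mu> \<bind> K)) = ennreal (\<integral>w. 1 - \<phi> w \<partial>(\<mu> \<bind> K))"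
  proof -
    interpret B: prob_space "\<mu> \<bind> K"
      by (rule prob_space.prob_space_bind[OF \<mu> _ Kmeas]) (use K(2) in auto)
    have "(\<lambda>w. 1 - \<phi> w) \<in> borel_measurable P" by measurable
    then have "(\<lambda>w. 1 - \<phi> w) \<in> borel_measurable (\<mu> \<bind> K)"
      unfolding measurable_cong_sets[OF bind_sets refl] .
    then show ?thesis
      using \<phi>(2) bind_space
      by (intro nn_integral_eq_integral B.integrable_const_bound[where B = 1] AE_I2) auto
  qed
  \<comment> \<open>As \<open>l\<close> has integral 1, the term with 1 / \<epsilon> that the
    pointwise inequality carries on its left becomes a number, and it cancels in the last
    step.\<close>
  have "1 + ennreal (1 / \<epsilon>) = (\<integral>\<^sup>+w. 1 + ennreal (1 / \<epsilon>) * l w \<partial>P)"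
    by (subst nn_integral_add) (auto simp: nn_integral_cmult l1 P.emeasure_space_1)
  also have "\<dots> \<le> (\<integral>\<^sup>+w. ennreal (\<phi> w) + ennreal (1 - \<phi> w) * l w + ennreal (\<epsilon> / 2)
    + ennreal (1 / (2 * \<epsilon>)) * (1 + l w * l w) \<partial>P)"
    by (intro nn_integral_mono second_moment_pointwise) (use \<phi>(2) \<epsilon> in auto)
  also have "\<dots> = (\<integral>\<^sup>+w. ennreal (\<phi> w) \<partial>P) + (\<integral>\<^sup>+w. ennreal (1 - \<phi> w) * l w \<partial>P) + ennreal (\<epsilon> / 2)
    + ennreal (1 / (2 * \<epsilon>)) * (1 + (\<integral>\<^sup>+w. l w * l w \<partial>P))"
    by (simp add: nn_integral_add nn_integral_cmult P.emeasure_space_1)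
  also have "\<dots> \<le> ennreal (\<integral>w. \<phi> w \<partial>P) + ennreal (\<integral>w. 1 - \<phi> w \<partial>(\<mu> \<bind> K)) + ennreal (\<epsilon> / 2)
    + ennreal (1 / (2 * \<epsilon>)) * (1 + ennreal (1 + \<epsilon>\<^sup>2))"
    unfolding typeII int0 int1 by (intro add_mono mult_left_mono l2) auto
  finally have bound: "1 + ennreal (1 / \<epsilon>) \<le> \<dots>" .
  have nonneg: "0 \<le> (\<integral>w. \<phi> w \<partial>P)" "0 \<le> (\<integral>w. 1 - \<phi> w \<partial>(\<mu> \<bind> K))"
    using \<phi>(2) bind_space by (auto intro!: Bochner_Integration.integral_nonneg)
  have "ennreal (1 + 1 / \<epsilon>) \<le> ennreal ((\<integral>w. \<phi> w \<partial>P) + (\<integral>w. 1 - \<phi> w \<partial>(\<mu> \<bind> K)) + \<epsilon> / 2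
    + 1 / (2 * \<epsilon>) * (1 + (1 + \<epsilon>\<^sup>2)))"
    using bound nonneg \<epsilon>
    by (simp add: ennreal_plus[symmetric] ennreal_mult[symmetric] ennreal_1[symmetric] del: ennreal_plus ennreal_1)
  then have "1 + 1 / \<epsilon> \<le> (\<integral>w. \<phi> w \<partial>P) + (\<integral>w. 1 - \<phi> w \<partial>(\<mu> \<bind> K)) + \<epsilon> / 2
    + 1 / (2 * \<epsilon>) * (1 + (1 + \<epsilon>\<^sup>2))"
    using nonneg \<epsilon> by (subst (asm) ennreal_le_iff) (auto intro!: add_nonneg_nonneg)
  also have "1 / (2 * \<epsilon>) * (1 + (1 + \<epsilon>\<^sup>2)) = 1 / \<epsilon> + \<epsilon> / 2"
    using \<epsilon> by (simp add: field_simps power2_eq_square)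
  finally show ?thesis by simp
qed

section \<open>Measurability of the likelihood ratio and its second moment\<close>

lemma borel_measurable_det:
  fixes F :: "'a \<Rightarrow> real mat"
  assumes F: "\<And>q. q \<in> space M \<Longrightarrow> F q \<in> carrier_mat n n"
    and entry: "\<And>i j. i < n \<Longrightarrow> j < n \<Longrightarrow> (\<lambda>q. F q $$ (i, j)) \<in> borel_measurable M"
  shows "(\<lambda>q. Determinant.det (F q)) \<in> borel_measurable M"
proof -
  have "(\<lambda>q. \<Sum>\<pi> | \<pi> permutes {0..<n}. signof \<pi> * (\<Prod>i = 0..<n. F q $$ (i, \<pi> i))) \<in> borel_measurable M"
  proof (intro borel_measurable_sum borel_measurable_times borel_measurable_const borel_measurable_prod entry)
    fix \<pi> i assume "\<pi> \<in> {\<pi>. \<pi> permutes {0..<n}}" "i \<in> {0..<n}"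
    then show "i < n" "\<pi> i < n" using permutes_in_image[of \<pi> "{0..<n}" i] by auto
  qed
  also have "?this \<longleftrightarrow> ?thesis"
    by (rule measurable_cong) (simp add: det_def'[OF F])
  finally show ?thesis .
qed

text \<open>\<open>mat_inverse\<close> runs Gauss-Jordan elimination, whose case distinctions
  obscure measurability; Cramer's rule exhibits the entries as rational functions of the
  matrix.\<close>

lemma mat_inverse_entry:
  fixes A :: "real mat"
  assumes A: "A \<in> carrier_mat n n" and det: "Determinant.det A \<noteq> 0" and ij: "i < n" "j < n"
  shows "the (mat_inverse A) $$ (i, j) = cofactor A j i / Determinant.det A"
proof -
  let ?B = "the (mat_inverse A)"
  note B = det_nonzero_mat_inverse[OF A det]
  have "?B * (A * adj_mat A) = ?B * A * adj_mat A"
    using A B adj_mat(1)[OF A] by (intro assoc_mult_mat[symmetric, of _ n n _ n _ n])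
  also have "\<dots> = adj_mat A"
    using B(3) adj_mat(1)[OF A] by simp
  also have "?B * (A * adj_mat A) = Determinant.det A \<cdot>\<^sub>m ?B"
    unfolding adj_mat(2)[OF A] using mult_smult_distrib[OF B(1), of "1\<^sub>m n" n] B(1) by simp
  finally have "Determinant.det A * ?B $$ (i, j) = adj_mat A $$ (i, j)"
    using B(1) ij by (metis carrier_matD index_smult_mat(1))
  then show ?thesis
    using det A ij by (simp add: adj_mat_def field_simps)
qed

lemma borel_measurable_mat_inverse_entry:
  fixes F :: "'a \<Rightarrow> real mat"
  assumes F: "\<And>q. q \<in> space M \<Longrightarrow> F q \<in> carrier_mat n n"
    and entry: "\<And>i j. i < n \<Longrightarrow> j < n \<Longrightarrow> (\<lambda>q. F q $$ (i, j)) \<in> borel_measurable M"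
    and det: "\<And>q. q \<in> space M \<Longrightarrow> Determinant.det (F q) \<noteq> 0" and ij: "i < n" "j < n"
  shows "(\<lambda>q. the (mat_inverse (F q)) $$ (i, j)) \<in> borel_measurable M"
proof -
  have "(\<lambda>q. Determinant.det (mat_delete (F q) j i)) \<in> borel_measurable M"
  proof (rule borel_measurable_det)
    show "mat_delete (F q) j i \<in> carrier_mat (n - 1) (n - 1)" if "q \<in> space M" for q
      using F[OF that] by (rule mat_delete_carrier)
    fix k l assume kl: "k < n - 1" "l < n - 1"
    have "(\<lambda>q. F q $$ (if k < j then k else Suc k, if l < i then l else Suc l)) \<in> borel_measurable M"
      by (rule entry) (use kl in auto)
    also have "?this \<longleftrightarrow> (\<lambda>q. mat_delete (F q) j i $$ (k, l)) \<in> borel_measurable M"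
      by (rule measurable_cong) (use F kl in \<open>auto simp: mat_delete_def dest!: F\<close>)
    finally show "(\<lambda>q. mat_delete (F q) j i $$ (k, l)) \<in> borel_measurable M" .
  qed
  moreover have "(\<lambda>q. Determinant.det (F q)) \<in> borel_measurable M"
    by (rule borel_measurable_det[OF F entry])
  ultimately have "(\<lambda>q. (-1) ^ (j + i) * Determinant.det (mat_delete (F q) j i) / Determinant.det (F q))
    \<in> borel_measurable M"
    by measurable
  also have "?this \<longleftrightarrow> ?thesis"
    by (rule measurable_cong) (simp add: mat_inverse_entry[OF F det ij] cofactor_def)
  finally show ?thesis .
qed

context coercive_matrix
begin

text \<open>Joint measurability in the spike and the observation is what makes the mixture a kernel
  and allows the order of integration to be exchanged. It is reduced to matrix entries, which
  generate the sigma-algebra of the Stiefel manifold.\<close>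

lemma borel_measurable_gauss_ratio_spiked:
  assumes \<mu>: "uniform_stiefel p r \<mu>" and t: "0 \<le> t"
  shows "(\<lambda>(Q, x). gauss_ratio p S (spiked S t Q) x) \<in> borel_measurable (\<mu> \<Otimes>\<^sub>M gaussian p S)"
proof -
  note sp = uniform_stiefelD(2)[OF \<mu>] and sets = uniform_stiefelD(3)[OF \<mu>]
  have sg: "sets (gaussian p S) = sets (\<Pi>\<^sub>M j\<in>{..<p}. lborel)" by (simp add: gaussian_eq)
  have spd: "pd_mat p (spiked S t Q)" if "Q \<in> space \<mu>" for Q
    using pd_mat_spiked[OF pd stiefel_carrier t] that sp by blast
  have entry: "(\<lambda>Q. spiked S t Q $$ (i, j)) \<in> borel_measurable \<mu>" if ij: "i < p" "j < p" for i j
  proof -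
    have "(\<lambda>Q. S $$ (i, j) + t * (\<Sum>m<r. Q $$ (i, m) * Q $$ (j, m))) \<in> borel_measurable \<mu>"
      using stiefel_space_measurable_entry[OF sets] ij
      by (intro borel_measurable_add borel_measurable_times borel_measurable_sum borel_measurable_const) auto
    also have "?this \<longleftrightarrow> ?thesis"
      using ij carrier
      by (intro measurable_cong)
        (auto simp: sp spiked_def scalar_prod_def atLeast0LessThan dest!: stiefel_carrier)
    finally show ?thesis .
  qed
  have det [measurable]: "(\<lambda>Q. Determinant.det (spiked S t Q)) \<in> borel_measurable \<mu>"
    by (rule borel_measurable_det[OF pd_matD(1)[OF spd] entry])
  have inv [measurable]: "(\<lambda>Q. the (mat_inverse (spiked S t Q)) $$ (i, j)) \<in> borel_measurable \<mu>"
    if "i < p" "j < p" for i j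
  proof (rule borel_measurable_mat_inverse_entry[OF _ entry _ that])
    fix Q assume "Q \<in> space \<mu>"
    then show "spiked S t Q \<in> carrier_mat p p" "Determinant.det (spiked S t Q) \<noteq> 0"
      using pd_matD(1)[OF spd] pd_mat_det_pos[OF spd] by force+
  qed
  have coord [measurable]: "(\<lambda>x. x i) \<in> borel_measurable (gaussian p S)" if "i < p" for i
    unfolding measurable_cong_sets[OF sg refl]
    using measurable_component_singleton[of i "{..<p}" "\<lambda>_. lborel :: real measure"] that by simp
  have "(\<lambda>z. 1 / sqrt ((2 * pi) ^ p * Determinant.det (spiked S t (fst z))) *
      exp (- quad_form p (\<lambda>i j. the (mat_inverse (spiked S t (fst z))) $$ (i, j)) (snd z) / 2)
      / gauss_density p S (snd z)) \<in> borel_measurable (\<mu> \<Otimes>\<^sub>M gaussian p S)"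
  proof -
    have "(\<lambda>z. the (mat_inverse (spiked S t (fst z))) $$ (i, j) * snd z i * snd z j)
      \<in> borel_measurable (\<mu> \<Otimes>\<^sub>M gaussian p S)" if "i < p" "j < p" for i j
      using inv[OF that] coord[OF that(1)] coord[OF that(2)] by measurable
    then have "(\<lambda>z. quad_form p (\<lambda>i j. the (mat_inverse (spiked S t (fst z))) $$ (i, j)) (snd z))
      \<in> borel_measurable (\<mu> \<Otimes>\<^sub>M gaussian p S)"
      unfolding quad_form_def by (intro borel_measurable_sum) auto
    moreover have "gauss_density p S \<in> borel_measurable (gaussian p S)"
      unfolding measurable_cong_sets[OF sg refl] by (rule borel_measurable_gauss_density[OF pd])
    ultimately show ?thesis by measurable
  qed
  also have "?this \<longleftrightarrow> ?thesis"
  proof (rule measurable_cong)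
    fix z assume "z \<in> space (\<mu> \<Otimes>\<^sub>M gaussian p S)"
    then have "fst z \<in> space \<mu>" by (auto simp: space_pair_measure)
    from pd_matD(1)[OF pd_mat_inverse(1)[OF spd[OF this]]]
    show "1 / sqrt ((2 * pi) ^ p * Determinant.det (spiked S t (fst z))) *
      exp (- quad_form p (\<lambda>i j. the (mat_inverse (spiked S t (fst z))) $$ (i, j)) (snd z) / 2)
      / gauss_density p S (snd z) = (case z of (Q, x) \<Rightarrow> gauss_ratio p S (spiked S t Q) x)"
      by (simp add: quad_form_mat gauss_ratio_def gauss_density_def case_prod_unfold)
  qed
  finally show ?thesis .
qed

lemma iid_gaussian_spiked_density:
  assumes Q: "Q \<in> stiefel p r" and t: "0 \<le> t"
  shows "iid_gaussian n p (spiked S t Q) =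
    density (iid_gaussian n p S) (\<lambda>w. \<Prod>i<n. ennreal (gauss_ratio p S (spiked S t Q) (w i)))"
proof -
  have A: "pd_mat p (spiked S t Q)" by (rule pd_mat_spiked[OF pd stiefel_carrier[OF Q] t])
  show ?thesis
    unfolding iid_gaussian_def gaussian_density_ratio[OF pd A]
    by (rule PiM_density)
      (use prob_space_gaussian[OF pd] prob_space_gaussian[OF A] borel_measurable_gauss_ratio[OF pd A]
        gaussian_density_ratio[OF pd A] in auto)
qed

lemma prob_space_iid_gaussian: "pd_mat p A \<Longrightarrow> prob_space (iid_gaussian n p A)"
  unfolding iid_gaussian_def by (intro prob_space_PiM prob_space_gaussian)

text \<open>Independence turns the bound for one observation into its n-th power, so the exponential
  moment is needed at s = n t^2, with \<nu> = 1 / c^2 and tr N \<le> r / c^2. Only W is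
  averaged.\<close>

lemma likelihood_second_moment:
  assumes \<mu>: "uniform_stiefel p r \<mu>" and t: "0 \<le> t" "t \<le> c / 2" and Q: "Q \<in> stiefel p r"
    and small: "8 * (real n * t\<^sup>2) / c\<^sup>2 < real p" "\<epsilon> < 1"
      "real n * t\<^sup>2 * (real r)\<^sup>2 / c\<^sup>2 \<le> \<epsilon> * (real p - 8 * (real n * t\<^sup>2) / c\<^sup>2)"
  defines "L \<equiv> \<lambda>Q w. \<Prod>i<n. ennreal (gauss_ratio p S (spiked S t Q) (w i))"
  shows "(\<integral>\<^sup>+W. \<integral>\<^sup>+w. L Q w * L W w \<partial>iid_gaussian n p S \<partial>\<mu>) \<le> ennreal (1 / (1 - \<epsilon>))"
proof -
  note sp = uniform_stiefelD(2)[OF \<mu>]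
  let ?g = "\<lambda>W. \<Sum>m<r. quad_form p (\<lambda>i j. overlap S Q $$ (i, j)) (\<lambda>i. W $$ (i, m))"
  interpret product_sigma_finite "\<lambda>_::nat. gaussian p S"
    using prob_space_gaussian[OF pd] by (auto simp: product_sigma_finite_def intro: prob_space_imp_sigma_finite)
  have "(\<integral>\<^sup>+w. L Q w * L W w \<partial>iid_gaussian n p S) \<le> ennreal (exp (real n * t\<^sup>2 * ?g W))"
    if "W \<in> space \<mu>" for W
  proof -
    have W: "W \<in> stiefel p r" using that sp by simp
    note AB = pd_mat_spiked[OF pd stiefel_carrier[OF Q] t(1)] pd_mat_spiked[OF pd stiefel_carrier[OF W] t(1)]
    have "(\<integral>\<^sup>+w. L Q w * L W w \<partial>iid_gaussian n p S)
      = (\<integral>\<^sup>+w. (\<Prod>i<n. ennreal (gauss_ratio p S (spiked S t Q) (w i))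
          * ennreal (gauss_ratio p S (spiked S t W) (w i))) \<partial>(\<Pi>\<^sub>M i\<in>{..<n}. gaussian p S))"
      by (simp add: L_def iid_gaussian_def prod.distrib)
    also have "\<dots> = (\<Prod>i<n. \<integral>\<^sup>+x. ennreal (gauss_ratio p S (spiked S t Q) x)
          * ennreal (gauss_ratio p S (spiked S t W) x) \<partial>gaussian p S)"
      using borel_measurable_gauss_ratio[OF pd AB(1)] borel_measurable_gauss_ratio[OF pd AB(2)]
      by (intro product_nn_integral_prod) auto
    also have "\<dots> \<le> (\<Prod>i<n. ennreal (exp (t\<^sup>2 * ?g W)))"
      by (intro prod_mono_ennreal gauss_ratio_spiked_pair[OF Q W t])
    also have "\<dots> = ennreal (exp (real n * t\<^sup>2 * ?g W))"
      by (simp add: ennreal_power exp_of_nat_mult[symmetric] mult.assoc)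
    finally show ?thesis .
  qed
  then have le: "(\<integral>\<^sup>+W. \<integral>\<^sup>+w. L Q w * L W w \<partial>iid_gaussian n p S \<partial>\<mu>)
    \<le> (\<integral>\<^sup>+W. ennreal (exp (real n * t\<^sup>2 * ?g W)) \<partial>\<mu>)"
    by (rule nn_integral_mono)
  have "(\<integral>\<^sup>+W. ennreal (exp (real n * t\<^sup>2 * ?g W)) \<partial>\<mu>) = ennreal (\<integral>W. exp (real n * t\<^sup>2 * ?g W) \<partial>\<mu>)"
    and "(\<integral>W. exp (real n * t\<^sup>2 * ?g W) \<partial>\<mu>) \<le> 1 / (1 - \<epsilon>)"
  proof -
    let ?s = "real n * t\<^sup>2"
    have eps: "0 \<le> \<epsilon>"
    proof -
      have "0 \<le> \<epsilon> * (real p - 8 * ?s / c\<^sup>2)"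
        by (rule order_trans[OF _ small(3)]) simp
      then show ?thesis using small(1) by (simp add: zero_le_mult_iff)
    qed
    have "?s * real r * (\<Sum>i<p. overlap S Q $$ (i, i)) \<le> ?s * real r * (real r / c\<^sup>2)"
      by (intro mult_left_mono overlap_trace_le[OF Q]) simp
    also have "\<dots> = ?s * (real r)\<^sup>2 / c\<^sup>2" by (simp add: power2_eq_square)
    finally have tr: "?s * (\<Sum>i<p. overlap S Q $$ (i, i)) * real r \<le> \<epsilon> * (real p - 8 * ?s * (1 / c\<^sup>2))"
      using small(3) by (simp add: mult_ac)
    have sm: "8 * ?s * (1 / c\<^sup>2) < real p" "0 \<le> ?s" using small(1) by auto
    note M = uniform_stiefel_exp_moment[OF \<mu> overlap_symmetric[OF Q] overlap_square_le[OF Q]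
      overlap_quad_nonneg[OF Q] sm(2) tr sm(1) small(2)]
    show "(\<integral>W. exp (?s * ?g W) \<partial>\<mu>) \<le> 1 / (1 - \<epsilon>)" by (rule M(2)) auto
    show "(\<integral>\<^sup>+W. ennreal (exp (?s * ?g W)) \<partial>\<mu>) = ennreal (\<integral>W. exp (?s * ?g W) \<partial>\<mu>)"
      by (rule nn_integral_eq_integral[OF M(1)]) auto
  qed
  then show ?thesis using order_trans[OF le] by (simp add: ennreal_leI)
qed

end

lemma sets_iid_gaussian: "sets (iid_gaussian n p A) = sets (data_space n p)"
proof -
  have "sets (gaussian p A) = sets (\<Pi>\<^sub>M j\<in>{..<p}. borel)"
    unfolding gaussian_eq by (simp cong: sets_PiM_cong)
  then show ?thesis
    unfolding iid_gaussian_def data_space_def by (intro sets_PiM_cong) auto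
qed

text \<open>Two tolerances are linked here: \<epsilon> controls the second moment through 1 / (1 -
  \<epsilon>), and \<eta> is the loss in the error sum, with \<eta>^2 dominating the excess over
  1.\<close>

lemma (in coercive_matrix) testing_lower_bound:
  assumes \<mu>: "uniform_stiefel p r \<mu>" and t: "0 \<le> \<delta> / (1 - \<delta>)" "\<delta> / (1 - \<delta>) \<le> c / 2"
    and small: "8 * (real n * (\<delta> / (1 - \<delta>))\<^sup>2) / c\<^sup>2 < real p" "\<epsilon> < 1"
      "real n * (\<delta> / (1 - \<delta>))\<^sup>2 * (real r)\<^sup>2 / c\<^sup>2 \<le> \<epsilon> * (real p - 8 * (real n * (\<delta> / (1 - \<delta>))\<^sup>2) / c\<^sup>2)"
      "1 / (1 - \<epsilon>) \<le> 1 + \<eta>\<^sup>2" "0 < \<eta>"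
    and \<phi>: "\<phi> \<in> tests n p"
  shows "1 - \<eta> \<le> type_I_error (H0_law n p S) \<phi> + type_II_error (H1_law n p \<delta> S \<mu>) \<phi>"
proof -
  let ?t = "\<delta> / (1 - \<delta>)"
  let ?P = "iid_gaussian n p S"
  note sp = uniform_stiefelD(2)[OF \<mu>]
  have spaces: "space ?P = space (data_space n p)"
    by (rule sets_eq_imp_space_eq[OF sets_iid_gaussian])
  have "1 - \<eta> \<le> (\<integral>w. \<phi> w \<partial>?P) + (\<integral>w. 1 - \<phi> w \<partial>(\<mu> \<bind> (\<lambda>Q. iid_gaussian n p (spiked S ?t Q))))"
  proof (rule second_moment_testing_bound[where L = "\<lambda>Q w. \<Prod>i<n. ennreal (gauss_ratio p S (spiked S ?t Q) (w i))"])
    show "prob_space \<mu>" by (rule uniform_stiefelD(1)[OF \<mu>])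
    show "prob_space ?P" by (rule prob_space_iid_gaussian[OF pd])
    show "(\<lambda>(Q, w). \<Prod>i<n. ennreal (gauss_ratio p S (spiked S ?t Q) (w i))) \<in> borel_measurable (\<mu> \<Otimes>\<^sub>M ?P)"
      unfolding case_prod_unfold
    proof (intro borel_measurable_prod_ennreal measurable_compose[OF _ measurable_ennreal])
      fix i assume i: "i \<in> {..<n}"
      have "(\<lambda>w. w i) \<in> measurable ?P (gaussian p S)"
        unfolding iid_gaussian_def using i by (rule measurable_component_singleton)
      then have "(\<lambda>z. (fst z, snd z i)) \<in> measurable (\<mu> \<Otimes>\<^sub>M ?P) (\<mu> \<Otimes>\<^sub>M gaussian p S)"
        by measurable
      from measurable_compose[OF this borel_measurable_gauss_ratio_spiked[OF \<mu> t(1)]]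
      show "(\<lambda>z. gauss_ratio p S (spiked S ?t (fst z)) (snd z i)) \<in> borel_measurable (\<mu> \<Otimes>\<^sub>M ?P)"
        by simp
    qed
    fix Q assume "Q \<in> space \<mu>"
    then have Q: "Q \<in> stiefel p r" using sp by simp
    show "iid_gaussian n p (spiked S ?t Q)
      = density ?P (\<lambda>w. \<Prod>i<n. ennreal (gauss_ratio p S (spiked S ?t Q) (w i)))"
      by (rule iid_gaussian_spiked_density[OF Q t(1)])
    show "prob_space (iid_gaussian n p (spiked S ?t Q))"
      by (rule prob_space_iid_gaussian[OF pd_mat_spiked[OF pd stiefel_carrier[OF Q] t(1)]])
    show "(\<integral>\<^sup>+W. \<integral>\<^sup>+w. (\<Prod>i<n. ennreal (gauss_ratio p S (spiked S ?t Q) (w i)))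
        * (\<Prod>i<n. ennreal (gauss_ratio p S (spiked S ?t W) (w i))) \<partial>?P \<partial>\<mu>) \<le> ennreal (1 + \<eta>\<^sup>2)"
      using likelihood_second_moment[OF \<mu> t Q small(1,2,3)] ennreal_leI[OF small(4)] by (rule order_trans)
  next
    show "\<phi> \<in> borel_measurable ?P"
      unfolding measurable_cong_sets[OF sets_iid_gaussian refl] using \<phi> by (simp add: tests_def)
    show "0 \<le> \<phi> w \<and> \<phi> w \<le> 1" if "w \<in> space ?P" for w
      using \<phi> that unfolding spaces by (simp add: tests_def)
  qed (rule small(5))
  then show ?thesis
    by (simp add: type_I_error_def type_II_error_def H0_law_def H1_law_def spiked_def)
qed

section \<open>Rates of the parameters and passage to the limit\<close>

theorem theorem1p4:
  fixes \<alpha> \<beta> c\<^sub>0 \<gamma> :: real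
    and p r :: "nat \<Rightarrow> nat"
    and \<delta> :: "nat \<Rightarrow> real"
    and \<Sigma> :: "nat \<Rightarrow> real mat"
    and \<mu> :: "nat \<Rightarrow> real mat measure"
  assumes "0 < \<alpha>" "\<alpha> < 1" "0 < \<beta>" "\<beta> < 1" "0 < c\<^sub>0" "1 \<le> \<gamma>"
    and "\<And>n. n \<ge> 1 \<Longrightarrow> n \<le> p n"
    and "(\<lambda>n. real (p n) / real n) \<longlonglongrightarrow> \<gamma>"
    and "\<And>n. n \<ge> 1 \<Longrightarrow>
           r n \<in> {nat \<lfloor>real n powr (1 - \<beta>)\<rfloor>, nat \<lceil>real n powr (1 - \<beta>)\<rceil>}"
    and "\<And>n. n \<ge> 1 \<Longrightarrow> \<delta> n = real n powr (- \<alpha>)"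
    and "\<And>n. n \<ge> 1 \<Longrightarrow> covariance_matrix (p n) (\<Sigma> n)"
    and "\<And>n. n \<ge> 1 \<Longrightarrow> uniform_stiefel (p n) (r n) (\<mu> n)"
    and "\<alpha> + \<beta> > 1"
    and "\<And>n. n \<ge> 1 \<Longrightarrow> lambda_min (\<Sigma> n) \<ge> c\<^sub>0"
  shows "(\<lambda>n. INF \<phi> \<in> tests n (p n).
            type_I_error (H0_law n (p n) (\<Sigma> n)) \<phi> +
            type_II_error (H1_law n (p n) (\<delta> n) (\<Sigma> n) (\<mu> n)) \<phi>) \<longlonglongrightarrow> 1"
proof -
  note p_ge = assms(7) and r_eq = assms(9) and \<delta>_eq = assms(10) and cov = assms(11)
    and unif = assms(12) and lam = assms(14)
  define t where "t n = \<delta> n / (1 - \<delta> n)" for n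
  \<comment> \<open>The factor 2 compensates for p - 8 n t^2 / \<open>c\<^sub>0\<^sup>2\<close>
    being estimated from below by n / 2 only.\<close>
  define \<epsilon> where "\<epsilon> n = 2 * (t n * real (r n))\<^sup>2 / c\<^sub>0\<^sup>2" for n
  have one_pos: "(0 :: real) < 1" by simp
  have ge1: "\<forall>\<^sub>F n in sequentially. 1 \<le> n" by (rule eventually_ge_at_top)
  have powr0: "(\<lambda>n. real n powr a) \<longlonglongrightarrow> 0" if "a < 0" for a
    using that by (intro tendsto_neg_powr filterlim_real_sequentially)
  have \<delta>0: "\<delta> \<longlonglongrightarrow> 0"
    by (rule Lim_transform_eventually[OF powr0[of "- \<alpha>"]])
      (use \<delta>_eq assms(1) in \<open>auto intro: eventually_mono[OF ge1]\<close>)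
  have t0: "t \<longlonglongrightarrow> 0"
    unfolding t_def using tendsto_divide[OF \<delta>0 tendsto_diff[OF tendsto_const \<delta>0], of 1] by simp
  have t_nonneg: "\<forall>\<^sub>F n in sequentially. 0 \<le> t n"
    using order_tendstoD(2)[OF \<delta>0 one_pos] ge1
  proof eventually_elim
    case (elim n)
    then show ?case using \<delta>_eq[of n] by (simp add: t_def)
  qed
  \<comment> \<open>The summand 1 covers both roundings; multiplied by t it contributes a term of
    order n powr (- \<alpha>), which vanishes by itself.\<close>
  have r_le: "real (r n) \<le> real n powr (1 - \<beta>) + 1" if "1 \<le> n" for n
  proof -
    let ?x = "real n powr (1 - \<beta>)"
    have x: "0 \<le> ?x" by simp
    then have "real (nat \<lfloor>?x\<rfloor>) \<le> ?x + 1" "real (nat \<lceil>?x\<rceil>) \<le> ?x + 1" by linarith+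
    then show ?thesis using r_eq[OF that] by fastforce
  qed
  \<comment> \<open>This is where \<alpha> + \<beta> > 1 enters: it makes the first exponent
    negative.\<close>
  have "(\<lambda>n. (real n powr (1 - \<alpha> - \<beta>) + real n powr (- \<alpha>)) / (1 - \<delta> n)) \<longlonglongrightarrow> (0 + 0) / (1 - 0)"
    using assms(1,13) by (intro tendsto_intros powr0 \<delta>0) auto
  then have tr_bound: "(\<lambda>n. (real n powr (1 - \<alpha> - \<beta>) + real n powr (- \<alpha>)) / (1 - \<delta> n)) \<longlonglongrightarrow> 0"
    by simp
  have tr0: "(\<lambda>n. t n * real (r n)) \<longlonglongrightarrow> 0"
  proof (rule tendsto_sandwich[OF _ _ tendsto_const tr_bound])
    show "\<forall>\<^sub>F n in sequentially. 0 \<le> t n * real (r n)"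
      using t_nonneg by eventually_elim simp
    show "\<forall>\<^sub>F n in sequentially. t n * real (r n)
      \<le> (real n powr (1 - \<alpha> - \<beta>) + real n powr (- \<alpha>)) / (1 - \<delta> n)"
      using t_nonneg ge1
    proof eventually_elim
      case (elim n)
      have "t n * real (r n) \<le> t n * (real n powr (1 - \<beta>) + 1)"
        using elim r_le by (intro mult_left_mono) auto
      also have "\<dots> = (real n powr (- \<alpha>) * real n powr (1 - \<beta>) + real n powr (- \<alpha>)) / (1 - \<delta> n)"
        using \<delta>_eq[OF elim(2)] by (simp add: t_def distrib_left add_divide_distrib)
      also have "real n powr (- \<alpha>) * real n powr (1 - \<beta>) = real n powr (1 - \<alpha> - \<beta>)"
        by (simp add: powr_add[symmetric] algebra_simps)
      finally show ?case .
    qed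
  qed
  have \<epsilon>0: "\<epsilon> \<longlonglongrightarrow> 0"
  proof -
    have "(\<lambda>n. 2 * (t n * real (r n))\<^sup>2 / c\<^sub>0\<^sup>2) \<longlonglongrightarrow> 2 * 0\<^sup>2 / c\<^sub>0\<^sup>2"
      using assms(5) by (intro tendsto_intros tr0) auto
    then show ?thesis by (simp add: \<epsilon>_def[abs_def])
  qed
  have inv_\<epsilon>: "(\<lambda>n. 1 / (1 - \<epsilon> n)) \<longlonglongrightarrow> 1"
    using tendsto_divide[OF tendsto_const tendsto_diff[OF tendsto_const \<epsilon>0], of 1 1] by simp
  show ?thesis
  proof (rule LIMSEQ_I, goal_cases)
    case (1 \<kappa>)
    define \<eta> where "\<eta> = \<kappa> / 2"
    have \<eta>: "0 < \<eta>" "\<eta> < \<kappa>" using 1 by (auto simp: \<eta>_def)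
    let ?f = "\<lambda>n \<phi>. type_I_error (H0_law n (p n) (\<Sigma> n)) \<phi> +
      type_II_error (H1_law n (p n) (\<delta> n) (\<Sigma> n) (\<mu> n)) \<phi>"
    \<comment> \<open>For t < \<open>c\<^sub>0\<close> / 4 the correction 8 n t^2 /
      \<open>c\<^sub>0\<^sup>2\<close> is at most n / 2, so at least half of n remains because p
      \<ge> n; the condition t \<le> \<open>c\<^sub>0\<close> / 2 of the testing bound follows as
      well.\<close>
    have pos: "0 < c\<^sub>0 / 4" "1 < 1 + \<eta>\<^sup>2" using assms(5) \<eta> by auto
    have "\<forall>\<^sub>F n in sequentially. norm ((INF \<phi> \<in> tests n (p n). ?f n \<phi>) - 1) < \<kappa>"
      using ge1 t_nonneg order_tendstoD(2)[OF t0 pos(1)] order_tendstoD(2)[OF \<epsilon>0 one_pos]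
        order_tendstoD(2)[OF inv_\<epsilon> pos(2)]
    proof eventually_elim
      case (elim n)
      note n = elim(1) and t_n = elim(2,3)
      have p0: "0 < p n" using p_ge[OF n] n by simp
      have pn: "real n \<le> real (p n)" "0 < real n" using p_ge[OF n] n by auto
      interpret coercive_matrix "p n" "\<Sigma> n" "c\<^sub>0"
      proof
        show "\<Sigma> n \<in> carrier_mat (p n) (p n)" "(\<Sigma> n)\<^sup>T = \<Sigma> n"
          using cov[OF n] by (auto simp: covariance_matrix_def)
        show "0 < c\<^sub>0" by fact
        fix v :: "real vec" assume v: "v \<in> carrier_vec (p n)"
        have "c\<^sub>0 * scalar_prod v v \<le> lambda_min (\<Sigma> n) * scalar_prod v v"
          by (rule mult_right_mono[OF lam[OF n] scalar_prod_self_nonneg])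
        also have "\<dots> \<le> mat_form (\<Sigma> n) v" by (rule lambda_min_le_mat_form[OF cov[OF n] p0 v])
        finally show "c\<^sub>0 * scalar_prod v v \<le> mat_form (\<Sigma> n) v" .
      qed
      have "(t n)\<^sup>2 \<le> (c\<^sub>0 / 4)\<^sup>2" using t_n by (intro power_mono) auto
      then have "8 * (real n * (t n)\<^sup>2) / c\<^sub>0\<^sup>2 \<le> 8 * (real n * (c\<^sub>0 / 4)\<^sup>2) / c\<^sub>0\<^sup>2"
        by (intro divide_right_mono mult_left_mono) auto
      also have "\<dots> = real n / 2" using assms(5) by (simp add: power2_eq_square)
      finally have half: "8 * (real n * (t n)\<^sup>2) / c\<^sub>0\<^sup>2 \<le> real n / 2" .
      have small1: "8 * (real n * (t n)\<^sup>2) / c\<^sub>0\<^sup>2 < real (p n)" using half pn by linarith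
      have "real n * (t n)\<^sup>2 * (real (r n))\<^sup>2 / c\<^sub>0\<^sup>2 = \<epsilon> n * (real n / 2)"
        by (simp add: \<epsilon>_def power_mult_distrib)
      also have "\<dots> \<le> \<epsilon> n * (real (p n) - 8 * (real n * (t n)\<^sup>2) / c\<^sub>0\<^sup>2)"
        using half pn by (intro mult_left_mono) (auto simp: \<epsilon>_def)
      finally have small2: "real n * (t n)\<^sup>2 * (real (r n))\<^sup>2 / c\<^sub>0\<^sup>2
        \<le> \<epsilon> n * (real (p n) - 8 * (real n * (t n)\<^sup>2) / c\<^sub>0\<^sup>2)" .
      have lower: "1 - \<eta> \<le> ?f n \<phi>" if "\<phi> \<in> tests n (p n)" for \<phi>
        by (rule testing_lower_bound[OF unif[OF n], where \<epsilon> = "\<epsilon> n"])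
          (use t_n small1 small2 elim \<eta> assms(5) that in \<open>auto simp: t_def[symmetric]\<close>)
      \<comment> \<open>The test that always rejects has error sum exactly 1. It bounds the infimum
        from above and makes the set of tests nonempty, while \<open>lower\<close> bounds the error
        sums from below, as an infimum of reals requires.\<close>
      have one: "(\<lambda>_. 1) \<in> tests n (p n)" by (simp add: tests_def)
      have f1: "?f n (\<lambda>_. 1) = 1"
        using prob_space.prob_space[OF prob_space_iid_gaussian[OF pd], of n]
        by (simp add: type_I_error_def type_II_error_def H0_law_def)
      have "1 - \<eta> \<le> (INF \<phi> \<in> tests n (p n). ?f n \<phi>)"
        by (rule cINF_greatest) (use one lower in auto)
      moreover have "(INF \<phi> \<in> tests n (p n). ?f n \<phi>) \<le> ?f n (\<lambda>_. 1)"
        by (rule cINF_lower[OF _ one]) (use lower in \<open>auto simp: bdd_below_def\<close>)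
      ultimately show ?case using f1 \<eta> by simp
    qed
    then show ?case by (simp add: eventually_sequentially)
  qed
qed

end
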